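(* Let $d\ge 1$, $H\in(\tfrac12,1)$, $0<t_0<T$, fix $M>0$, and assume $\beta\in\big(2H-1,\ d\wedge(2H+1)\big)$. Let $u$ be the mild solution of the linear stochastic wave equation with zero initial conditions driven by the fractional-colored noise $W$ with Hurst index $H$ and Riesz spatial covariance of parameter $\beta$ (as defined in the context). Put $$\Delta\big((t,x);(s,y)\big)=|t-s|^{2H+1-\beta}+|x-y|^{2H+1-\beta}.$$ Then there exist positive constants $C_1,C_2$ such that for every $t,s\in[t_0,T]$ and $x,y\in[-M,M]^d$ $$C_1\,\Delta\big((t,x);(s,y)\big)\ \le\ \mathbf{E}\,|u(t,x)-u(s,y)|^2\ \le\ C_2\,\Delta\big((t,x);(s,y)\big).$$
   Context: Fourier transform convention: $\mathcal F\varphi(\xi)=\int_{\mathbb R^d}e^{-i\xi\cdot x}\varphi(x)\,dx$. Let $\mu(d\xi)=|\xi|^{-d+\beta}d\xi$ on $\mathbb R^d$, $0<\beta<d$, and let $f$ be the Fourier transform of $\mu$ in $\mathcal S'(\mathbb R^d)$, i.e. $\int f\varphi\,dx=\int\mathcal F\varphi\,d\mu$ for $\varphi\in\mathcal S(\mathbb R^d)$ (the Riesz kernel, a constant multiple of $|x|^{-\beta}$). Let $R_H(t,s)=\frac12(t^{2H}+s^{2H}-|t-s|^{2H})$ and $\alpha_H=H(2H-1)$. The noise $W=\{W_t(A):t\ge0,\ A\subset\mathbb R^d \text{ bounded Borel}\}$ is a centered Gaussian family with covariance $\mathbf E(W_t(A)W_s(B))=R_H(t,s)\int_A\int_B f(x-y)\,dx\,dy$.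 The Hilbert space $\mathcal{HP}$ is the completion of the linear span of the functions $1_{[0,t]\times A}$ for the inner product $\langle\varphi,\psi\rangle_{\mathcal{HP}}=\alpha_H\int_{\mathbb R^d}\int_0^\infty\int_0^\infty\mathcal F\varphi(r,\cdot)(\xi)\overline{\mathcal F\psi(v,\cdot)(\xi)}|r-v|^{2H-2}\,dr\,dv\,\mu(d\xi)$, and $1_{[0,t]\times A}\mapsto W_t(A)$ extends to an isometry $\varphi\mapsto W(\varphi)=\int_0^\infty\int_{\mathbb R^d}\varphi\,dW$ from $\mathcal{HP}$ into $L^2(\Omega)$. The stochastic wave equation is $\partial_t^2u=\Delta u+\dot W$ on $(0,\infty)\times\mathbb R^d$, $u(0,\cdot)=0$, $\partial_tu(0,\cdot)=0$. Let $G_1$ be the fundamental solution of $u_{tt}-\Delta u=0$, with $\mathcal FG_1(t,\cdot)(\xi)=\sin(t|\xi|)/|\xi|$. The (mild) solution is the centered Gaussian process $u(t,x)=\int_0^t\int_{\mathbb R^d}G_1(t-s,x-y)\,W(ds,dy)$, i.e. $u(t,x)=W(g_{t,x})$ with $g_{t,x}=G_1(t-\cdot,x-\cdot)1_{[0,t]}$; it is well defined for $\beta\in(0,d\wedge(2H+1))$. Equivalently, $u$ is centered Gaussian with $$\mathbf E[u(t,x)u(s,y)]=\alpha_H\int_{\mathbb R^d}\mu(d\xi)\,e^{-i\xi\cdot(x-y)}\int_0^t\int_0^s\frac{\sin((t-r)|\xi|)\,\sin((s-v)|\xi|)}{|\xi|^2}\,|r-v|^{2H-2}\,dv\,dr .$$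 *)

theory Defs
  imports "HOL-Probability.Probability"
begin

section \<open>Fourier transform and the Riesz kernel\<close>

definition fourier :: "(real^'n \<Rightarrow> complex) \<Rightarrow> real^'n \<Rightarrow> complex" where
  "fourier \<phi> \<xi> = (LINT x|lborel. exp (- (\<i> * complex_of_real (\<xi> \<bullet> x))) * \<phi> x)"

definition partial_deriv :: "'n \<Rightarrow> (real^'n \<Rightarrow> complex) \<Rightarrow> real^'n \<Rightarrow> complex" where
  "partial_deriv i \<phi> x = frechet_derivative \<phi> (at x) (axis i 1)"

text \<open>Frechet differentiability of all iterated partial derivatives is the same as
  being of class \<open>C\<^sup>\<infinity>\<close>.\<close>

definition schwartz :: "(real^'n \<Rightarrow> complex) \<Rightarrow> bool" where
  "schwartz \<phi> \<longleftrightarrow> (\<forall>is. foldr partial_deriv is \<phi> differentiable_on UNIV \<and>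
     (\<forall>k. \<exists>B. \<forall>x. norm x ^ k * norm (foldr partial_deriv is \<phi> x) \<le> B))"

definition riesz_measure :: "real \<Rightarrow> (real^'n) measure" where
  "riesz_measure \<beta> = density lborel (\<lambda>\<xi>. ennreal (norm \<xi> powr (\<beta> - real CARD('n))))"

text \<open>The tempered distribution \<open>\<phi> \<mapsto> \<integral> \<F>\<phi> d\<mu>\<close> is represented by the function \<open>f\<close>.\<close>

definition tempered_fourier_transform ::
    "(real^'n) measure \<Rightarrow> (real^'n \<Rightarrow> real) \<Rightarrow> bool" where
  "tempered_fourier_transform \<mu> f \<longleftrightarrow> f \<in> borel_measurable borel \<and>
     (\<forall>\<phi>. schwartz \<phi> \<longrightarrow>
        integrable lborel (\<lambda>x. complex_of_real (f x) * \<phi> x) \<and>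
        integrable \<mu> (fourier \<phi>) \<and>
        (LINT x|lborel. complex_of_real (f x) * \<phi> x) = (LINT \<xi>|\<mu>. fourier \<phi> \<xi>))"

section \<open>The fractional-colored noise\<close>

text \<open>Degenerate (almost surely zero) variables count as Gaussian.\<close>

definition centered_gaussian_rv :: "'w measure \<Rightarrow> ('w \<Rightarrow> real) \<Rightarrow> bool" where
  "centered_gaussian_rv P X \<longleftrightarrow> X \<in> borel_measurable P \<and>
     ((AE \<omega> in P. X \<omega> = 0) \<or> (\<exists>\<sigma>>0. distributed P lborel X (normal_density 0 \<sigma>)))"

definition centered_gaussian_family :: "'w measure \<Rightarrow> 'i set \<Rightarrow> ('i \<Rightarrow> 'w \<Rightarrow> real) \<Rightarrow> bool" where
  "centered_gaussian_family P I X \<longleftrightarrow>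
     (\<forall>J c. finite J \<longrightarrow> J \<subseteq> I \<longrightarrow> centered_gaussian_rv P (\<lambda>\<omega>. \<Sum>j\<in>J. c j * X j \<omega>))"

definition fbm_cov :: "real \<Rightarrow> real \<Rightarrow> real \<Rightarrow> real" where
  "fbm_cov H t s = (t powr (2*H) + s powr (2*H) - \<bar>t - s\<bar> powr (2*H)) / 2"

definition noise_index :: "(real \<times> (real^'n) set) set" where
  "noise_index = {(t, A). 0 \<le> t \<and> bounded A \<and> A \<in> sets borel}"

definition fractional_colored_noise ::
    "'w measure \<Rightarrow> real \<Rightarrow> (real^'n \<Rightarrow> real) \<Rightarrow> (real \<Rightarrow> (real^'n) set \<Rightarrow> 'w \<Rightarrow> real) \<Rightarrow> bool" where
  "fractional_colored_noise P H f W \<longleftrightarrow>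
     centered_gaussian_family P noise_index (\<lambda>(t, A). W t A) \<and>
     (\<forall>(t, A)\<in>noise_index. \<forall>(s, B)\<in>noise_index.
        (LINT \<omega>|P. W t A \<omega> * W s B \<omega>) =
          fbm_cov H t s * (LINT x:A|lborel. LINT y:B|lborel. f (x - y)))"

section \<open>The space HP and the Wiener integral\<close>

text \<open>Elements of HP need not be functions of the space variable, so they are given here
  by their spatial Fourier transforms \<open>\<Phi> r \<xi> = \<F>\<phi>(r,\<cdot>)(\<xi>)\<close>, in terms of which the inner product
  is expressed. The integral over \<open>(r, v)\<close> has to be taken first: for \<open>\<beta> \<ge> 2\<close> the triple
  integral is not absolutely convergent for the wave kernel.\<close>

definition hp_density ::
    "real \<Rightarrow> (real \<Rightarrow> real^'n \<Rightarrow> complex) \<Rightarrow> (real \<Rightarrow> real^'n \<Rightarrow> complex) \<Rightarrow> real^'n \<Rightarrow> complex" where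
  "hp_density H \<Phi> \<Psi> \<xi> =
     (LINT v:{0<..}|lborel. LINT r:{0<..}|lborel.
        \<Phi> r \<xi> * cnj (\<Psi> v \<xi>) * complex_of_real (\<bar>r - v\<bar> powr (2*H - 2)))"

definition hp_inner ::
    "real \<Rightarrow> real \<Rightarrow> (real \<Rightarrow> real^'n \<Rightarrow> complex) \<Rightarrow> (real \<Rightarrow> real^'n \<Rightarrow> complex) \<Rightarrow> complex" where
  "hp_inner H \<beta> \<Phi> \<Psi> =
     complex_of_real (H * (2*H - 1)) * (LINT \<xi>|riesz_measure \<beta>. hp_density H \<Phi> \<Psi> \<xi>)"

text \<open>Integrability is required explicitly because a divergent Bochner integral has value \<open>0\<close>.\<close>

definition hp_tendsto ::
    "real \<Rightarrow> real \<Rightarrow> (nat \<Rightarrow> real \<Rightarrow> real^'n \<Rightarrow> complex) \<Rightarrow> (real \<Rightarrow> real^'n \<Rightarrow> complex) \<Rightarrow> bool" where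
  "hp_tendsto H \<beta> \<Phi> \<Psi> \<longleftrightarrow>
     (let D = (\<lambda>n r \<xi>. \<Phi> n r \<xi> - \<Psi> r \<xi>) in
        (\<forall>n. integrable (riesz_measure \<beta>) (hp_density H (D n) (D n))) \<and>
        (\<lambda>n. hp_inner H \<beta> (D n) (D n)) \<longlonglongrightarrow> 0)"

text \<open>The linear combination \<open>\<Sum> c(t,A) 1\<^bsub>[0,t]\<times>A\<^esub>\<close> over a finite set \<open>S\<close> of pairs \<open>(t,A)\<close>,
  and its stochastic integral.\<close>

definition elementary_fun ::
    "(real \<times> (real^'n) set) set \<Rightarrow> (real \<times> (real^'n) set \<Rightarrow> real) \<Rightarrow> real \<Rightarrow> real^'n \<Rightarrow> real" where
  "elementary_fun S c r x = (\<Sum>(t, A)\<in>S. c (t, A) * indicator ({0..t} \<times> A) (r, x))"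

definition elementary_integral ::
    "(real \<Rightarrow> (real^'n) set \<Rightarrow> 'w \<Rightarrow> real) \<Rightarrow>
     (real \<times> (real^'n) set) set \<Rightarrow> (real \<times> (real^'n) set \<Rightarrow> real) \<Rightarrow> 'w \<Rightarrow> real" where
  "elementary_integral W S c \<omega> = (\<Sum>(t, A)\<in>S. c (t, A) * W t A \<omega>)"

text \<open>\<open>X\<close> is (a version of) \<open>W(\<phi>)\<close>, where \<open>\<phi>\<close> is the element of the completion with spatial
  Fourier transform \<open>\<Phi>\<close>: the isometric extension is the \<open>L\<^sup>2\<close>-limit along elementary functions
  converging to \<open>\<phi>\<close> in HP.\<close>

definition is_wiener_integral ::
    "'w measure \<Rightarrow> real \<Rightarrow> real \<Rightarrow> (real \<Rightarrow> (real^'n) set \<Rightarrow> 'w \<Rightarrow> real) \<Rightarrow>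
     (real \<Rightarrow> real^'n \<Rightarrow> complex) \<Rightarrow> ('w \<Rightarrow> real) \<Rightarrow> bool" where
  "is_wiener_integral P H \<beta> W \<Phi> X \<longleftrightarrow>
     X \<in> borel_measurable P \<and> integrable P (\<lambda>\<omega>. (X \<omega>)\<^sup>2) \<and>
     (\<exists>S c. (\<forall>n::nat. finite (S n) \<and> S n \<subseteq> noise_index) \<and>
        hp_tendsto H \<beta>
          (\<lambda>n r. fourier (\<lambda>x. complex_of_real (elementary_fun (S n) (c n) r x))) \<Phi> \<and>
        (\<lambda>n. LINT \<omega>|P. (elementary_integral W (S n) (c n) \<omega> - X \<omega>)\<^sup>2) \<longlonglongrightarrow> 0)"

section \<open>The stochastic wave equation\<close>

text \<open>Fourier transform of the fundamental solution \<open>G\<^sub>1(t,\<cdot>)\<close>, a function only for \<open>d \<le> 2\<close>.\<close>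

definition wave_kernel_ft :: "real \<Rightarrow> real^'n \<Rightarrow> complex" where
  "wave_kernel_ft t \<xi> =
     complex_of_real (if \<xi> = 0 then t else sin (t * norm \<xi>) / norm \<xi>)"

text \<open>Fourier transform in \<open>y\<close> of \<open>g\<^bsub>t,x\<^esub>(r,y) = G\<^sub>1(t - r, x - y) 1\<^bsub>[0,t]\<^esub>(r)\<close>; reflection
  plus translation gives the phase and \<open>\<F>G\<^sub>1(t - r)(-\<xi>)\<close>, which is even in \<open>\<xi>\<close>.\<close>

definition wave_integrand_ft :: "real \<Rightarrow> real^'n \<Rightarrow> real \<Rightarrow> real^'n \<Rightarrow> complex" where
  "wave_integrand_ft t x r \<xi> =
     indicator {0..t} r * exp (- (\<i> * complex_of_real (\<xi> \<bullet> x))) * wave_kernel_ft (t - r) (- \<xi>)"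

definition mild_solution ::
    "'w measure \<Rightarrow> real \<Rightarrow> real \<Rightarrow> (real \<Rightarrow> (real^'n) set \<Rightarrow> 'w \<Rightarrow> real) \<Rightarrow>
     (real \<Rightarrow> real^'n \<Rightarrow> 'w \<Rightarrow> real) \<Rightarrow> bool" where
  "mild_solution P H \<beta> W u \<longleftrightarrow>
     (\<forall>t\<ge>0. \<forall>x. is_wiener_integral P H \<beta> W (wave_integrand_ft t x) (u t x))"

definition Delta :: "real \<Rightarrow> real \<Rightarrow> real \<times> (real^'n) \<Rightarrow> real \<times> (real^'n) \<Rightarrow> real" where
  "Delta H \<beta> p q =
     \<bar>fst p - fst q\<bar> powr (2*H + 1 - \<beta>) + norm (snd p - snd q) powr (2*H + 1 - \<beta>)"

end

theory Submission imports Defs begin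

text \<open>Write \<open>\<mu>\<close> for the measure \<open>\<bar>\<xi>\<bar> powr (\<beta> - d) d\<xi>\<close>, \<open>\<rho> = \<bar>\<xi>\<bar>\<close> and \<open>L = max \<bar>t - s\<bar> \<bar>x - y\<bar>\<close>.
  The solution is a Wiener integral, so the variance of \<open>u(t,x) - u(s,y)\<close> is comparable to
  \<open>\<integral> N(\<xi>) \<mu>(d\<xi>)\<close>, where \<open>N(\<xi>)\<close> is the quadratic form
  \<open>\<integral>\<integral> h(r) cnj (h(v)) \<bar>r - v\<bar> powr (2H - 2) dr dv\<close> at the time profile \<open>h\<close> that the difference of
  the two wave kernels has at frequency \<open>\<xi>\<close>. Everything follows from pointwise bounds on \<open>N\<close> and a scaling.

  On the common time interval the profile is a sum \<open>A exp(-i\<rho>r) + B exp(i\<rho>r)\<close> of two exponentials with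
  \<open>\<bar>A\<bar>\<^sup>2 + \<bar>B\<bar>\<^sup>2 = (1 - cos (\<xi> \<bullet> (x - y)) cos (\<rho> (t - s))) / \<rho>\<^sup>2\<close>; call the numerator the phase defect.

  For the lower bound, the kernel \<open>\<bar>r - v\<bar> powr (2H - 2)\<close> is factorised through
  \<open>(w - r) powr (H - 3/2)\<close> and \<open>(w - v) powr (H - 3/2)\<close>, integrated over all \<open>w\<close> later than \<open>r\<close> and \<open>v\<close>
  (\<open>causal_kernel_factorisation\<close>). The form becomes the squared \<open>L\<^sup>2\<close> norm of a causal smoothing of \<open>h\<close>,
  and restricting to \<open>w < t\<^sub>0\<close> leaves an expression that involves only the exponentials, whatever \<open>h\<close>
  does later. Smoothing multiplies an exponential by \<open>\<rho> powr (1/2 - H)\<close> and a slowly varying factor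
  bounded away from \<open>0\<close>, so for large \<open>\<rho>\<close> the form is at least a constant times
  \<open>\<rho> powr (-1 - 2H)\<close> times the phase defect (\<open>wave_energy_lower\<close>). For the upper bound, cancellation of
  \<open>exp(i\<rho>v)\<close> against the kernel gives the same power of \<open>\<rho>\<close>, times \<open>min 1 ((L\<rho>)\<^sup>2)\<close>, at every nonzero frequency
  (\<open>wave_energy_upper\<close>).

  Substituting \<open>\<eta> = L\<xi>\<close> produces the factor \<open>L powr (2H + 1 - \<beta>)\<close>. Above, it multiplies
  \<open>\<integral> min 1 (\<bar>\<eta>\<bar>\<^sup>2) \<bar>\<eta>\<bar> powr (\<beta> - 2H - 1 - d) d\<eta>\<close>, which converges precisely for \<open>2H - 1 < \<beta> < 2H + 1\<close>.
  Below, integration is restricted to a shell \<open>R \<le> \<bar>\<eta>\<bar> \<le> 2R\<close>, with \<open>R\<close> so large that every \<open>\<xi> = \<eta>/L\<close>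
  is a high frequency for all \<open>L\<close> that occur; the defect integrated over the shell is continuous and
  positive on the compact set of normalised increments (\<open>shell_defect_uniform\<close>).

  Comparing the variance with \<open>\<integral> N d\<mu>\<close> requires the isometry between noise and spectral inner
  product. The covariance \<open>f\<close> is tied to \<open>\<mu>\<close> only through Schwartz functions; testing with Gaussians and
  letting their width tend to \<open>0\<close> extends the identity to indicators of bounded Borel sets
  (\<open>indicator_isometry\<close>), hence to elementary integrands. The solution is an \<open>L\<^sup>2\<close> limit of elementary
  integrals whose integrands converge in the energy form, and both sides pass to the limit up to a
  factor \<open>4\<close>, which a two-sided bound can absorb (\<open>variance_comparison\<close>).\<close>

section \<open>Oscillatory integrals against a power\<close>

text \<open>Carries improper gauge integrals of nonnegative functions over to the Lebesgue integral.\<close>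

lemma lborel_set_integral_nonneg:
  fixes f :: "'a::euclidean_space \<Rightarrow> real"
  assumes [measurable]: "f \<in> borel_measurable borel" "S \<in> sets borel"
    and nonneg: "\<And>x. x \<in> S \<Longrightarrow> 0 \<le> f x" and I: "(f has_integral I) S"
  shows "set_integrable lborel S f" and "(LINT x:S|lborel. f x) = I"
proof -
  define g where "g = (\<lambda>x. indicator S x *\<^sub>R f x)"
  have gm: "g \<in> borel_measurable borel" unfolding g_def by measurable
  have gn: "0 \<le> g x" for x using nonneg by (auto simp: g_def indicator_def)
  have "(g has_integral I) UNIV"
  proof -
    have "g = (\<lambda>x. if x \<in> S then f x else 0)" by (auto simp: g_def indicator_def)
    then show ?thesis using I by (simp add: has_integral_restrict_UNIV)
  qed
  with gm gn have "integral\<^sup>N lborel g = I"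
    by (intro nn_integral_has_integral_lborel)
  moreover have "0 \<le> I" using I nonneg by (rule has_integral_nonneg)
  ultimately have "has_bochner_integral lborel g I"
    using gm gn by (intro has_bochner_integral_nn_integral) auto
  then show "set_integrable lborel S f" "(LINT x:S|lborel. f x) = I"
    by (auto simp: has_bochner_integral_iff set_integrable_def set_lebesgue_integral_def g_def)
qed

lemma powr_set_integral:
  fixes p x :: real
  assumes "0 < p" "0 \<le> x"
  shows "set_integrable lborel {0..x} (\<lambda>v. v powr (p - 1))"
    and "(LINT v:{0..x}|lborel. v powr (p - 1)) = x powr p / p"
  using lborel_set_integral_nonneg[OF _ _ _ has_integral_powr_from_0[of "p - 1" x]] assms
  by auto

text \<open>An incomplete Gamma integral on the imaginary axis.\<close>

definition osc :: "real \<Rightarrow> real \<Rightarrow> complex" where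
  "osc p x = (LINT v:{0..x}|lborel. cis v * complex_of_real (v powr (p - 1)))"

lemma borel_measurable_cis [measurable]: "cis \<in> borel_measurable borel"
  by (intro borel_measurable_continuous_onI continuous_intros)

lemma set_integrable_osc:
  assumes "0 < p" "0 \<le> a"
  shows "set_integrable lborel {a..b} (\<lambda>v. cis (\<rho> * v) * complex_of_real (v powr (p - 1)))"
proof (cases "a \<le> b")
  case True
  have "set_integrable lborel {0..b} (\<lambda>v. v powr (p - 1))"
    using powr_set_integral(1) assms True by simp
  then have "set_integrable lborel {a..b} (\<lambda>v. v powr (p - 1))"
    by (rule set_integrable_subset) (use assms in auto)
  then show ?thesis
    unfolding set_integrable_def
    by (rule Bochner_Integration.integrable_bound)
       (auto simp: norm_mult indicator_def)
qed (simp add: set_integrable_def)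

lemma osc_diff:
  assumes "0 < p" "0 \<le> a" "a \<le> b"
  shows "(LINT v:{a..b}|lborel. cis v * complex_of_real (v powr (p - 1))) = osc p b - osc p a"
proof -
  have "(LINT v:{0..a}\<union>{a..b}|lborel. cis v * complex_of_real (v powr (p - 1))) =
      osc p a + (LINT v:{a..b}|lborel. cis v * complex_of_real (v powr (p - 1)))"
    unfolding osc_def
  proof (rule set_integral_Un_AE)
    show "AE x in lborel. \<not> (x \<in> {0..a} \<and> x \<in> {a..b})"
      using AE_lborel_singleton[of a] by eventually_elim auto
  qed (use set_integrable_osc[where \<rho>=1 and p=p] assms in \<open>auto simp: set_integrable_def\<close>)
  moreover have "{0..a}\<union>{a..b} = {0..b}" using assms by auto
  ultimately show ?thesis by (simp add: osc_def)
qed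

text \<open>At distance \<open>a\<close> from the singularity the integrand has modulus at most \<open>a powr (p - 1)\<close>. Hence \<open>osc\<close>
  varies slowly at infinity, and its values at two points a quarter period apart are nearly equal.\<close>

lemma norm_osc_diff_le:
  assumes "0 < p" "p \<le> 1" "0 < a" "a \<le> b"
  shows "norm (osc p b - osc p a) \<le> (b - a) * a powr (p - 1)"
proof -
  have "norm (osc p b - osc p a) \<le>
      (LINT v|lborel. norm (indicator {a..b} v *\<^sub>R (cis v * complex_of_real (v powr (p - 1)))))"
    unfolding osc_diff[OF assms(1) less_imp_le[OF assms(3)] assms(4), symmetric] set_lebesgue_integral_def
    by (rule integral_norm_bound)
  also have "\<dots> \<le> (LINT v|lborel. indicator {a..b} v *\<^sub>R a powr (p - 1))"
  proof (rule integral_mono)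
    show "integrable lborel (\<lambda>v. norm (indicator {a..b} v *\<^sub>R (cis v * complex_of_real (v powr (p - 1)))))"
      using set_integrable_osc[of p a b 1] assms by (intro integrable_norm) (auto simp: set_integrable_def)
    show "integrable lborel (\<lambda>v. indicator {a..b} v *\<^sub>R a powr (p - 1))"
      using borel_integrable_atLeastAtMost'[of a b "\<lambda>_. a powr (p - 1)"] by (simp add: set_integrable_def)
  qed (use assms in \<open>auto simp: norm_mult indicator_def intro!: powr_mono2'\<close>)
  also have "\<dots> = (b - a) * a powr (p - 1)" using assms by simp
  finally show ?thesis .
qed

definition cis_prim :: "real \<Rightarrow> complex" where
  "cis_prim v = (cis v - 1) / \<i>"

text \<open>The primitive \<open>cis_prim\<close> of \<open>cis\<close> is bounded and has imaginary part \<open>1 - cos\<close>. Boundedness makes the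
  remaining integral converge absolutely, and the sign of the imaginary part excludes cancellation.\<close>

lemma osc_by_parts:
  assumes "1 \<le> (x::real)"
  shows "(LINT v:{1..x}|lborel. cis v * complex_of_real (v powr (p - 1))) =
    cis_prim x * complex_of_real (x powr (p - 1)) - cis_prim 1 +
      complex_of_real (1 - p) * (LINT v:{1..x}|lborel. cis_prim v * complex_of_real (v powr (p - 2)))"
    and "set_integrable lborel {1..x} (\<lambda>v. cis_prim v * complex_of_real (v powr (p - 2)))"
proof -
  have cE: "continuous_on {1..x} (\<lambda>v. cis_prim v * complex_of_real (v powr (p - 2)))"
    unfolding cis_prim_def by (intro continuous_intros) auto
  have cC: "continuous_on {1..x} (\<lambda>v. cis v * complex_of_real (v powr (p - 1)))"
    by (intro continuous_intros) auto
  show iE: "set_integrable lborel {1..x} (\<lambda>v. cis_prim v * complex_of_real (v powr (p - 2)))"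
    by (rule borel_integrable_atLeastAtMost'[OF cE])
  have iC: "set_integrable lborel {1..x} (\<lambda>v. cis v * complex_of_real (v powr (p - 1)))"
    by (rule borel_integrable_atLeastAtMost'[OF cC])
  have E': "(cis_prim has_vector_derivative cis v) (at v within A)" for v A
    unfolding cis_prim_def cis_conv_exp
    by (rule has_vector_derivative_real_field[where f="\<lambda>z. (exp (\<i> * z) - 1) / \<i>"])
      (auto intro!: derivative_eq_intros simp: algebra_simps simp flip: power2_eq_square)
  have d: "((\<lambda>v. cis_prim v * complex_of_real (v powr (p - 1))) has_vector_derivative
      cis v * complex_of_real (v powr (p - 1)) - complex_of_real (1 - p) * (cis_prim v * complex_of_real (v powr (p - 2))))
      (at v within {1..x})" if "1 \<le> v" "v \<le> x" for v
  proof -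
    have "((\<lambda>v. v powr (p - 1)) has_real_derivative (p - 1) * v powr (p - 2)) (at v within {1..x})"
      using that by (auto intro!: derivative_eq_intros simp: algebra_simps)
    then have "((\<lambda>v. complex_of_real (v powr (p - 1))) has_vector_derivative
        complex_of_real ((p - 1) * v powr (p - 2))) (at v within {1..x})"
      by (intro has_vector_derivative_of_real) (simp add: has_real_derivative_iff_has_vector_derivative)
    from has_vector_derivative_mult[OF E' this] show ?thesis
      by (simp add: algebra_simps)
  qed
  have "(LINT v:{1..x}|lborel. cis v * complex_of_real (v powr (p - 1)) -
      complex_of_real (1 - p) * (cis_prim v * complex_of_real (v powr (p - 2)))) =
      cis_prim x * complex_of_real (x powr (p - 1)) - cis_prim 1 * complex_of_real (1 powr (p - 1))"
    unfolding set_lebesgue_integral_def using assms d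
    by (intro integral_FTC_Icc)
      (auto simp: cis_prim_def intro!: continuous_intros)
  moreover have "(LINT v:{1..x}|lborel. cis v * complex_of_real (v powr (p - 1)) -
      complex_of_real (1 - p) * (cis_prim v * complex_of_real (v powr (p - 2)))) =
     (LINT v:{1..x}|lborel. cis v * complex_of_real (v powr (p - 1))) -
      complex_of_real (1 - p) * (LINT v:{1..x}|lborel. cis_prim v * complex_of_real (v powr (p - 2)))"
    using iE iC by (subst set_integral_diff(2)) auto
  ultimately have "(LINT v:{1..x}|lborel. cis v * complex_of_real (v powr (p - 1))) -
      complex_of_real (1 - p) * (LINT v:{1..x}|lborel. cis_prim v * complex_of_real (v powr (p - 2))) =
      cis_prim x * complex_of_real (x powr (p - 1)) - cis_prim 1 * complex_of_real (1 powr (p - 1))"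
    by (simp only:)
  then show "(LINT v:{1..x}|lborel. cis v * complex_of_real (v powr (p - 1))) =
    cis_prim x * complex_of_real (x powr (p - 1)) - cis_prim 1 +
      complex_of_real (1 - p) * (LINT v:{1..x}|lborel. cis_prim v * complex_of_real (v powr (p - 2)))"
    by (simp add: algebra_simps)
qed

text \<open>Up to \<open>1\<close> the power is integrable; beyond \<open>1\<close> an integration by parts leaves two boundary terms and an
  absolutely convergent integral, each bounded by \<open>2\<close>.\<close>

lemma norm_osc_le:
  assumes p: "0 < p" "p \<le> 1" and "0 \<le> x"
  shows "norm (osc p x) \<le> 1 / p + 6"
proof -
  have small: "norm (osc p y) \<le> 1 / p" if "0 \<le> y" "y \<le> 1" for y
  proof -
    have "norm (osc p y) \<le> (LINT v|lborel. norm (indicator {0..y} v *\<^sub>R (cis v * complex_of_real (v powr (p - 1)))))"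
      unfolding osc_def set_lebesgue_integral_def by (rule integral_norm_bound)
    also have "\<dots> = (LINT v:{0..y}|lborel. v powr (p - 1))"
      unfolding set_lebesgue_integral_def by (intro Bochner_Integration.integral_cong) (auto simp: norm_mult)
    also have "\<dots> = y powr p / p" using p that by (simp add: powr_set_integral)
    also have "\<dots> \<le> 1 / p" using p that by (intro divide_right_mono powr_le1) auto
    finally show ?thesis .
  qed
  show ?thesis
  proof (cases "x \<le> 1")
    case True
    then show ?thesis using small[of x] assms by simp
  next
    case False
    have nE: "norm (cis_prim v) \<le> 2" for v
      using norm_triangle_ineq4[of "cis v" 1] by (auto simp: cis_prim_def norm_divide norm_mult)
    note parts = osc_by_parts[of x p]
    have i: "(LINT v:{1..x}|lborel. (1 - p) * v powr (p - 2)) = 1 - x powr (p - 1)"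
      and ii: "set_integrable lborel {1..x} (\<lambda>v. (1 - p) * v powr (p - 2))"
    proof -
      have "has_bochner_integral lborel (\<lambda>v. ((1 - p) * v powr (p - 2)) * indicator {1..x} v)
          (- (x powr (p - 1)) - (- (1 powr (p - 1))))"
        using False p by (intro has_bochner_integral_FTC_Icc_nonneg)
          (auto intro!: derivative_eq_intros simp: algebra_simps)
      then show "(LINT v:{1..x}|lborel. (1 - p) * v powr (p - 2)) = 1 - x powr (p - 1)"
        "set_integrable lborel {1..x} (\<lambda>v. (1 - p) * v powr (p - 2))"
        by (auto simp: has_bochner_integral_iff set_integrable_def set_lebesgue_integral_def mult_ac)
    qed
    have "norm (complex_of_real (1 - p) * (LINT v:{1..x}|lborel. cis_prim v * complex_of_real (v powr (p - 2))))
       = norm (LINT v:{1..x}|lborel. complex_of_real (1 - p) * (cis_prim v * complex_of_real (v powr (p - 2))))"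
      by simp
    also have "\<dots> \<le> (LINT v|lborel. norm (indicator {1..x} v *\<^sub>R (complex_of_real (1 - p) * (cis_prim v * complex_of_real (v powr (p - 2))))))"
      unfolding set_lebesgue_integral_def by (rule integral_norm_bound)
    also have "\<dots> \<le> (LINT v:{1..x}|lborel. 2 * ((1 - p) * v powr (p - 2)))"
      unfolding set_lebesgue_integral_def
    proof (rule integral_mono)
      show "integrable lborel (\<lambda>v. norm (indicator {1..x} v *\<^sub>R (complex_of_real (1 - p) * (cis_prim v * complex_of_real (v powr (p - 2))))))"
        using set_integrable_mult_right[OF parts(2)] False
        by (intro integrable_norm) (auto simp: set_integrable_def)
      show "integrable lborel (\<lambda>v. indicator {1..x} v *\<^sub>R (2 * ((1 - p) * v powr (p - 2))))"
        using set_integrable_mult_right[OF ii, of 2] by (auto simp: set_integrable_def)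
      show "norm (indicator {1..x} v *\<^sub>R (complex_of_real (1 - p) * (cis_prim v * complex_of_real (v powr (p - 2)))))
        \<le> indicator {1..x} v *\<^sub>R (2 * ((1 - p) * v powr (p - 2)))" for v
        using mult_right_mono[OF nE[of v], of "(1 - p) * v powr (p - 2)"] p
        by (auto simp: norm_mult indicator_def mult_ac simp del: of_real_diff)
    qed
    also have "\<dots> = 2 * (1 - x powr (p - 1))" using i by simp
    also have "\<dots> \<le> 2" by simp
    finally have 3: "norm (complex_of_real (1 - p) * (LINT v:{1..x}|lborel. cis_prim v * complex_of_real (v powr (p - 2)))) \<le> 2" .
    have "norm (cis_prim x * complex_of_real (x powr (p - 1))) \<le> 2 * 1"
      unfolding norm_mult using False p
      by (intro mult_mono nE) (auto simp: powr_mono2' intro: powr_mono2'[of "p - 1" 1 x, simplified])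
    moreover have "osc p x - osc p 1 = cis_prim x * complex_of_real (x powr (p - 1)) - cis_prim 1 +
        complex_of_real (1 - p) * (LINT v:{1..x}|lborel. cis_prim v * complex_of_real (v powr (p - 2)))"
      using osc_diff[of p 1 x] parts(1) False p by simp
    ultimately have "norm (osc p x - osc p 1) \<le> 2 * 1 + 2 + 2"
      using 3 nE[of 1]
      by (simp only:) (intro norm_triangle_le add_mono norm_triangle_le_diff)
    then show ?thesis
      using small[of 1] norm_triangle_ineq2[of "osc p x" "osc p 1"] by simp
  qed
qed

text \<open>Since \<open>1 - cos \<ge> 0\<close>, integrating by parts exhibits the imaginary part as a sum of
  nonnegative terms.\<close>

lemma norm_osc_ge:
  assumes p: "0 < p" "p < 1"
  obtains c where "0 < c" "\<And>x. 2 \<le> x \<Longrightarrow> c \<le> norm (osc p x)"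
proof
  define c where "c = (1 - p) * ((1 - cos 1) * 2 powr (p - 2))"
  have cos1: "cos (1::real) < 1" using cos_monotone_0_pi[of 0 1] pi_gt3 by simp
  then show "0 < c" using p by (simp add: c_def)
  fix x :: real assume x: "2 \<le> x"
  have re: "Im (cis_prim v * complex_of_real r) = (1 - cos v) * r" for v r
    by (simp add: cis_prim_def algebra_simps)
  have "1 - cos 1 \<le> Im (osc p 1)"
  proof -
    have "1 - cos 1 = (LINT v:{0..1::real}|lborel. sin v)"
    proof -
      have "(LINT v|lborel. sin v * indicator {0..1} v) = - cos (1::real) - (- cos 0)"
        by (intro integral_FTC_Icc_real[where F="\<lambda>x. - cos x"])
          (auto intro!: derivative_eq_intros continuous_intros)
      then show ?thesis by (simp add: set_lebesgue_integral_def mult.commute)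
    qed
    also have "\<dots> \<le> (LINT v|lborel. Im (indicator {0..1} v *\<^sub>R (cis v * complex_of_real (v powr (p - 1)))))"
      unfolding set_lebesgue_integral_def
    proof (rule integral_mono_AE)
      show "integrable lborel (\<lambda>x. indicator {0..1} x *\<^sub>R sin x :: real)"
        using borel_integrable_atLeastAtMost'[of 0 1 "\<lambda>x::real. sin x", OF continuous_on_sin[OF continuous_on_id]]
        by (simp add: set_integrable_def)
      show "integrable lborel (\<lambda>v. Im (indicator {0..1} v *\<^sub>R (cis v * complex_of_real (v powr (p - 1)))))"
        using set_integrable_osc[of p 0 1 1] p by (intro integrable_Im) (auto simp: set_integrable_def)
      show "AE v in lborel. indicator {0..1} v *\<^sub>R sin v \<le> Im (indicator {0..1} v *\<^sub>R (cis v * complex_of_real (v powr (p - 1))))"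
        using AE_lborel_singleton[of 0]
      proof eventually_elim
        case (elim v)
        have "sin v * 1 \<le> sin v * v powr (p - 1)" if "0 \<le> v" "v \<le> 1"
          using powr_mono2'[of "p - 1" v 1] that elim p pi_gt3
          by (intro mult_left_mono sin_ge_zero) auto
        then show ?case by (auto simp: indicator_def)
      qed
    qed
    also have "\<dots> = Im (osc p 1)"
      unfolding osc_def set_lebesgue_integral_def
      using set_integrable_osc[of p 0 1 1] p by (intro integral_Im) (auto simp: set_integrable_def)
    finally show ?thesis .
  qed
  moreover have "Im (osc p x) - Im (osc p 1) \<ge> - (1 - cos 1) + c"
  proof -
    have "(1 - cos 1) * 2 powr (p - 2) = (LINT v:{1..2::real}|lborel. (1 - cos 1) * 2 powr (p - 2))"
      by (simp add: set_lebesgue_integral_def)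
    also have "\<dots> \<le> (LINT v|lborel. Im (indicator {1..x} v *\<^sub>R (cis_prim v * complex_of_real (v powr (p - 2)))))"
      unfolding set_lebesgue_integral_def
    proof (rule integral_mono)
      show "integrable lborel (\<lambda>v. Im (indicator {1..x} v *\<^sub>R (cis_prim v * complex_of_real (v powr (p - 2)))))"
        using osc_by_parts(2)[of x p] x by (intro integrable_Im) (auto simp: set_integrable_def)
      show "indicator {1..2} v *\<^sub>R ((1 - cos 1) * 2 powr (p - 2))
        \<le> Im (indicator {1..x} v *\<^sub>R (cis_prim v * complex_of_real (v powr (p - 2))))" for v
      proof -
        have "(1 - cos 1) * 2 powr (p - 2) \<le> (1 - cos v) * v powr (p - 2)" if "1 \<le> v" "v \<le> 2"
          using that cos_monotone_0_pi_le[of 1 v] pi_gt3 p by (intro mult_mono powr_mono2') auto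
        then show ?thesis using x by (auto simp: indicator_def re simp del: times_complex.sel)
      qed
    qed auto
    also have "\<dots> = Im (LINT v:{1..x}|lborel. cis_prim v * complex_of_real (v powr (p - 2)))"
      unfolding set_lebesgue_integral_def
      using osc_by_parts(2)[of x p] x by (intro integral_Im) (auto simp: set_integrable_def)
    finally have "c \<le> (1 - p) * \<dots>"
      unfolding c_def using p by (intro mult_left_mono) auto
    moreover have "0 \<le> (1 - cos x) * x powr (p - 1)" by simp
    moreover have "Im (osc p x) - Im (osc p 1) = (1 - cos x) * x powr (p - 1) - (1 - cos 1)
        + (1 - p) * Im (LINT v:{1..x}|lborel. cis_prim v * complex_of_real (v powr (p - 2)))"
    proof -
      have "osc p x - osc p 1 = cis_prim x * complex_of_real (x powr (p - 1)) - cis_prim 1 +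
        complex_of_real (1 - p) * (LINT v:{1..x}|lborel. cis_prim v * complex_of_real (v powr (p - 2)))"
        using osc_diff[of p 1 x] osc_by_parts(1)[of x p] p x by simp
      from arg_cong[OF this, of Im] show ?thesis
        using re[of x "x powr (p - 1)"] re[of 1 1]
        by (simp del: of_real_diff)
    qed
    ultimately show ?thesis by linarith
  qed
  ultimately have "c \<le> Im (osc p x)" by simp
  also have "\<dots> \<le> norm (osc p x)" using abs_Im_le_cmod[of "osc p x"] by simp
  finally show "c \<le> norm (osc p x)" .
qed

lemma osc_scaled:
  assumes "0 < p" "0 < \<rho>" "0 \<le> a" "a \<le> b"
  shows "(LINT v:{a..b}|lborel. cis (\<rho> * v) * complex_of_real (v powr (p - 1))) =
    complex_of_real (\<rho> powr (- p)) * (osc p (\<rho> * b) - osc p (\<rho> * a))"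
proof -
  have "osc p (\<rho> * b) - osc p (\<rho> * a) =
      (LINT v:{\<rho> * a..\<rho> * b}|lborel. cis v * complex_of_real (v powr (p - 1)))"
    using assms by (simp add: osc_diff)
  also have "\<dots> = \<rho> *\<^sub>R (LINT v|lborel. indicator {\<rho> * a..\<rho> * b} (\<rho> * v) *\<^sub>R
      (cis (\<rho> * v) * complex_of_real ((\<rho> * v) powr (p - 1))))"
    unfolding set_lebesgue_integral_def using assms
    by (subst lborel_integral_real_affine[where c=\<rho> and t=0]) auto
  also have "(LINT v|lborel. indicator {\<rho> * a..\<rho> * b} (\<rho> * v) *\<^sub>R
      (cis (\<rho> * v) * complex_of_real ((\<rho> * v) powr (p - 1)))) =
    (LINT v:{a..b}|lborel. complex_of_real (\<rho> powr (p - 1)) * (cis (\<rho> * v) * complex_of_real (v powr (p - 1))))"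
    unfolding set_lebesgue_integral_def
    by (intro Bochner_Integration.integral_cong)
      (use assms in \<open>auto simp: indicator_def powr_mult\<close>)
  finally have "osc p (\<rho> * b) - osc p (\<rho> * a) = complex_of_real (\<rho> * \<rho> powr (p - 1)) *
      (LINT v:{a..b}|lborel. cis (\<rho> * v) * complex_of_real (v powr (p - 1)))"
    by (simp add: scaleR_conv_of_real)
  moreover have "\<rho> powr (- p) * (\<rho> * \<rho> powr (p - 1)) = 1"
    using assms by (simp add: powr_minus powr_diff)
  ultimately show ?thesis
    by (metis (no_types, lifting) mult.assoc mult_1 of_real_1 of_real_mult)
qed

text \<open>Splitting at the singularity \<open>r\<close> leaves two one-sided integrals, each a difference of two values of
  \<open>osc\<close> after translation, reflection and scaling.\<close>

lemma norm_osc_kernel_le: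
  assumes p: "0 < p" "p \<le> 1" and \<rho>: "\<rho> \<noteq> 0"
  shows "norm (LINT v:{a..b}|lborel. cis (\<rho> * v) * complex_of_real (\<bar>r - v\<bar> powr (p - 1)))
    \<le> 4 * (1 / p + 6) * \<bar>\<rho>\<bar> powr (- p)" (is "norm ?I \<le> _")
    and "set_integrable lborel {a..b} (\<lambda>v. cis (\<rho> * v) * complex_of_real (\<bar>r - v\<bar> powr (p - 1)))"
proof -
  define B where "B = (1 / p + 6)"
  define k where "k = (\<lambda>\<sigma> v. cis (\<sigma> * v) * complex_of_real (v powr (p - 1)))"
  have pos: "norm (LINT v:{c..d}|lborel. k \<sigma> v) \<le> 2 * B * \<bar>\<rho>\<bar> powr (- p)"
    if "0 \<le> c" "\<bar>\<sigma>\<bar> = \<bar>\<rho>\<bar>" for c d \<sigma>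
  proof (cases "c \<le> d")
    case False
    then show ?thesis using p by (simp add: B_def set_lebesgue_integral_def)
  next
    case True
    have *: "norm (LINT v:{c..d}|lborel. k \<bar>\<rho>\<bar> v) \<le> 2 * B * \<bar>\<rho>\<bar> powr (- p)"
    proof -
      have "norm (osc p (\<bar>\<rho>\<bar> * d) - osc p (\<bar>\<rho>\<bar> * c)) \<le> B + B"
        using that True p unfolding B_def
        by (intro norm_triangle_le_diff add_mono norm_osc_le) auto
      then show ?thesis
        unfolding k_def using that True p \<rho>
        by (subst osc_scaled) (auto simp: norm_mult mult.commute[of "\<bar>\<rho>\<bar> powr (-p)"] intro!: mult_right_mono)
    qed
    moreover have "(LINT v:{c..d}|lborel. k (- \<bar>\<rho>\<bar>) v) = cnj (LINT v:{c..d}|lborel. k \<bar>\<rho>\<bar> v)"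
      unfolding set_lebesgue_integral_def k_def
      by (subst Bochner_Integration.integral_cnj[symmetric], intro Bochner_Integration.integral_cong) (auto simp: cis_cnj)
    moreover have "\<sigma> = \<bar>\<rho>\<bar> \<or> \<sigma> = - \<bar>\<rho>\<bar>" using that by linarith
    ultimately show ?thesis by auto
  qed
  have ik: "set_integrable lborel {c..d} (k \<sigma>)" if "0 \<le> c" for c d \<sigma>
    unfolding k_def using set_integrable_osc p that by simp
  define F where "F = (\<lambda>v. cis (\<rho> * v) * complex_of_real (\<bar>r - v\<bar> powr (p - 1)))"
  have left: "norm (LINT v:{a..min b r}|lborel. F v) \<le> 2 * B * \<bar>\<rho>\<bar> powr (- p)"
    "set_integrable lborel {a..min b r} F"
  proof -
    have eq: "indicator {a..min b r} (r + - 1 * v) *\<^sub>R F (r + - 1 * v) =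
        cis (\<rho> * r) * (indicator {r - min b r..r - a} v *\<^sub>R k (- \<rho>) v)" for v
      by (auto simp: indicator_def F_def k_def right_diff_distrib cis_mult)
    have "(LINT v:{a..min b r}|lborel. F v) = cis (\<rho> * r) * (LINT v:{r - min b r..r - a}|lborel. k (- \<rho>) v)"
    proof -
      have "(LINT v:{a..min b r}|lborel. F v) = \<bar>- 1\<bar> *\<^sub>R
          (LINT v|lborel. indicator {a..min b r} (r + - 1 * v) *\<^sub>R F (r + - 1 * v))"
        unfolding set_lebesgue_integral_def by (rule lborel_integral_real_affine) simp
      then show ?thesis unfolding eq by (simp add: set_lebesgue_integral_def del: mult_scaleR_right)
    qed
    then show "norm (LINT v:{a..min b r}|lborel. F v) \<le> 2 * B * \<bar>\<rho>\<bar> powr (- p)"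
      using pos[of "r - min b r" "- \<rho>" "r - a"] by (simp add: norm_mult)
    show "set_integrable lborel {a..min b r} F"
      unfolding set_integrable_def
      by (subst lborel_integrable_real_affine_iff[where c="-1" and t=r, symmetric], simp)
        (use ik[of "r - min b r" "r - a" "- \<rho>"] in \<open>auto simp only: eq set_integrable_def intro!: integrable_mult_right\<close>)
  qed
  have right: "norm (LINT v:{max a r..b}|lborel. F v) \<le> 2 * B * \<bar>\<rho>\<bar> powr (- p)"
    "set_integrable lborel {max a r..b} F"
  proof -
    have eq: "indicator {max a r..b} (r + 1 * v) *\<^sub>R F (r + 1 * v) =
        cis (\<rho> * r) * (indicator {max a r - r..b - r} v *\<^sub>R k \<rho> v)" for v
      by (auto simp: indicator_def F_def k_def distrib_left cis_mult)
    have "(LINT v:{max a r..b}|lborel. F v) = cis (\<rho> * r) * (LINT v:{max a r - r..b - r}|lborel. k \<rho> v)"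
    proof -
      have "(LINT v:{max a r..b}|lborel. F v) = \<bar>1\<bar> *\<^sub>R
          (LINT v|lborel. indicator {max a r..b} (r + 1 * v) *\<^sub>R F (r + 1 * v))"
        unfolding set_lebesgue_integral_def by (rule lborel_integral_real_affine) simp
      then show ?thesis unfolding eq by (simp add: set_lebesgue_integral_def del: mult_scaleR_right)
    qed
    then show "norm (LINT v:{max a r..b}|lborel. F v) \<le> 2 * B * \<bar>\<rho>\<bar> powr (- p)"
      using pos[of "max a r - r" "\<rho>" "b - r"] by (simp add: norm_mult)
    show "set_integrable lborel {max a r..b} F"
      unfolding set_integrable_def
      by (subst lborel_integrable_real_affine_iff[where c="1" and t=r, symmetric], simp)
        (use ik[of "max a r - r" "b - r" "\<rho>"] in \<open>auto simp only: eq set_integrable_def intro!: integrable_mult_right\<close>)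
  qed
  have un: "{a..b} = {a..min b r} \<union> {max a r..b}" by auto
  show "set_integrable lborel {a..b} (\<lambda>v. cis (\<rho> * v) * complex_of_real (\<bar>r - v\<bar> powr (p - 1)))"
    unfolding un F_def[symmetric] by (rule set_integrable_Un[OF left(2) right(2)]) auto
  have "?I = (LINT v:{a..min b r}|lborel. F v) + (LINT v:{max a r..b}|lborel. F v)"
    unfolding un F_def[symmetric]
  proof (rule set_integral_Un_AE[OF _ _ _ left(2) right(2)])
    show "AE x in lborel. \<not> (x \<in> {a..min b r} \<and> x \<in> {max a r..b})"
      using AE_lborel_singleton[of r] by eventually_elim auto
  qed auto
  then show "norm ?I \<le> 4 * (1 / p + 6) * \<bar>\<rho>\<bar> powr (- p)"
    using norm_triangle_le[OF add_mono[OF left(1) right(1)]] by (simp add: B_def[symmetric])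
qed

section \<open>The Riesz kernel in time\<close>

text \<open>The odd primitive of \<open>\<bar>x\<bar> powr (p - 1)\<close>; written with \<open>max\<close> so that continuity at \<open>0\<close> is visible.\<close>

definition odd_powr :: "real \<Rightarrow> real \<Rightarrow> real" where
  "odd_powr p x = (max x 0 powr p - max (- x) 0 powr p) / p"

lemma measurable_odd_powr [measurable]: "odd_powr p \<in> borel_measurable borel"
  unfolding odd_powr_def by measurable

lemma odd_powr_minus: "odd_powr p (- x) = - odd_powr p x"
  by (simp add: odd_powr_def diff_divide_distrib)

lemma odd_powr_nonneg: "0 \<le> x \<Longrightarrow> odd_powr p x = x powr p / p"
  by (simp add: odd_powr_def max_def)

lemma odd_powr_nonpos: "x \<le> 0 \<Longrightarrow> odd_powr p x = - ((- x) powr p) / p"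
  by (auto simp add: odd_powr_def max_def)

lemma continuous_on_odd_powr:
  "0 < p \<Longrightarrow> continuous_on A f \<Longrightarrow> continuous_on A (\<lambda>x. odd_powr p (f x))"
  unfolding odd_powr_def by (intro continuous_intros continuous_on_powr') auto

lemma DERIV_odd_powr:
  assumes "0 < p" "x \<noteq> 0"
  shows "(odd_powr p has_real_derivative \<bar>x\<bar> powr (p - 1)) (at x)"
proof (cases "0 < x")
  case True
  have "((\<lambda>x. x powr p / p) has_real_derivative \<bar>x\<bar> powr (p - 1)) (at x)"
    using True assms by (auto intro!: derivative_eq_intros)
  then show ?thesis
    by (rule has_field_derivative_transform_within_open[of _ _ _ "{0<..}"])
      (use True in \<open>auto simp: odd_powr_nonneg\<close>)
next
  case False
  then have x: "x < 0" using assms by simp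
  have "((\<lambda>x. - ((- x) powr p) / p) has_real_derivative \<bar>x\<bar> powr (p - 1)) (at x)"
    using x assms by (auto intro!: derivative_eq_intros)
  then show ?thesis
    by (rule has_field_derivative_transform_within_open[of _ _ _ "{..<0}"])
      (use x in \<open>auto simp: odd_powr_nonpos\<close>)
qed

lemma DERIV_abs_powr:
  assumes "0 < p" "x \<noteq> 0"
  shows "((\<lambda>x. \<bar>x\<bar> powr (p + 1) / (p * (p + 1))) has_real_derivative odd_powr p x) (at x)"
proof (cases "0 < x")
  case True
  have "((\<lambda>x. x powr (p + 1)) has_real_derivative (p + 1) * x powr p) (at x)"
    using True by (auto intro!: derivative_eq_intros)
  from DERIV_cdivide[OF this, of "p * (p + 1)"]
  have "((\<lambda>x. x powr (p + 1) / (p * (p + 1))) has_real_derivative odd_powr p x) (at x)"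
    using True assms by (simp add: odd_powr_nonneg mult.commute[of p])
  then show ?thesis
    by (rule has_field_derivative_transform_within_open[of _ _ _ "{0<..}"])
      (use True in auto)
next
  case False
  then have x: "x < 0" using assms by simp
  have "((\<lambda>x. (- x) powr (p + 1)) has_real_derivative - ((p + 1) * (- x) powr p)) (at x)"
    using x by (auto intro!: derivative_eq_intros)
  from DERIV_cdivide[OF this, of "p * (p + 1)"]
  have "((\<lambda>x. (- x) powr (p + 1) / (p * (p + 1))) has_real_derivative odd_powr p x) (at x)"
    using x assms by (simp add: odd_powr_nonpos mult.commute[of p])
  then show ?thesis
    by (rule has_field_derivative_transform_within_open[of _ _ _ "{..<0}"])
      (use x in auto)
qed

lemma abs_powr_set_integral:
  fixes p v a b :: real
  assumes p: "0 < p" and "a \<le> b"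
  shows "set_integrable lborel {a..b} (\<lambda>r. \<bar>r - v\<bar> powr (p - 1))"
    and "(LINT r:{a..b}|lborel. \<bar>r - v\<bar> powr (p - 1)) = odd_powr p (b - v) - odd_powr p (a - v)"
proof -
  have "((\<lambda>r. \<bar>r - v\<bar> powr (p - 1)) has_integral (odd_powr p (b - v) - odd_powr p (a - v))) {a..b}"
  proof (rule fundamental_theorem_of_calculus_interior_strong[of "{v}"])
    show "((\<lambda>r. odd_powr p (r - v)) has_vector_derivative \<bar>r - v\<bar> powr (p - 1)) (at r)"
      if "r \<in> {a<..<b} - {v}" for r
    proof -
      have "((\<lambda>r. r - v) has_real_derivative 1) (at r)"
        by (auto intro!: derivative_eq_intros)
      from DERIV_chain2[OF DERIV_odd_powr[OF p] this] that show ?thesis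
        unfolding has_real_derivative_iff_has_vector_derivative[symmetric] by simp
    qed
  qed (use assms in \<open>auto intro!: continuous_intros continuous_on_odd_powr\<close>)
  from lborel_set_integral_nonneg[OF _ _ _ this]
  show "set_integrable lborel {a..b} (\<lambda>r. \<bar>r - v\<bar> powr (p - 1))"
    "(LINT r:{a..b}|lborel. \<bar>r - v\<bar> powr (p - 1)) = odd_powr p (b - v) - odd_powr p (a - v)"
    by auto
qed

lemma odd_powr_set_integral:
  fixes p t s :: real
  assumes p: "0 < p" and "0 \<le> s" "0 \<le> t"
  shows "(LINT v:{0..s}|lborel. odd_powr p (t - v) + odd_powr p v)
     = (t powr (p + 1) + s powr (p + 1) - \<bar>t - s\<bar> powr (p + 1)) / (p * (p + 1))"
proof -
  define F where "F = (\<lambda>v. (\<bar>v\<bar> powr (p + 1) - \<bar>t - v\<bar> powr (p + 1)) / (p * (p + 1)))"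
  have c: "continuous_on {0..s} (\<lambda>v. odd_powr p (t - v) + odd_powr p v)"
    using p by (intro continuous_intros continuous_on_odd_powr) auto
  have "((\<lambda>v. odd_powr p (t - v) + odd_powr p v) has_integral (F s - F 0)) {0..s}"
  proof (rule fundamental_theorem_of_calculus_interior_strong[of "{t}"])
    show "(F has_vector_derivative odd_powr p (t - v) + odd_powr p v) (at v)"
      if "v \<in> {0<..<s} - {t}" for v
    proof -
      have "((\<lambda>v. \<bar>v\<bar> powr (p + 1) / (p * (p + 1)) - \<bar>t - v\<bar> powr (p + 1) / (p * (p + 1)))
          has_real_derivative odd_powr p v - odd_powr p (t - v) * (- 1)) (at v)"
      proof (intro DERIV_diff)
        show "((\<lambda>v. \<bar>v\<bar> powr (p + 1) / (p * (p + 1))) has_real_derivative odd_powr p v) (at v)"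
          using that p by (intro DERIV_abs_powr) auto
        have "((\<lambda>v. t - v) has_real_derivative - 1) (at v)"
          by (auto intro!: derivative_eq_intros)
        from DERIV_chain2[OF DERIV_abs_powr[OF p] this] that
        show "((\<lambda>v. \<bar>t - v\<bar> powr (p + 1) / (p * (p + 1))) has_real_derivative odd_powr p (t - v) * - 1) (at v)"
          by simp
      qed
      then show ?thesis
        unfolding has_real_derivative_iff_has_vector_derivative[symmetric]
        by (simp add: F_def diff_divide_distrib add.commute)
    qed
    show "continuous_on {0..s} F"
      unfolding F_def using p by (intro continuous_intros continuous_on_powr') auto
  qed (use assms in auto)
  then have "integral {0..s} (\<lambda>v. odd_powr p (t - v) + odd_powr p v) = F s - F 0"
    by (rule integral_unique)
  moreover have "(LINT v:{0..s}|lborel. odd_powr p (t - v) + odd_powr p v) =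
      integral {0..s} (\<lambda>v. odd_powr p (t - v) + odd_powr p v)"
    by (rule set_borel_integral_eq_integral(2)[OF borel_integrable_atLeastAtMost'[OF c]])
  ultimately show ?thesis
    using assms by (simp add: F_def add_divide_distrib diff_divide_distrib)
qed

lemma set_integral_AE_interval:
  fixes f :: "real \<Rightarrow> 'b::{banach, second_countable_topology}"
  assumes [measurable]: "f \<in> borel_measurable borel"
  shows "(LINT r:{0<..}|lborel. indicator {0..t} r *\<^sub>R f r) = (LINT r:{0..t}|lborel. f r)"
proof -
  have "AE r in lborel. indicator {0<..} r *\<^sub>R indicator {0..t} r *\<^sub>R f r = indicator {0..t} r *\<^sub>R f r"
    using AE_lborel_singleton[of "0::real"] by eventually_elim (auto simp: indicator_def)
  then show ?thesis
    unfolding set_lebesgue_integral_def by (intro integral_cong_AE) auto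
qed

text \<open>The function \<open>\<bar>x\<bar> powr (2H) / (2H(2H - 1))\<close> is a second primitive of \<open>\<bar>x\<bar> powr (2H - 2)\<close>; integrating
  over a rectangle takes its values at the four corners.\<close>

lemma fbm_cov_eq_integral:
  fixes H t s :: real
  assumes H: "1/2 < H" and "0 \<le> t" "0 \<le> s"
  defines "k \<equiv> \<lambda>r v. indicator {0..t} r * indicator {0..s} v * \<bar>r - v\<bar> powr (2*H - 2)"
  shows "(LINT v:{0<..}|lborel. LINT r:{0<..}|lborel. k r v) = fbm_cov H t s / (H * (2*H - 1))"
    and "\<And>v. set_integrable lborel {0<..} (\<lambda>r. k r v)"
    and "set_integrable lborel {0<..} (\<lambda>v. LINT r:{0<..}|lborel. k r v)"
proof -
  define p where "p = 2*H - 1"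
  have p: "0 < p" "2*H - 2 = p - 1" "2*H = p + 1" using H by (auto simp: p_def)
  have inner: "(LINT r:{0<..}|lborel. k r v) = indicator {0..s} v *\<^sub>R (odd_powr p (t - v) + odd_powr p v)" for v
  proof -
    have "(LINT r:{0<..}|lborel. k r v) =
        (LINT r:{0<..}|lborel. indicator {0..t} r *\<^sub>R (indicator {0..s} v * \<bar>r - v\<bar> powr (p - 1)))"
      by (simp add: k_def p(2) mult.assoc)
    also have "\<dots> = (LINT r:{0..t}|lborel. indicator {0..s} v * \<bar>r - v\<bar> powr (p - 1))"
      by (rule set_integral_AE_interval) measurable
    also have "\<dots> = indicator {0..s} v * (odd_powr p (t - v) - odd_powr p (0 - v))"
      using abs_powr_set_integral(2)[of p 0 t v] p assms by simp
    finally show ?thesis by (simp add: odd_powr_minus)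
  qed
  show "set_integrable lborel {0<..} (\<lambda>r. k r v)" for v
  proof -
    have "set_integrable lborel {0..t} (\<lambda>r. \<bar>r - v\<bar> powr (p - 1))"
      using abs_powr_set_integral(1)[of p 0 t v] p assms by simp
    then show ?thesis
      unfolding set_integrable_def
      by (rule Bochner_Integration.integrable_bound) (auto simp: k_def p(2) indicator_def)
  qed
  have c: "continuous_on {0..s} (\<lambda>v. odd_powr p (t - v) + odd_powr p v)"
    using p by (intro continuous_intros continuous_on_odd_powr) auto
  show "set_integrable lborel {0<..} (\<lambda>v. LINT r:{0<..}|lborel. k r v)"
    unfolding inner using borel_integrable_atLeastAtMost'[OF c]
    unfolding set_integrable_def
    by (rule_tac Bochner_Integration.integrable_bound) (auto simp: indicator_def)
  have "(LINT v:{0<..}|lborel. LINT r:{0<..}|lborel. k r v) = (LINT v:{0..s}|lborel. odd_powr p (t - v) + odd_powr p v)"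
    unfolding inner by (intro set_integral_AE_interval) measurable
  also have "\<dots> = (t powr (p + 1) + s powr (p + 1) - \<bar>t - s\<bar> powr (p + 1)) / (p * (p + 1))"
    using p assms by (intro odd_powr_set_integral)
  also have "\<dots> = fbm_cov H t s / (H * (2*H - 1))"
    using H by (simp add: fbm_cov_def p(3)[symmetric] p_def[symmetric])
  finally show "(LINT v:{0<..}|lborel. LINT r:{0<..}|lborel. k r v) = fbm_cov H t s / (H * (2*H - 1))" .
qed

section \<open>Causal factorisation of the quadratic form\<close>

text \<open>Earlier times \<open>r\<close> influence later times \<open>w\<close> only. The cut at \<open>r = 0\<close> matches the domain of
  integration \<open>(0,\<infinity>)\<close> of the quadratic form.\<close>

definition causal_kernel :: "real \<Rightarrow> real \<Rightarrow> real \<Rightarrow> real" where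
  "causal_kernel q w r = (if 0 < r \<and> r < w then (w - r) powr (q - 1) else 0)"

lemma causal_kernel_nonneg [simp]: "0 \<le> causal_kernel q w r"
  by (simp add: causal_kernel_def)

lemma measurable_causal_kernel [measurable (raw)]:
  assumes [measurable]: "f \<in> borel_measurable M" "g \<in> borel_measurable M"
  shows "(\<lambda>x. causal_kernel q (f x) (g x)) \<in> borel_measurable M"
  unfolding causal_kernel_def by measurable

text \<open>For \<open>r < v\<close> the substitution \<open>w = v + (v - r) y\<close> extracts the power of \<open>v - r\<close> and leaves the Beta
  integral of \<open>y powr (q - 1) (1 + y) powr (q - 1)\<close>: it converges at \<open>0\<close> because \<open>q > 0\<close> and at infinity
  because \<open>q < 1/2\<close>.\<close>

lemma causal_kernel_factorisation:
  fixes q :: real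
  assumes q: "0 < q" "q < 1/2"
  obtains \<kappa> where "0 < \<kappa>"
    "\<And>r v. 0 < r \<Longrightarrow> 0 < v \<Longrightarrow> r \<noteq> v \<Longrightarrow>
      (\<integral>\<^sup>+w. ennreal (causal_kernel q w r * causal_kernel q w v) \<partial>lborel) = ennreal (\<kappa> * \<bar>r - v\<bar> powr (2*q - 1))"
proof -
  define g where "g = (\<lambda>y::real. indicator {0<..} y * (y powr (q - 1) * (1 + y) powr (q - 1)))"
  define K where "K = (\<integral>\<^sup>+y. ennreal (g y) \<partial>lborel)"
  have [measurable]: "g \<in> borel_measurable borel" unfolding g_def by measurable
  have "K < \<infinity>"
  proof -
    have i1: "set_integrable lborel {0..1} (\<lambda>v::real. v powr (q - 1))"
      using powr_set_integral(1)[of q 1] q by simp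
    have i2: "set_integrable lborel {1..} (\<lambda>v::real. v powr (2*q - 2))"
      using lborel_set_integral_nonneg(1)[OF _ _ _ has_integral_powr_to_inf[of "2*q - 2" 1]] q by simp
    have "integrable lborel g"
    proof (rule Bochner_Integration.integrable_bound)
      show "integrable lborel (\<lambda>y::real. indicator {0..1} y *\<^sub>R y powr (q - 1) + indicator {1..} y *\<^sub>R y powr (2*q - 2))"
        using i1 i2 by (auto simp: set_integrable_def)
      show "AE y in lborel. norm (g y) \<le> norm (indicator {0..1} y *\<^sub>R y powr (q - 1) + indicator {1..} y *\<^sub>R y powr (2*q - 2))"
      proof (intro AE_I2)
        fix y :: real
        have "y powr (q - 1) * (1 + y) powr (q - 1) \<le> y powr (q - 1) * 1" if "0 < y"
          using powr_mono2'[of "q - 1" 1 "1 + y"] that q by (intro mult_left_mono) auto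
        moreover have "y powr (q - 1) * (1 + y) powr (q - 1) \<le> y powr (q - 1) * y powr (q - 1)" if "0 < y"
          using powr_mono2'[of "q - 1" y "1 + y"] that q by (intro mult_left_mono) auto
        moreover have "y powr (q - 1) * y powr (q - 1) = y powr (2*q - 2)"
          by (simp flip: powr_add)
        ultimately show "norm (g y) \<le> norm (indicator {0..1} y *\<^sub>R y powr (q - 1) + indicator {1..} y *\<^sub>R y powr (2*q - 2))"
          by (auto simp: g_def indicator_def)
      qed
    qed simp
    moreover have "0 \<le> g y" for y by (simp add: g_def)
    ultimately show ?thesis by (simp add: K_def nn_integral_eq_integral)
  qed
  moreover have "0 < K"
  proof -
    have "ennreal (2 powr (q - 1) * 3 powr (q - 1)) = (\<integral>\<^sup>+y. ennreal (2 powr (q - 1) * 3 powr (q - 1)) * indicator {1..2::real} y \<partial>lborel)"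
      by (simp add: nn_integral_cmult)
    also have "\<dots> \<le> K"
      unfolding K_def using q
      by (intro nn_integral_mono)
        (auto simp: g_def indicator_def intro!: ennreal_leI mult_mono powr_mono2')
    finally show ?thesis by (rule less_le_trans[rotated]) simp
  qed
  ultimately obtain \<kappa> where \<kappa>: "0 < \<kappa>" "K = ennreal \<kappa>"
    by (cases K) (auto simp: ennreal_less_zero_iff)
  have *: "(\<integral>\<^sup>+w. ennreal (causal_kernel q w r * causal_kernel q w v) \<partial>lborel) = ennreal (\<kappa> * \<bar>r - v\<bar> powr (2*q - 1))"
    if "0 < r" "r < v" for r v
  proof -
    have "(\<integral>\<^sup>+w. ennreal (causal_kernel q w r * causal_kernel q w v) \<partial>lborel) =
       ennreal \<bar>v - r\<bar> * (\<integral>\<^sup>+y. ennreal (causal_kernel q (v + (v - r) * y) r * causal_kernel q (v + (v - r) * y) v) \<partial>lborel)"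
      using that by (intro nn_integral_real_affine) auto
    also have "(\<integral>\<^sup>+y. ennreal (causal_kernel q (v + (v - r) * y) r * causal_kernel q (v + (v - r) * y) v) \<partial>lborel)
       = (\<integral>\<^sup>+y. ennreal ((v - r) powr (2*q - 2)) * ennreal (g y) \<partial>lborel)"
    proof (intro nn_integral_cong)
      fix y :: real
      have e: "v + (v - r) * y - r = (v - r) * (1 + y)" "v + (v - r) * y - v = (v - r) * y"
        by (auto simp: algebra_simps)
      have pos: "v < v + (v - r) * y \<longleftrightarrow> 0 < y" using that by (auto simp: zero_less_mult_iff)
      have pos': "r < v + (v - r) * y" if "0 < y"
        using pos that \<open>r < v\<close> by linarith
      have "(v - r) powr (q - 1) * (v - r) powr (q - 1) = (v - r) powr (2*q - 2)"
        by (simp flip: powr_add)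
      then have "causal_kernel q (v + (v - r) * y) r * causal_kernel q (v + (v - r) * y) v
          = (v - r) powr (2*q - 2) * g y"
        using that pos pos' by (auto simp: causal_kernel_def g_def e powr_mult)
      then show "ennreal (causal_kernel q (v + (v - r) * y) r * causal_kernel q (v + (v - r) * y) v) =
          ennreal ((v - r) powr (2*q - 2)) * ennreal (g y)"
        by (simp add: ennreal_mult' g_def)
    qed
    also have "\<dots> = ennreal ((v - r) powr (2*q - 2)) * ennreal \<kappa>"
      by (simp add: nn_integral_cmult K_def[symmetric] \<kappa>)
    also have "ennreal \<bar>v - r\<bar> * \<dots> = ennreal (\<kappa> * (\<bar>v - r\<bar> * (v - r) powr (2*q - 2)))"
      using \<kappa>(1) by (simp add: ennreal_mult'[symmetric] mult_ac)
    also have "\<bar>v - r\<bar> * (v - r) powr (2*q - 2) = \<bar>r - v\<bar> powr (2*q - 1)"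
      using that powr_mult_base[of "v - r" "2*q - 2"] by (simp add: abs_minus_commute algebra_simps)
    finally show ?thesis .
  qed
  show thesis
  proof (rule that[OF \<kappa>(1)])
    fix r v :: real assume "0 < r" "0 < v" "r \<noteq> v"
    then show "(\<integral>\<^sup>+w. ennreal (causal_kernel q w r * causal_kernel q w v) \<partial>lborel) = ennreal (\<kappa> * \<bar>r - v\<bar> powr (2*q - 1))"
      using *[of r v] *[of v r] by (cases "r < v") (auto simp: mult.commute abs_minus_commute)
  qed
qed


lemma measurable_cnj [measurable]: "cnj \<in> borel_measurable borel"
  by (intro borel_measurable_continuous_onI continuous_intros)

text \<open>The form \<open>hp_density\<close> at one fixed frequency, as a function of the time profile.\<close>

definition frac_form :: "real \<Rightarrow> (real \<Rightarrow> complex) \<Rightarrow> complex" where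
  "frac_form H h = (LINT v:{0<..}|lborel. LINT r:{0<..}|lborel.
     h r * cnj (h v) * complex_of_real (\<bar>r - v\<bar> powr (2*H - 2)))"

text \<open>Bounded time profiles with compact support in \<open>[0,\<infinity>)\<close>: the smoothing of such a profile is defined
  at every point, and all integrals below converge absolutely.\<close>

definition pulse :: "(real \<Rightarrow> complex) \<Rightarrow> bool" where
  "pulse h \<longleftrightarrow> h \<in> borel_measurable borel \<and> (\<exists>R m. \<forall>r. norm (h r) \<le> m * indicator {0..R} r)"

text \<open>Up to the factor \<open>Gamma(q)\<close>, the Riemann--Liouville fractional integral of order \<open>q\<close>.\<close>

definition causal_smoothing :: "real \<Rightarrow> (real \<Rightarrow> complex) \<Rightarrow> real \<Rightarrow> complex" where
  "causal_smoothing q h w = (LINT r|lborel. h r * complex_of_real (causal_kernel q w r))"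

lemma pulse_measurable [measurable_dest]: "pulse h \<Longrightarrow> h \<in> borel_measurable borel"
  by (simp add: pulse_def)

lemma pulse_bound:
  assumes "pulse h"
  obtains R m where "0 < R" "0 < m" "\<And>r. norm (h r) \<le> m * indicator {0..R} r"
proof -
  from assms obtain R m where *: "\<And>r. norm (h r) \<le> m * indicator {0..R} r"
    by (auto simp: pulse_def)
  have "norm (h r) \<le> max m 1 * indicator {0..max R 1} r" for r
  proof (cases "0 \<le> r \<and> r \<le> R")
    case False
    then have "h r = 0" using *[of r] by simp
    then show ?thesis by simp
  qed (use *[of r] in auto)
  then show ?thesis by (intro that[of "max R 1" "max m 1"]) auto
qed

lemma pulse_add: assumes "pulse f" "pulse g" shows "pulse (\<lambda>r. f r + g r)"
proof -
  obtain R m where f: "0 < R" "0 < m" "\<And>r. norm (f r) \<le> m * indicator {0..R} r"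
    using pulse_bound[OF assms(1)] by blast
  obtain R' m' where g: "0 < R'" "0 < m'" "\<And>r. norm (g r) \<le> m' * indicator {0..R'} r"
    using pulse_bound[OF assms(2)] by blast
  have "norm (f r + g r) \<le> (m + m') * indicator {0..max R R'} r" for r
  proof (cases "r \<in> {0..max R R'}")
    case True
    have "norm (f r) \<le> m" "norm (g r) \<le> m'"
      using f(2) f(3)[of r] g(2) g(3)[of r] by (auto split: split_indicator_asm)
    with True show ?thesis using norm_triangle_ineq[of "f r" "g r"] by simp
  next
    case False
    then have "f r = 0" "g r = 0"
      using f(3)[of r] g(3)[of r] by (auto split: split_indicator_asm)
    then show ?thesis using f(2) g(2) by simp
  qed
  then show ?thesis using assms by (auto simp: pulse_def)
qed

lemma pulse_cmult: assumes "pulse f" shows "pulse (\<lambda>r. c * f r)"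
proof -
  obtain R m where f: "0 < R" "0 < m" "\<And>r. norm (f r) \<le> m * indicator {0..R} r"
    using pulse_bound[OF assms] by blast
  have "norm (c * f r) \<le> (norm c * m) * indicator {0..R} r" for r
    using mult_left_mono[OF f(3)[of r], of "norm c"] by (simp add: norm_mult mult.assoc)
  then show ?thesis using assms by (auto simp: pulse_def)
qed

lemma pulse_diff: "pulse f \<Longrightarrow> pulse g \<Longrightarrow> pulse (\<lambda>r. f r - g r)"
  using pulse_add[of f "\<lambda>r. (- 1) * g r"] pulse_cmult[of g "- 1"] by simp

lemma causal_kernel_integrable:
  assumes q: "0 < q"
  shows "integrable lborel (causal_kernel q w)"
proof (cases "0 \<le> w")
  case False
  then have "causal_kernel q w = (\<lambda>r. 0)" by (auto simp: causal_kernel_def)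
  then show ?thesis by simp
next
  case True
  have "set_integrable lborel {0..w} (\<lambda>r. \<bar>r - w\<bar> powr (q - 1))"
    using abs_powr_set_integral(1)[of q 0 w w] True q by simp
  then show ?thesis
    unfolding set_integrable_def
    by (rule Bochner_Integration.integrable_bound) (auto simp: causal_kernel_def indicator_def)
qed

lemma causal_smoothing_integrable:
  assumes "0 < q" "pulse h"
  shows "integrable lborel (\<lambda>r. h r * complex_of_real (causal_kernel q w r))"
proof -
  obtain R m where h: "0 < R" "0 < m" "\<And>r. norm (h r) \<le> m * indicator {0..R} r"
    using pulse_bound[OF assms(2)] by blast
  note [measurable] = pulse_measurable[OF assms(2)]
  have "integrable lborel (\<lambda>r. m * causal_kernel q w r)"
    using causal_kernel_integrable[OF assms(1)] by simp
  then show ?thesis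
  proof (rule Bochner_Integration.integrable_bound)
    show "AE r in lborel. norm (h r * complex_of_real (causal_kernel q w r)) \<le> norm (m * causal_kernel q w r)"
    proof (intro AE_I2)
      fix r
      have "norm (h r) \<le> m" using h(3)[of r] h(2) by (auto split: split_indicator_asm)
      then show "norm (h r * complex_of_real (causal_kernel q w r)) \<le> norm (m * causal_kernel q w r)"
        using h(2) by (auto simp: norm_mult intro!: mult_right_mono)
    qed
  qed simp
qed

lemma causal_smoothing_add:
  "0 < q \<Longrightarrow> pulse f \<Longrightarrow> pulse g \<Longrightarrow>
    causal_smoothing q (\<lambda>r. f r + g r) w = causal_smoothing q f w + causal_smoothing q g w"
  unfolding causal_smoothing_def distrib_right
  by (intro Bochner_Integration.integral_add causal_smoothing_integrable)

lemma causal_smoothing_measurable [measurable]: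
  assumes [measurable]: "h \<in> borel_measurable borel"
  shows "causal_smoothing q h \<in> borel_measurable borel"
  unfolding causal_smoothing_def by measurable

lemma riesz_pulse_nn_integral:
  assumes p: "0 < p" and "0 < R"
  shows "(\<integral>\<^sup>+v. \<integral>\<^sup>+r. ennreal (indicator {0..R} r * indicator {0..R} v * \<bar>r - v\<bar> powr (p - 1)) \<partial>lborel \<partial>lborel)
    \<le> ennreal (R * (2 * R powr p / p))"
proof -
  have "(\<integral>\<^sup>+r. ennreal (indicator {0..R} r * indicator {0..R} v * \<bar>r - v\<bar> powr (p - 1)) \<partial>lborel)
     \<le> ennreal (2 * R powr p / p) * indicator {0..R} v" for v
  proof (cases "v \<in> {0..R}")
    case True
    have i: "integrable lborel (\<lambda>r. indicator {0..R} r * \<bar>r - v\<bar> powr (p - 1))"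
      using abs_powr_set_integral(1)[of p 0 R v] assms by (simp add: set_integrable_def)
    have "(\<integral>\<^sup>+r. ennreal (indicator {0..R} r * indicator {0..R} v * \<bar>r - v\<bar> powr (p - 1)) \<partial>lborel)
       = (\<integral>\<^sup>+r. ennreal (indicator {0..R} r * \<bar>r - v\<bar> powr (p - 1)) \<partial>lborel)"
      using True by simp
    also have "\<dots> = ennreal (odd_powr p (R - v) - odd_powr p (0 - v))"
      using nn_integral_eq_integral[OF i] abs_powr_set_integral(2)[of p 0 R v] assms
      by (simp add: set_lebesgue_integral_def)
    also have "odd_powr p (R - v) - odd_powr p (0 - v) = ((R - v) powr p + v powr p) / p"
      using True by (simp add: odd_powr_nonneg odd_powr_minus add_divide_distrib)
    also have "\<dots> \<le> (R powr p + R powr p) / p"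
      using True p by (intro divide_right_mono add_mono powr_mono2) auto
    finally show ?thesis using True by (simp add: ennreal_leI)
  qed simp
  then have "(\<integral>\<^sup>+v. \<integral>\<^sup>+r. ennreal (indicator {0..R} r * indicator {0..R} v * \<bar>r - v\<bar> powr (p - 1)) \<partial>lborel \<partial>lborel)
     \<le> (\<integral>\<^sup>+v. ennreal (2 * R powr p / p) * indicator {0..R} v \<partial>lborel)"
    by (rule nn_integral_mono)
  also have "\<dots> = ennreal (2 * R powr p / p) * ennreal R"
    using assms by (simp add: nn_integral_cmult)
  also have "\<dots> = ennreal (R * (2 * R powr p / p))"
    using assms by (simp add: ennreal_mult'' mult.commute flip: ennreal_mult'')
  finally show ?thesis .
qed

text \<open>Inserting the factorisation and integrating over \<open>w\<close> last turns the form into a squared norm. This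
  shows positivity, and it localises: the smoothing at \<open>w\<close> depends on the profile before \<open>w\<close> only.
  The factorisation fails on the diagonal \<open>r = v\<close>, a null set.\<close>

lemma frac_form_eq_smoothing:
  assumes H: "1/2 < H" "H < 1"
  obtains \<kappa> where "0 < \<kappa>"
    "\<And>h. pulse h \<Longrightarrow> integrable lborel (\<lambda>w. (norm (causal_smoothing (H - 1/2) h w))\<^sup>2)"
    "\<And>h. pulse h \<Longrightarrow> complex_of_real \<kappa> * frac_form H h =
       complex_of_real (LINT w|lborel. (norm (causal_smoothing (H - 1/2) h w))\<^sup>2)"
proof -
  define q where "q = H - 1/2"
  have q: "0 < q" "q < 1/2" "2*H - 2 = 2*q - 1" using H by (auto simp: q_def)
  obtain \<kappa> where \<kappa>: "0 < \<kappa>" and fac: "\<And>r v. 0 < r \<Longrightarrow> 0 < v \<Longrightarrow> r \<noteq> v \<Longrightarrow>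
      (\<integral>\<^sup>+w. ennreal (causal_kernel q w r * causal_kernel q w v) \<partial>lborel) = ennreal (\<kappa> * \<bar>r - v\<bar> powr (2*q - 1))"
    using causal_kernel_factorisation[OF q(1,2)] by blast
  let ?k = "causal_kernel q"
  have main: "integrable lborel (\<lambda>w. (norm (causal_smoothing q h w))\<^sup>2) \<and>
     complex_of_real \<kappa> * frac_form H h = complex_of_real (LINT w|lborel. (norm (causal_smoothing q h w))\<^sup>2)"
    if h: "pulse h" for h
  proof -
    note [measurable] = pulse_measurable[OF h]
    obtain R m where R: "0 < R" "0 < m" "\<And>r. norm (h r) \<le> m * indicator {0..R} r"
      using pulse_bound[OF h] by blast
    define ii :: "real \<Rightarrow> real \<Rightarrow> real" where "ii r v = indicator {0<..} r * indicator {0<..} v" for r v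
    have [measurable]: "(\<lambda>(r, v). ii r v) \<in> borel_measurable (borel \<Otimes>\<^sub>M borel)"
      unfolding ii_def by measurable
    let ?K = "\<lambda>z::real \<times> real. ii (fst z) (snd z) * \<bar>fst z - snd z\<bar> powr (2*q - 1)"
    let ?A = "\<lambda>z. norm (h (fst z)) * norm (h (snd z)) * ?K z"
    define G where "G w z = h (fst z) * cnj (h (snd z)) * complex_of_real (?k w (fst z) * ?k w (snd z))" for w and z :: "real \<times> real"
    have Gb: "(\<lambda>(w, z). G w z) \<in> borel_measurable (borel \<Otimes>\<^sub>M (borel \<Otimes>\<^sub>M borel))"
      unfolding G_def by measurable
    have Gm [measurable]: "(\<lambda>(w, z). G w z) \<in> borel_measurable (lborel \<Otimes>\<^sub>M (lborel \<Otimes>\<^sub>M lborel))"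
      using Gb by (subst measurable_cong_sets[OF sets_pair_measure_cong[OF sets_lborel sets_pair_measure_cong[OF sets_lborel sets_lborel]] refl])
    have kk: "(\<integral>\<^sup>+w. ennreal (?k w (fst z) * ?k w (snd z)) \<partial>lborel) =
        ennreal (\<kappa> * ?K z)" if "fst z \<noteq> snd z" for z :: "real \<times> real"
    proof (cases "0 < fst z \<and> 0 < snd z")
      case True
      then show ?thesis using fac[of "fst z" "snd z"] that by (simp add: ii_def)
    next
      case False
      then have "?k w (fst z) * ?k w (snd z) = 0" for w by (auto simp: causal_kernel_def)
      then have "ennreal (?k w (fst z) * ?k w (snd z)) = 0" for w by simp
      moreover have "ii (fst z) (snd z) = 0" using False by (auto simp: ii_def)
      ultimately show ?thesis by (simp only: nn_integral_const mult_zero_left mult_zero_right ennreal_0)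
    qed
    have diag: "AE z in lborel \<Otimes>\<^sub>M lborel. fst z \<noteq> (snd z :: real)"
    proof (rule lborel_pair.AE_pair_measure)
      show "{z \<in> space (lborel \<Otimes>\<^sub>M lborel). fst z \<noteq> (snd z :: real)} \<in> sets (lborel \<Otimes>\<^sub>M lborel)"
        by measurable
      show "AE x in lborel. AE y in lborel. fst (x, y) \<noteq> (snd (x, y) :: real)"
      proof (rule AE_I2)
        fix x :: real
        show "AE y in lborel. fst (x, y) \<noteq> snd (x, y)"
          using AE_lborel_singleton[of x] by eventually_elim auto
      qed
    qed
    have nG: "(\<integral>\<^sup>+w. ennreal (norm (G w z)) \<partial>lborel) =
        ennreal (\<kappa> * (?A z))"
      if "fst z \<noteq> snd z" for z :: "real \<times> real"
    proof -
      have "(\<integral>\<^sup>+w. ennreal (norm (G w z)) \<partial>lborel) =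
         (\<integral>\<^sup>+w. ennreal (norm (h (fst z)) * norm (h (snd z))) * ennreal (?k w (fst z) * ?k w (snd z)) \<partial>lborel)"
        by (intro nn_integral_cong) (simp add: G_def norm_mult ennreal_mult' abs_mult)
      also have "\<dots> = ennreal (norm (h (fst z)) * norm (h (snd z))) * ennreal (\<kappa> * ?K z)"
        using that by (simp add: nn_integral_cmult kk)
      finally show ?thesis by (simp add: ennreal_mult'[symmetric] mult_ac)
    qed
    let ?B = "\<lambda>z::real \<times> real. indicator {0..R} (fst z) * indicator {0..R} (snd z) * \<bar>fst z - snd z\<bar> powr (2*q - 1)"
    have fin: "(\<integral>\<^sup>+z. ennreal (?A z) \<partial>(lborel \<Otimes>\<^sub>M lborel)) < \<infinity>"
    proof -
      have "(\<integral>\<^sup>+z. ennreal (?A z) \<partial>(lborel \<Otimes>\<^sub>M lborel))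
        \<le> (\<integral>\<^sup>+z. ennreal (m * m) * ennreal (?B z) \<partial>(lborel \<Otimes>\<^sub>M lborel))"
      proof (intro nn_integral_mono)
        fix z :: "real \<times> real"
        have "norm (h (fst z)) * norm (h (snd z)) \<le> (m * indicator {0..R} (fst z)) * (m * indicator {0..R} (snd z))"
          using R by (intro mult_mono) auto
        then have "?A z
          \<le> (m * indicator {0..R} (fst z)) * (m * indicator {0..R} (snd z)) * (1 * \<bar>fst z - snd z\<bar> powr (2*q - 1))"
          using R by (intro mult_mono) (auto simp: ii_def indicator_def)
        then show "ennreal (?A z)
          \<le> ennreal (m * m) * ennreal (?B z)"
          using R by (simp add: ennreal_mult'[symmetric] mult_ac ennreal_leI)
      qed
      also have "\<dots> = ennreal (m * m) * (\<integral>\<^sup>+z. ennreal (?B z) \<partial>(lborel \<Otimes>\<^sub>M lborel))"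
        by (intro nn_integral_cmult) measurable
      also have "(\<integral>\<^sup>+z. ennreal (?B z) \<partial>(lborel \<Otimes>\<^sub>M lborel))
        = (\<integral>\<^sup>+v. \<integral>\<^sup>+r. ennreal (indicator {0..R} r * indicator {0..R} v * \<bar>r - v\<bar> powr (2*q - 1)) \<partial>lborel \<partial>lborel)"
        by (subst lborel_pair.nn_integral_snd[symmetric]) auto
      also have "ennreal (m * m) * \<dots> \<le> ennreal (m * m) * ennreal (R * (2 * R powr (2*q) / (2*q)))"
        using riesz_pulse_nn_integral[of "2*q" R] q R by (intro mult_left_mono) auto
      also have "\<dots> < \<infinity>" by (simp add: ennreal_mult_less_top)
      finally show ?thesis .
    qed
    interpret P: pair_sigma_finite lborel "lborel \<Otimes>\<^sub>M lborel :: (real \<times> real) measure"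
      by (intro pair_sigma_finite.intro sigma_finite_lborel) (simp add: lborel_prod sigma_finite_lborel)
    have iG: "integrable (lborel \<Otimes>\<^sub>M (lborel \<Otimes>\<^sub>M lborel)) (\<lambda>(w, z). G w z)"
      unfolding integrable_iff_bounded
    proof (intro conjI Gm)
      have "(\<integral>\<^sup>+x. ennreal (norm (case x of (w, z) \<Rightarrow> G w z)) \<partial>(lborel \<Otimes>\<^sub>M (lborel \<Otimes>\<^sub>M lborel)))
         = (\<integral>\<^sup>+z. \<integral>\<^sup>+w. ennreal (norm (G w z)) \<partial>lborel \<partial>(lborel \<Otimes>\<^sub>M lborel))"
        by (subst P.nn_integral_snd[symmetric]) auto
      also have "\<dots> = (\<integral>\<^sup>+z. ennreal \<kappa> * ennreal (?A z) \<partial>(lborel \<Otimes>\<^sub>M lborel))"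
        using diag by (intro nn_integral_cong_AE, eventually_elim) (use \<kappa> in \<open>simp add: nG ennreal_mult'[symmetric]\<close>)
      also have "\<dots> = ennreal \<kappa> * (\<integral>\<^sup>+z. ennreal (?A z) \<partial>(lborel \<Otimes>\<^sub>M lborel))"
        by (intro nn_integral_cmult) measurable
      also have "\<dots> < \<infinity>" using fin by (simp add: ennreal_mult_less_top)
      finally show "(\<integral>\<^sup>+x. ennreal (norm (case x of (w, z) \<Rightarrow> G w z)) \<partial>(lborel \<Otimes>\<^sub>M (lborel \<Otimes>\<^sub>M lborel))) < \<infinity>" .
    qed
    have sm: "(LINT z|(lborel \<Otimes>\<^sub>M lborel). G w z) = complex_of_real ((norm (causal_smoothing q h w))\<^sup>2)"
      if "integrable (lborel \<Otimes>\<^sub>M lborel) (G w)" for w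
    proof -
      have "(LINT z|(lborel \<Otimes>\<^sub>M lborel). G w z) = (LINT v|lborel. LINT r|lborel. G w (r, v))"
        using lborel_pair.integral_snd[of "\<lambda>r v. G w (r, v)"] that by simp
      also have "\<dots> = (LINT v|lborel. causal_smoothing q h w * cnj (h v * complex_of_real (?k w v)))"
      proof (intro Bochner_Integration.integral_cong refl)
        fix v
        have "(LINT r|lborel. G w (r, v)) = (LINT r|lborel. (h r * complex_of_real (?k w r)) * cnj (h v * complex_of_real (?k w v)))"
          by (intro Bochner_Integration.integral_cong) (simp_all add: G_def mult_ac)
        also have "\<dots> = causal_smoothing q h w * cnj (h v * complex_of_real (?k w v))"
          unfolding causal_smoothing_def by (rule integral_mult_left_zero)
        finally show "(LINT r|lborel. G w (r, v)) = causal_smoothing q h w * cnj (h v * complex_of_real (?k w v))" .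
      qed
      also have "\<dots> = causal_smoothing q h w * cnj (causal_smoothing q h w)"
        unfolding causal_smoothing_def Bochner_Integration.integral_cnj[symmetric]
        by (rule integral_mult_right_zero)
      finally show ?thesis by (simp add: complex_norm_square[symmetric])
    qed
    have AEw: "AE w in lborel. (LINT z|(lborel \<Otimes>\<^sub>M lborel). G w z) = complex_of_real ((norm (causal_smoothing q h w))\<^sup>2)"
      using P.AE_integrable_fst'[OF iG] by eventually_elim (simp add: sm)
    have cI: "integrable lborel (\<lambda>w. complex_of_real ((norm (causal_smoothing q h w))\<^sup>2))"
      using P.integrable_fst'[OF iG] AEw
      by (subst integrable_cong_AE[where g="\<lambda>w. LINT z|(lborel \<Otimes>\<^sub>M lborel). G w z"]) auto
    have 1: "integrable lborel (\<lambda>w. (norm (causal_smoothing q h w))\<^sup>2)"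
      using integrable_Re[OF cI] by simp
    have intG: "(LINT w|lborel. G w z) = \<kappa> *\<^sub>R (ii (fst z) (snd z) *
        (h (fst z) * cnj (h (snd z)) * complex_of_real (\<bar>fst z - snd z\<bar> powr (2*H - 2))))"
      if "fst z \<noteq> snd z" for z
    proof -
      have "has_bochner_integral lborel (\<lambda>w. ?k w (fst z) * ?k w (snd z)) (\<kappa> * ?K z)"
        using kk[OF that] \<kappa> by (intro has_bochner_integral_nn_integral) (auto simp: ii_def)
      then have "(LINT w|lborel. ?k w (fst z) * ?k w (snd z)) = \<kappa> * ?K z"
        by (rule has_bochner_integral_integral_eq)
      then have "(LINT w|lborel. complex_of_real (?k w (fst z) * ?k w (snd z))) = complex_of_real (\<kappa> * ?K z)"
        by (simp only: integral_complex_of_real)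
      then have "(LINT w|lborel. G w z) = h (fst z) * cnj (h (snd z)) * complex_of_real (\<kappa> * ?K z)"
        unfolding G_def by (subst integral_mult_right_zero) simp
      then show ?thesis using q(3) by (simp add: scaleR_conv_of_real mult_ac)
    qed
    let ?F = "\<lambda>(r, v). indicator {0<..} r * indicator {0<..} v *
        (h r * cnj (h v) * complex_of_real (\<bar>r - v\<bar> powr (2*H - 2)))"
    have AEz: "AE z in lborel \<Otimes>\<^sub>M lborel. (LINT w|lborel. G w z) = \<kappa> *\<^sub>R ?F z"
      using diag by eventually_elim (simp add: intG ii_def case_prod_beta of_real_indicator)
    have "integrable (lborel \<Otimes>\<^sub>M lborel) (\<lambda>z. \<kappa> *\<^sub>R ?F z)"
      using P.integrable_snd[of G] iG AEz
      by (subst integrable_cong_AE[where g="\<lambda>z. LINT w|lborel. G w z"]) auto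
    then have "integrable (lborel \<Otimes>\<^sub>M lborel) (\<lambda>z. (1 / \<kappa>) *\<^sub>R (\<kappa> *\<^sub>R ?F z))"
      by (rule integrable_scaleR_right)
    moreover have "(1 / \<kappa>) *\<^sub>R (\<kappa> *\<^sub>R x) = x" for x :: complex
      using \<kappa> by simp
    ultimately have 3: "integrable (lborel \<Otimes>\<^sub>M lborel) ?F"
      by (simp only:)
    have "complex_of_real (LINT w|lborel. (norm (causal_smoothing q h w))\<^sup>2) = (LINT w|lborel. LINT z|(lborel \<Otimes>\<^sub>M lborel). G w z)"
      unfolding integral_complex_of_real[symmetric] using AEw
      by (intro integral_cong_AE) (auto elim: eventually_mono)
    also have "\<dots> = (LINT z|(lborel \<Otimes>\<^sub>M lborel). LINT w|lborel. G w z)"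
      using P.Fubini_integral[of G] iG by simp
    also have "\<dots> = (LINT z|(lborel \<Otimes>\<^sub>M lborel). \<kappa> *\<^sub>R ?F z)"
      using AEz by (intro integral_cong_AE) auto
    also have "\<dots> = \<kappa> *\<^sub>R (LINT z|(lborel \<Otimes>\<^sub>M lborel). ?F z)" by simp
    also have "(LINT z|(lborel \<Otimes>\<^sub>M lborel). ?F z) = (LINT v|lborel. LINT r|lborel. ?F (r, v))"
      using lborel_pair.integral_snd[of "\<lambda>r v. ?F (r, v)"] 3 by simp
    also have "\<dots> = (LINT v|lborel. LINT r|lborel. indicator {0<..} v *\<^sub>R (indicator {0<..} r *\<^sub>R
        (h r * cnj (h v) * complex_of_real (\<bar>r - v\<bar> powr (2*H - 2)))))"
      by (intro Bochner_Integration.integral_cong refl) (simp split: split_indicator)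
    also have "\<dots> = frac_form H h"
      by (simp add: frac_form_def set_lebesgue_integral_def del: scaleR_scaleR)
    finally have 2: "complex_of_real \<kappa> * frac_form H h = complex_of_real (LINT w|lborel. (norm (causal_smoothing q h w))\<^sup>2)"
      by (simp add: scaleR_conv_of_real)
    show ?thesis using 1 2 by blast
  qed
  show thesis
    using main unfolding q_def by (intro that[OF \<kappa>]) blast+
qed

section \<open>The energy of a time profile\<close>

definition energy :: "real \<Rightarrow> (real \<Rightarrow> complex) \<Rightarrow> real" where
  "energy H h = Re (frac_form H h)"

lemma frac_form_cmult: "frac_form H (\<lambda>r. c * h r) = complex_of_real ((norm c)\<^sup>2) * frac_form H h"
proof -
  have "frac_form H (\<lambda>r. c * h r) = (LINT v:{0<..}|lborel. LINT r:{0<..}|lborel. (c * cnj c) *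
     (h r * cnj (h v) * complex_of_real (\<bar>r - v\<bar> powr (2*H - 2))))"
    unfolding frac_form_def by (simp add: mult_ac)
  then show ?thesis
    by (simp add: frac_form_def complex_norm_square[symmetric] del: of_real_power)
qed

lemma energy_cmult: "energy H (\<lambda>r. c * h r) = (norm c)\<^sup>2 * energy H h"
  by (simp add: energy_def frac_form_cmult del: of_real_power)

lemma energy_cong:
  assumes "\<And>r. 0 < r \<Longrightarrow> h r = g r"
  shows "energy H h = energy H g"
  unfolding energy_def frac_form_def
  by (intro arg_cong[where f=Re] set_lebesgue_integral_cong ballI allI impI) (auto simp: assms)

lemma energy_smoothing:
  assumes H: "1/2 < H" "H < 1"
  shows "\<exists>\<kappa>>0. \<forall>h. pulse h \<longrightarrow>
    integrable lborel (\<lambda>w. (norm (causal_smoothing (H - 1/2) h w))\<^sup>2) \<and>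
    energy H h = \<kappa> * (LINT w|lborel. (norm (causal_smoothing (H - 1/2) h w))\<^sup>2) \<and>
    frac_form H h = complex_of_real (energy H h)"
proof (rule frac_form_eq_smoothing[OF H])
  fix \<kappa> :: real
  assume \<kappa>: "0 < \<kappa>"
    "\<And>h. pulse h \<Longrightarrow> integrable lborel (\<lambda>w. (norm (causal_smoothing (H - 1/2) h w))\<^sup>2)"
    "\<And>h. pulse h \<Longrightarrow> complex_of_real \<kappa> * frac_form H h =
       complex_of_real (LINT w|lborel. (norm (causal_smoothing (H - 1/2) h w))\<^sup>2)"
  have *: "frac_form H h = complex_of_real (1 / \<kappa> * (LINT w|lborel. (norm (causal_smoothing (H - 1/2) h w))\<^sup>2))"
    if "pulse h" for h
  proof -
    have "frac_form H h = complex_of_real (1 / \<kappa>) * (complex_of_real \<kappa> * frac_form H h)"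
      using \<kappa>(1) by simp
    then show ?thesis unfolding \<kappa>(3)[OF that] by (simp only: of_real_mult)
  qed
  show ?thesis
    by (intro exI[of _ "1 / \<kappa>"]) (use \<kappa>(1,2) in \<open>auto simp: energy_def * simp del: of_real_mult of_real_divide\<close>)
qed

lemma energy_nonneg:
  assumes H: "1/2 < H" "H < 1" and "pulse h" shows "0 \<le> energy H h"
proof -
  obtain \<kappa> where \<kappa>: "0 < \<kappa>"
    "\<And>h. pulse h \<Longrightarrow> integrable lborel (\<lambda>w. (norm (causal_smoothing (H - 1/2) h w))\<^sup>2)"
    "\<And>h. pulse h \<Longrightarrow> energy H h = \<kappa> * (LINT w|lborel. (norm (causal_smoothing (H - 1/2) h w))\<^sup>2)"
    "\<And>h. pulse h \<Longrightarrow> frac_form H h = complex_of_real (energy H h)"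
    using energy_smoothing[OF H] by blast
  then show ?thesis using assms by simp
qed

lemma frac_form_eq_energy:
  assumes H: "1/2 < H" "H < 1" and "pulse h" shows "frac_form H h = complex_of_real (energy H h)"
proof -
  obtain \<kappa> where \<kappa>: "0 < \<kappa>"
    "\<And>h. pulse h \<Longrightarrow> integrable lborel (\<lambda>w. (norm (causal_smoothing (H - 1/2) h w))\<^sup>2)"
    "\<And>h. pulse h \<Longrightarrow> energy H h = \<kappa> * (LINT w|lborel. (norm (causal_smoothing (H - 1/2) h w))\<^sup>2)"
    "\<And>h. pulse h \<Longrightarrow> frac_form H h = complex_of_real (energy H h)"
    using energy_smoothing[OF H] by blast
  then show ?thesis using assms(3) by simp
qed

lemma norm_add_power2_le: "(norm (x + y))\<^sup>2 \<le> 2 * (norm x)\<^sup>2 + 2 * (norm y)\<^sup>2"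
  for x y :: "'b::real_normed_vector"
proof -
  have "(norm (x + y))\<^sup>2 \<le> (norm x + norm y)\<^sup>2"
    by (intro power_mono norm_triangle_ineq) auto
  also have "\<dots> \<le> 2 * (norm x)\<^sup>2 + 2 * (norm y)\<^sup>2"
    using sum_squares_bound[of "norm x" "norm y"] by (simp add: power2_sum)
  finally show ?thesis .
qed

text \<open>The inequality holds pointwise for the squared smoothings. It takes the place of the triangle
  inequality where a constant factor is harmless.\<close>

lemma energy_add_le:
  assumes H: "1/2 < H" "H < 1" and fg: "pulse f" "pulse g"
  shows "energy H (\<lambda>r. f r + g r) \<le> 2 * energy H f + 2 * energy H g"
proof -
  obtain \<kappa> where \<kappa>: "0 < \<kappa>"
    "\<And>h. pulse h \<Longrightarrow> integrable lborel (\<lambda>w. (norm (causal_smoothing (H - 1/2) h w))\<^sup>2)"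
    "\<And>h. pulse h \<Longrightarrow> energy H h = \<kappa> * (LINT w|lborel. (norm (causal_smoothing (H - 1/2) h w))\<^sup>2)"
    "\<And>h. pulse h \<Longrightarrow> frac_form H h = complex_of_real (energy H h)"
    using energy_smoothing[OF H] by blast
  let ?N = "\<lambda>h. (LINT w|lborel. (norm (causal_smoothing (H - 1/2) h w))\<^sup>2)"
  have "?N (\<lambda>r. f r + g r) \<le> (LINT w|lborel. 2 * (norm (causal_smoothing (H - 1/2) f w))\<^sup>2 + 2 * (norm (causal_smoothing (H - 1/2) g w))\<^sup>2)"
    using \<kappa>(2)[OF pulse_add[OF fg]] \<kappa>(2)[OF fg(1)] \<kappa>(2)[OF fg(2)] fg H
    by (intro integral_mono) (auto simp: causal_smoothing_add norm_add_power2_le)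
  also have "\<dots> = 2 * ?N f + 2 * ?N g"
    using \<kappa>(2) fg by simp
  finally have "\<kappa> * ?N (\<lambda>r. f r + g r) \<le> \<kappa> * (2 * ?N f + 2 * ?N g)"
    using \<kappa>(1) by (intro mult_left_mono) auto
  then show ?thesis using \<kappa>(3) fg by (simp add: pulse_add algebra_simps)
qed

text \<open>Sampling at two points a quarter period apart: the two exponentials have equal sign at the
  first point and opposite sign at the second, so by the parallelogram law they cannot cancel at both.\<close>

lemma two_point_bound:
  fixes a b g g' :: complex
  assumes g: "c \<le> norm g" "0 \<le> c" and e: "norm (g' - g) \<le> c / 2"
  shows "c\<^sup>2 * ((norm a)\<^sup>2 + (norm b)\<^sup>2) \<le> (norm (a * g + b * cnj g))\<^sup>2 + 2 * (norm (a * g' - b * cnj g'))\<^sup>2"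
proof -
  define S where "S = (norm a)\<^sup>2 + (norm b)\<^sup>2"
  have "(norm (a * g - b * cnj g))\<^sup>2 = (norm ((a * g' - b * cnj g') + (b * cnj (g' - g) - a * (g' - g))))\<^sup>2"
    by (simp add: algebra_simps)
  also have "\<dots> \<le> 2 * (norm (a * g' - b * cnj g'))\<^sup>2 + 2 * (norm (b * cnj (g' - g) - a * (g' - g)))\<^sup>2"
    by (rule norm_add_power2_le)
  also have "(norm (b * cnj (g' - g) - a * (g' - g)))\<^sup>2 \<le> 2 * (norm (b * cnj (g' - g)))\<^sup>2 + 2 * (norm (a * (g' - g)))\<^sup>2"
    using norm_add_power2_le[of "b * cnj (g' - g)" "- (a * (g' - g))"] by simp
  also have "\<dots> = 2 * S * (norm (g' - g))\<^sup>2"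
    unfolding norm_mult power_mult_distrib complex_mod_cnj S_def by (simp add: algebra_simps)
  also have "\<dots> \<le> 2 * S * (c / 2)\<^sup>2"
    using e by (intro mult_left_mono power_mono) (auto simp: S_def)
  finally have 1: "(norm (a * g - b * cnj g))\<^sup>2 \<le> 2 * (norm (a * g' - b * cnj g'))\<^sup>2 + S * c\<^sup>2"
    by (simp add: power_divide)
  have "(norm (a * g + b * cnj g))\<^sup>2 + (norm (a * g - b * cnj g))\<^sup>2 = 2 * (norm (a * g))\<^sup>2 + 2 * (norm (b * cnj g))\<^sup>2"
    by (simp only: cmod_power2) (simp add: power2_eq_square algebra_simps)
  also have "\<dots> = 2 * S * (norm g)\<^sup>2"
    by (simp add: norm_mult power_mult_distrib S_def algebra_simps)
  also have "\<dots> \<ge> 2 * S * c\<^sup>2"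
    using g by (intro mult_left_mono power_mono) (auto simp: S_def)
  finally have "2 * S * c\<^sup>2 \<le> (norm (a * g + b * cnj g))\<^sup>2 + (norm (a * g - b * cnj g))\<^sup>2" .
  with 1 show ?thesis by (simp add: S_def[symmetric] mult.commute)
qed

lemma osc_0 [simp]: "osc p 0 = 0"
proof -
  have "AE v in lborel. indicator {0..0} v *\<^sub>R (cis v * complex_of_real (v powr (p - 1))) = 0"
    using AE_lborel_singleton[of "0::real"] by eventually_elim auto
  then show ?thesis unfolding osc_def set_lebesgue_integral_def by (rule integral_eq_zero_AE)
qed

text \<open>Substituting \<open>r = w - v\<close> pulls \<open>exp(\<plusminus>i\<rho>w)\<close> out of each integral and leaves an incomplete Gamma
  integral, the slowly varying amplitude.\<close>

lemma causal_smoothing_exponential: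
  assumes q: "0 < q" and \<rho>: "0 < \<rho>" and w: "0 \<le> w" "w \<le> t\<^sub>0"
    and h: "\<And>r. 0 < r \<Longrightarrow> r < t\<^sub>0 \<Longrightarrow> h r = A * cis (- (\<rho> * r)) + B * cis (\<rho> * r)"
    and [measurable]: "h \<in> borel_measurable borel"
  shows "causal_smoothing q h w = complex_of_real (\<rho> powr (- q)) *
    (A * cis (- (\<rho> * w)) * osc q (\<rho> * w) + B * cis (\<rho> * w) * cnj (osc q (\<rho> * w)))"
proof -
  let ?k = "\<lambda>v. indicator {0..w} v *\<^sub>R (cis (\<rho> * v) * complex_of_real (v powr (q - 1)))"
  have ik: "integrable lborel ?k"
    using set_integrable_osc[of q 0 w \<rho>] q by (simp add: set_integrable_def)
  have int: "(LINT v|lborel. ?k v) = complex_of_real (\<rho> powr (- q)) * osc q (\<rho> * w)"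
    using osc_scaled[of q \<rho> 0 w] assms by (simp add: set_lebesgue_integral_def)
  have "causal_smoothing q h w = (LINT v|lborel. h (w + - 1 * v) * complex_of_real (causal_kernel q w (w + - 1 * v)))"
    unfolding causal_smoothing_def by (subst lborel_integral_real_affine[where c="-1" and t=w]) auto
  also have "\<dots> = (LINT v|lborel. A * cis (- (\<rho> * w)) * ?k v + B * cis (\<rho> * w) * cnj (?k v))"
  proof (rule integral_cong_AE)
    show "AE v in lborel. h (w + - 1 * v) * complex_of_real (causal_kernel q w (w + - 1 * v)) =
       A * cis (- (\<rho> * w)) * ?k v + B * cis (\<rho> * w) * cnj (?k v)"
      using AE_lborel_singleton[of w]
    proof eventually_elim
      case (elim v)
      show ?case
      proof (cases "0 < v \<and> v < w")
        case True
        have "cis (- (\<rho> * (w - v))) = cis (- (\<rho> * w)) * cis (\<rho> * v)"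
          "cis (\<rho> * (w - v)) = cis (\<rho> * w) * cnj (cis (\<rho> * v))"
          by (simp_all add: cis_mult cis_cnj algebra_simps)
        moreover have "h (w - v) = A * cis (- (\<rho> * (w - v))) + B * cis (\<rho> * (w - v))"
          using True w by (intro h) auto
        ultimately show ?thesis
          using True by (simp add: causal_kernel_def algebra_simps)
      next
        case False
        then show ?thesis using elim by (auto simp: causal_kernel_def indicator_def)
      qed
    qed
  qed measurable
  also have "\<dots> = A * cis (- (\<rho> * w)) * (LINT v|lborel. ?k v) + B * cis (\<rho> * w) * cnj (LINT v|lborel. ?k v)"
    using ik by (subst Bochner_Integration.integral_add) (auto simp only: integral_mult_right_zero Bochner_Integration.integral_cnj intro!: integrable_mult_right integrable_cnj)
  finally show ?thesis unfolding int by (simp add: algebra_simps)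
qed

text \<open>Of the squared norm only \<open>w < t\<^sub>0\<close> is kept, which involves \<open>h\<close> on \<open>(0,t\<^sub>0)\<close> alone. At the points \<open>w\<close> and \<open>w + \<pi>/(2\<rho>)\<close> the two exponentials interfere with opposite signs, so the sum of
  the two squares is bounded below by \<open>\<rho> powr (-2q) (\<bar>A\<bar>\<^sup>2 + \<bar>B\<bar>\<^sup>2)\<close>, and \<open>2q = 2H - 1\<close>.\<close>

lemma energy_exponential_ge:
  assumes H: "1/2 < H" "H < 1" and t0: "0 < t\<^sub>0"
  obtains c K where "0 < c" "0 < K"
    "\<And>h A B \<rho>. pulse h \<Longrightarrow> K \<le> \<rho> \<Longrightarrow>
      (\<And>r. 0 < r \<Longrightarrow> r < t\<^sub>0 \<Longrightarrow> h r = A * cis (- (\<rho> * r)) + B * cis (\<rho> * r)) \<Longrightarrow>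
      c * \<rho> powr (1 - 2*H) * ((norm A)\<^sup>2 + (norm B)\<^sup>2) \<le> energy H h"
proof -
  define q where "q = H - 1/2"
  have q: "0 < q" "q < 1" using H by (auto simp: q_def)
  obtain \<kappa> where \<kappa>0: "0 < \<kappa>"
    "\<And>h. pulse h \<Longrightarrow> integrable lborel (\<lambda>w. (norm (causal_smoothing (H - 1/2) h w))\<^sup>2)"
    "\<And>h. pulse h \<Longrightarrow> energy H h = \<kappa> * (LINT w|lborel. (norm (causal_smoothing (H - 1/2) h w))\<^sup>2)"
    "\<And>h. pulse h \<Longrightarrow> frac_form H h = complex_of_real (energy H h)"
    using energy_smoothing[OF H] by blast
  note \<kappa> = \<kappa>0[folded q_def]
  obtain c0 where c0: "0 < c0" "\<And>x. 2 \<le> x \<Longrightarrow> c0 \<le> norm (osc q x)"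
    using norm_osc_ge[OF q] by blast
  \<comment> \<open>beyond \<open>x0\<close> the amplitude changes by at most half its lower bound within a quarter period\<close>
  define x0 where "x0 = max 2 ((pi / c0) powr (1 / (1 - q)))"
  have x0: "pi / 2 * x0 powr (q - 1) \<le> c0 / 2" "2 \<le> x0"
  proof -
    have "x0 powr (q - 1) \<le> ((pi / c0) powr (1 / (1 - q))) powr (q - 1)"
      using q c0 by (intro powr_mono2') (auto simp: x0_def)
    also have "\<dots> = (pi / c0) powr (- 1)"
    proof -
      have "1 / (1 - q) * (q - 1) = - 1" using q by (simp add: field_simps)
      then show ?thesis by (simp only: powr_powr)
    qed
    also have "\<dots> = c0 / pi" using c0 by (simp add: powr_minus)
    finally show "pi / 2 * x0 powr (q - 1) \<le> c0 / 2" by (simp add: field_simps)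
  qed (simp add: x0_def)
  \<comment> \<open>for \<open>\<rho> \<ge> K\<close> the admissible points \<open>w\<close> fill at least half of \<open>[0, t\<^sub>0]\<close>\<close>
  define K where "K = 2 * (x0 + pi / 2) / t\<^sub>0"
  define c where "c = \<kappa> * c0\<^sup>2 * t\<^sub>0 / 6"
  have "0 < K" using x0 t0 pi_gt_zero by (simp add: K_def add_pos_pos)
  show thesis
  proof (rule that[of c K])
    show "0 < c" using \<kappa>(1) c0 t0 by (simp add: c_def)
    show "0 < K" by fact
    fix h A B \<rho>
    assume h: "pulse h" and "K \<le> \<rho>"
      and hr: "\<And>r. 0 < r \<Longrightarrow> r < t\<^sub>0 \<Longrightarrow> h r = A * cis (- (\<rho> * r)) + B * cis (\<rho> * r)"
    then have \<rho>: "0 < \<rho>" using \<open>0 < K\<close> by simp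
    note [measurable] = pulse_measurable[OF h]
    define S where "S = (norm A)\<^sup>2 + (norm B)\<^sup>2"
    define d where "d = pi / (2 * \<rho>)"
    define F where "F = (\<lambda>w. (norm (causal_smoothing q h w))\<^sup>2)"
    have iF: "integrable lborel F" using \<kappa>(2)[OF h] by (simp add: F_def)
    have d: "0 < d" using \<rho> by (simp add: d_def)
    have len: "x0 / \<rho> \<le> t\<^sub>0 - d" "t\<^sub>0 / 2 \<le> t\<^sub>0 - d - x0 / \<rho>"
    proof -
      have "(x0 + pi / 2) / \<rho> \<le> (x0 + pi / 2) / K"
        using \<open>K \<le> \<rho>\<close> \<open>0 < K\<close> x0 pi_gt_zero by (intro divide_left_mono) auto
      also have "\<dots> = t\<^sub>0 / 2"
      proof -
        have "0 < x0 + pi / 2" using x0(2) pi_gt_zero by (intro add_pos_pos) auto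
        moreover have "X / (2 * X / t\<^sub>0) = t\<^sub>0 / 2" if "0 < X" for X using that t0 by simp
        ultimately show ?thesis unfolding K_def by blast
      qed
      finally have "x0 / \<rho> + d \<le> t\<^sub>0 / 2" by (simp add: d_def add_divide_distrib)
      then show "x0 / \<rho> \<le> t\<^sub>0 - d" "t\<^sub>0 / 2 \<le> t\<^sub>0 - d - x0 / \<rho>" using t0 by linarith+
    qed
    have pt: "\<rho> powr (1 - 2*H) * (c0\<^sup>2 * S) \<le> F w + 2 * F (d + 1 * w)" if w: "x0 / \<rho> \<le> w" "w \<le> t\<^sub>0 - d" for w
    proof -
      have "0 \<le> x0 / \<rho>" using x0(2) \<rho> by simp
      then have w0: "0 \<le> w" using w by linarith
      have xw: "x0 \<le> \<rho> * w" using w \<rho> by (simp add: pos_divide_le_eq mult.commute)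
      have \<rho>d: "\<rho> * (w + d) = \<rho> * w + pi / 2" using \<rho> by (simp add: d_def field_simps)
      let ?g = "osc q (\<rho> * w)" and ?g' = "osc q (\<rho> * w + pi / 2)"
      let ?a = "A * cis (- (\<rho> * w))" and ?b = "B * cis (\<rho> * w)"
      have K1: "causal_smoothing q h w = complex_of_real (\<rho> powr (- q)) * (?a * ?g + ?b * cnj ?g)"
        using causal_smoothing_exponential[of q \<rho> w t\<^sub>0 h A B] q \<rho> w0 w d hr by (simp add: algebra_simps)
      have cisd: "cis (- (\<rho> * w + pi / 2)) = - \<i> * cis (- (\<rho> * w))" "cis (\<rho> * w + pi / 2) = \<i> * cis (\<rho> * w)"
        by (simp_all add: cis_mult[symmetric] minus_add_distrib[symmetric] del: minus_add_distrib)
          (simp add: complex_eq_iff cos_add sin_add cos_diff sin_diff)+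
      have "causal_smoothing q h (w + d) = complex_of_real (\<rho> powr (- q)) *
          (A * cis (- (\<rho> * w + pi / 2)) * ?g' + B * cis (\<rho> * w + pi / 2) * cnj ?g')"
        using causal_smoothing_exponential[of q \<rho> "w + d" t\<^sub>0 h A B] q \<rho> w0 w d hr unfolding \<rho>d by simp
      also have "\<dots> = complex_of_real (\<rho> powr (- q)) * (- \<i> * (?a * ?g' - ?b * cnj ?g'))"
        unfolding cisd by (simp add: algebra_simps)
      finally have K2: "causal_smoothing q h (w + d) = complex_of_real (\<rho> powr (- q)) * (- \<i> * (?a * ?g' - ?b * cnj ?g'))" .
      have "norm (?g' - ?g) \<le> (\<rho> * w + pi / 2 - \<rho> * w) * (\<rho> * w) powr (q - 1)"
        using q xw x0(2) pi_gt_zero by (intro norm_osc_diff_le) auto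
      also have "\<dots> \<le> pi / 2 * x0 powr (q - 1)"
        using q xw x0(2) by (auto intro!: powr_mono2')
      finally have e: "norm (?g' - ?g) \<le> c0 / 2" using x0(1) by simp
      have "c0\<^sup>2 * ((norm ?a)\<^sup>2 + (norm ?b)\<^sup>2) \<le> (norm (?a * ?g + ?b * cnj ?g))\<^sup>2 + 2 * (norm (?a * ?g' - ?b * cnj ?g'))\<^sup>2"
        using c0 xw x0(2) e by (intro two_point_bound) auto
      then have "c0\<^sup>2 * S \<le> (norm (?a * ?g + ?b * cnj ?g))\<^sup>2 + 2 * (norm (?a * ?g' - ?b * cnj ?g'))\<^sup>2"
        by (simp add: S_def norm_mult)
      then have "(\<rho> powr (- q))\<^sup>2 * (c0\<^sup>2 * S) \<le> (\<rho> powr (- q))\<^sup>2 * ((norm (?a * ?g + ?b * cnj ?g))\<^sup>2 + 2 * (norm (?a * ?g' - ?b * cnj ?g'))\<^sup>2)"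
        by (intro mult_left_mono) auto
      also have "\<dots> = F w + 2 * F (d + 1 * w)"
      proof -
        have "F w = (\<rho> powr (- q))\<^sup>2 * (norm (?a * ?g + ?b * cnj ?g))\<^sup>2"
          unfolding F_def K1 norm_mult power_mult_distrib by simp
        moreover have "F (w + d) = (\<rho> powr (- q))\<^sup>2 * (norm (?a * ?g' - ?b * cnj ?g'))\<^sup>2"
          unfolding F_def K2 norm_mult power_mult_distrib by simp
        ultimately show ?thesis by (simp add: distrib_left add.commute[of d])
      qed
      also have "(\<rho> powr (- q))\<^sup>2 = \<rho> powr (1 - 2*H)"
        by (simp add: power2_eq_square q_def flip: powr_add)
      finally show ?thesis .
    qed
    have iF': "integrable lborel (\<lambda>w. F (d + 1 * w))"
      by (rule lborel_integrable_real_affine[OF iF]) simp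
    have F0: "0 \<le> F w" for w by (simp add: F_def)
    have "\<rho> powr (1 - 2*H) * (c0\<^sup>2 * S) * (t\<^sub>0 / 2) \<le> \<rho> powr (1 - 2*H) * (c0\<^sup>2 * S) * (t\<^sub>0 - d - x0 / \<rho>)"
      using len by (intro mult_left_mono) (auto simp: S_def)
    also have "\<dots> = (LINT w|lborel. indicator {x0 / \<rho>..t\<^sub>0 - d} w *\<^sub>R (\<rho> powr (1 - 2*H) * (c0\<^sup>2 * S)))"
      using len by simp
    also have "\<dots> \<le> (LINT w|lborel. F w + 2 * F (d + 1 * w))"
    proof (rule integral_mono)
      show "integrable lborel (\<lambda>w. indicator {x0 / \<rho>..t\<^sub>0 - d} w *\<^sub>R (\<rho> powr (1 - 2*H) * (c0\<^sup>2 * S)))"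
        using borel_integrable_atLeastAtMost'[of "x0 / \<rho>" "t\<^sub>0 - d" "\<lambda>_. \<rho> powr (1 - 2*H) * (c0\<^sup>2 * S)"]
        by (simp add: set_integrable_def)
      show "indicator {x0 / \<rho>..t\<^sub>0 - d} w *\<^sub>R (\<rho> powr (1 - 2*H) * (c0\<^sup>2 * S)) \<le> F w + 2 * F (d + 1 * w)" for w
        using pt[of w] F0[of w] F0[of "d + w"] by (auto split: split_indicator)
    qed (intro Bochner_Integration.integrable_add integrable_mult_right iF iF')
    also have "\<dots> = (LINT w|lborel. F w) + 2 * (LINT w|lborel. F (d + 1 * w))"
      using iF iF' by (subst Bochner_Integration.integral_add) auto
    also have "(LINT w|lborel. F (d + 1 * w)) = (LINT w|lborel. F w)"
      by (subst (2) lborel_integral_real_affine[where c=1 and t=d]) auto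
    finally have "\<rho> powr (1 - 2*H) * (c0\<^sup>2 * S) * (t\<^sub>0 / 2) \<le> 3 * (LINT w|lborel. F w)" by simp
    then have "\<kappa> * (\<rho> powr (1 - 2*H) * (c0\<^sup>2 * S) * (t\<^sub>0 / 2)) \<le> \<kappa> * (3 * (LINT w|lborel. F w))"
      using \<kappa>(1) by (intro mult_left_mono) auto
    then show "c * \<rho> powr (1 - 2*H) * ((norm A)\<^sup>2 + (norm B)\<^sup>2) \<le> energy H h"
      unfolding \<kappa>(3)[OF h] S_def[symmetric] by (simp add: F_def[symmetric] c_def mult_ac)
  qed
qed

lemma integral_norm_le:
  fixes f :: "'a \<Rightarrow> 'b::{banach, second_countable_topology}"
  assumes "integrable M g" "\<And>x. norm (f x) \<le> g x"
  shows "norm (integral\<^sup>L M f) \<le> integral\<^sup>L M g"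
proof -
  have "0 \<le> g x" for x using norm_ge_zero assms(2) by (rule order_trans)
  then have "(\<integral>x. norm (f x) \<partial>M) \<le> integral\<^sup>L M g"
    using assms by (intro integral_mono') auto
  then show ?thesis using integral_norm_bound[of M f] by (rule order_trans[rotated])
qed

text \<open>Both upper bounds on the energy estimate the inner integral uniformly in the outer variable.\<close>

lemma energy_le_of_inner_bound:
  assumes ab: "0 \<le> a" "a \<le> b" and h: "\<And>r. norm (h r) \<le> m * indicator {a<..b} r"
    and inner: "\<And>v. a < v \<Longrightarrow> v \<le> b \<Longrightarrow>
      norm (LINT r:{0<..}|lborel. h r * complex_of_real (\<bar>r - v\<bar> powr (2*H - 2))) \<le> D"
  shows "energy H h \<le> m * D * (b - a)"
proof -
  have "norm (frac_form H h) \<le> (LINT v|lborel. indicator {a<..b} v *\<^sub>R (m * D))"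
    unfolding frac_form_def set_lebesgue_integral_def[of _ _ "\<lambda>v. LINT r:{0<..}|lborel. h r * cnj (h v) * complex_of_real (\<bar>r - v\<bar> powr (2*H - 2))"]
  proof (rule integral_norm_le)
    show "integrable lborel (\<lambda>v. indicator {a<..b} v *\<^sub>R (m * D))"
      by (intro integrable_scaleR_left integrable_real_indicator) (use ab in auto)
    fix v
    have "(LINT r:{0<..}|lborel. h r * cnj (h v) * complex_of_real (\<bar>r - v\<bar> powr (2*H - 2))) =
        cnj (h v) * (LINT r:{0<..}|lborel. h r * complex_of_real (\<bar>r - v\<bar> powr (2*H - 2)))"
      by (simp only: set_integral_mult_right[symmetric]) (simp add: mult_ac)
    moreover have "norm (cnj (h v) * (LINT r:{0<..}|lborel. h r * complex_of_real (\<bar>r - v\<bar> powr (2*H - 2)))) \<le> indicator {a<..b} v * (m * D)"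
    proof (cases "a < v \<and> v \<le> b")
      case True
      then have "norm (h v) \<le> m" using h[of v] by simp
      moreover have "0 \<le> m" using \<open>norm (h v) \<le> m\<close> norm_ge_zero order_trans by blast
      ultimately show ?thesis using inner[of v] True by (auto simp: norm_mult intro!: mult_mono)
    next
      case False
      then have "h v = 0" using h[of v] by (auto split: split_indicator_asm)
      then show ?thesis using False by simp
    qed
    ultimately show "norm (indicator {0<..} v *\<^sub>R (LINT r:{0<..}|lborel. h r * cnj (h v) * complex_of_real (\<bar>r - v\<bar> powr (2*H - 2))))
       \<le> indicator {a<..b} v *\<^sub>R (m * D)"
      using ab by (auto split: split_indicator)
  qed
  also have "\<dots> = m * D * (b - a)" using ab by simp
  finally show ?thesis
    unfolding energy_def using complex_Re_le_cmod[of "frac_form H h"] by linarith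
qed

lemma energy_le_of_bounded:
  assumes H: "1/2 < H" and ab: "0 \<le> a" "a \<le> b" and m: "0 \<le> m" "\<And>r. norm (h r) \<le> m * indicator {a<..b} r"
  shows "energy H h \<le> 2 / (2*H - 1) * m\<^sup>2 * (b - a) powr (2*H)"
proof -
  define p where "p = 2*H - 1"
  have p: "0 < p" "2*H - 2 = p - 1" "2*H = p + 1" using H by (auto simp: p_def)
  have "energy H h \<le> m * (m * (2 * (b - a) powr p / p)) * (b - a)"
  proof (rule energy_le_of_inner_bound[OF ab m(2)])
    fix v assume v: "a < v" "v \<le> b"
    have i: "set_integrable lborel {a..b} (\<lambda>r. \<bar>r - v\<bar> powr (p - 1))"
      using abs_powr_set_integral(1)[of p a b v] p ab by simp
    have "norm (LINT r:{0<..}|lborel. h r * complex_of_real (\<bar>r - v\<bar> powr (2*H - 2)))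
       \<le> (LINT r|lborel. m * (indicator {a..b} r *\<^sub>R \<bar>r - v\<bar> powr (p - 1)))"
      unfolding set_lebesgue_integral_def
    proof (rule integral_norm_le)
      show "integrable lborel (\<lambda>r. m * (indicator {a..b} r *\<^sub>R \<bar>r - v\<bar> powr (p - 1)))"
        using i by (simp add: set_integrable_def)
      show "norm (indicator {0<..} r *\<^sub>R (h r * complex_of_real (\<bar>r - v\<bar> powr (2*H - 2))))
         \<le> m * (indicator {a..b} r *\<^sub>R \<bar>r - v\<bar> powr (p - 1))" for r
      proof (cases "a < r \<and> r \<le> b")
        case True
        then show ?thesis using m(2)[of r] ab by (auto simp: norm_mult p(2) intro!: mult_right_mono)
      next
        case False
        then have "h r = 0" using m(2)[of r] by (auto split: split_indicator_asm)
        then show ?thesis using m(1) by simp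
      qed
    qed
    also have "\<dots> = m * (LINT r:{a..b}|lborel. \<bar>r - v\<bar> powr (p - 1))"
      by (simp add: set_lebesgue_integral_def)
    also have "\<dots> = m * (odd_powr p (b - v) - odd_powr p (a - v))"
      using abs_powr_set_integral(2)[of p a b v] p ab by simp
    also have "odd_powr p (b - v) - odd_powr p (a - v) = ((b - v) powr p + (v - a) powr p) / p"
      using v by (simp add: odd_powr_nonneg odd_powr_nonpos add_divide_distrib)
    also have "m * \<dots> \<le> m * (((b - a) powr p + (b - a) powr p) / p)"
      using v p m(1) by (intro mult_left_mono divide_right_mono add_mono powr_mono2) auto
    finally show "norm (LINT r:{0<..}|lborel. h r * complex_of_real (\<bar>r - v\<bar> powr (2*H - 2))) \<le> m * (2 * (b - a) powr p / p)"
      by simp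
  qed
  also have "\<dots> = 2 / p * m\<^sup>2 * ((b - a) * (b - a) powr p)"
    by (simp add: power2_eq_square)
  also have "(b - a) * (b - a) powr p = (b - a) powr (2*H)"
    using ab powr_mult_base[of "b - a" p] by (simp add: p(3) add.commute)
  finally show ?thesis by (simp add: p_def)
qed

text \<open>Oscillation makes the inner integral of size \<open>\<rho> powr (1 - 2H)\<close> uniformly in the outer variable.\<close>

lemma energy_exponential_le:
  assumes H: "1/2 < H" "H < 1" and ab: "0 \<le> a" "a \<le> b" and \<rho>: "0 < \<rho>"
    and h: "\<And>r. h r = indicator {a<..b} r * (A * cis (- (\<rho> * r)) + B * cis (\<rho> * r))"
  shows "energy H h \<le> 4 * (1 / (2*H - 1) + 6) * (b - a) * \<rho> powr (1 - 2*H) * (norm A + norm B)\<^sup>2"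
proof -
  define p where "p = 2*H - 1"
  define C where "C = 4 * (1 / p + 6) * \<rho> powr (- p)"
  have p: "0 < p" "p \<le> 1" "2*H - 2 = p - 1" "1 - 2*H = - p" using H by (auto simp: p_def)
  let ?m = "norm A + norm B"
  have "energy H h \<le> ?m * (?m * C) * (b - a)"
  proof (rule energy_le_of_inner_bound[OF ab])
    show "norm (h r) \<le> ?m * indicator {a<..b} r" for r
      using norm_triangle_ineq[of "A * cis (- (\<rho> * r))" "B * cis (\<rho> * r)"]
      by (auto simp: h norm_mult split: split_indicator)
    fix v assume v: "a < v" "v \<le> b"
    let ?J = "\<lambda>\<sigma>. LINT r:{a..b}|lborel. cis (\<sigma> * r) * complex_of_real (\<bar>v - r\<bar> powr (p - 1))"
    have J: "norm (?J \<rho>) \<le> C" "norm (?J (- \<rho>)) \<le> C"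
      using norm_osc_kernel_le(1)[of p \<rho> a b v] norm_osc_kernel_le(1)[of p "- \<rho>" a b v] p \<rho>
      by (auto simp: C_def)
    have i: "set_integrable lborel {a..b} (\<lambda>r. cis (\<sigma> * r) * complex_of_real (\<bar>v - r\<bar> powr (p - 1)))"
      if "\<sigma> \<noteq> 0" for \<sigma> using norm_osc_kernel_le(2)[of p \<sigma> a b v] p that by simp
    have hm: "h \<in> borel_measurable borel"
      unfolding h[abs_def] by measurable
    have "(LINT r:{0<..}|lborel. h r * complex_of_real (\<bar>r - v\<bar> powr (2*H - 2))) =
        (LINT r:{a..b}|lborel. A * (cis (- \<rho> * r) * complex_of_real (\<bar>v - r\<bar> powr (p - 1))) +
           B * (cis (\<rho> * r) * complex_of_real (\<bar>v - r\<bar> powr (p - 1))))"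
      unfolding set_lebesgue_integral_def
    proof (rule integral_cong_AE)
      show "AE r in lborel. indicator {0<..} r *\<^sub>R (h r * complex_of_real (\<bar>r - v\<bar> powr (2*H - 2))) =
        indicator {a..b} r *\<^sub>R (A * (cis (- \<rho> * r) * complex_of_real (\<bar>v - r\<bar> powr (p - 1))) +
           B * (cis (\<rho> * r) * complex_of_real (\<bar>v - r\<bar> powr (p - 1))))"
        using AE_lborel_singleton[of a] unfolding p(3)
        by eventually_elim (use ab in \<open>auto simp: h algebra_simps abs_minus_commute split: split_indicator\<close>)
    qed (use hm in measurable)
    also have "\<dots> = A * ?J (- \<rho>) + B * ?J \<rho>"
      using i[of \<rho>] i[of "- \<rho>"] \<rho>
      by (subst set_integral_add(2)) (auto intro: set_integrable_mult_right)
    also have "norm \<dots> \<le> norm A * C + norm B * C"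
      using J by (intro norm_triangle_le add_mono) (auto simp: norm_mult intro!: mult_left_mono)
    finally show "norm (LINT r:{0<..}|lborel. h r * complex_of_real (\<bar>r - v\<bar> powr (2*H - 2))) \<le> ?m * C"
      by (simp add: distrib_right)
  qed
  also have "\<dots> = 4 * (1 / (2*H - 1) + 6) * (b - a) * \<rho> powr (1 - 2*H) * (norm A + norm B)\<^sup>2"
    unfolding C_def p(4) p_def[symmetric] by (simp add: power2_eq_square mult_ac)
  finally show ?thesis .
qed

section \<open>Gaussians as test functions\<close>

definition gaussian :: "real \<Rightarrow> real^'n \<Rightarrow> real^'n \<Rightarrow> real" where
  "gaussian s c x = exp (- (norm (x - c))\<^sup>2 / (2 * s\<^sup>2))"

lemma gaussian_pos [simp]: "0 < gaussian s c x"
  by (simp add: gaussian_def)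

lemma gaussian_nonneg [simp]: "0 \<le> gaussian s c x"
  by (simp add: gaussian_def)

lemma measurable_gaussian [measurable (raw)]:
  assumes [measurable]: "f \<in> borel_measurable M" "g \<in> borel_measurable M"
  shows "(\<lambda>x. gaussian s (f x) (g x)) \<in> borel_measurable M"
  unfolding gaussian_def by measurable

text \<open>Polynomial multiples of a Gaussian: a linear class that contains the Gaussian and is stable under
  partial derivatives.\<close>

inductive poly_gaussian :: "real \<Rightarrow> real^'n \<Rightarrow> (real^'n \<Rightarrow> complex) \<Rightarrow> bool" for s c where
  base: "poly_gaussian s c (\<lambda>x. complex_of_real (gaussian s c x))"
| coord: "poly_gaussian s c f \<Longrightarrow> poly_gaussian s c (\<lambda>x. complex_of_real (x $ j) * f x)"
| cmult: "poly_gaussian s c f \<Longrightarrow> poly_gaussian s c (\<lambda>x. a * f x)"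
| add: "poly_gaussian s c f \<Longrightarrow> poly_gaussian s c g \<Longrightarrow> poly_gaussian s c (\<lambda>x. f x + g x)"

lemma poly_gaussian_derivative:
  assumes "poly_gaussian s c f"
  shows "\<exists>f'. (\<forall>x. (f has_derivative f' x) (at x)) \<and> (\<forall>i. poly_gaussian s c (\<lambda>x. f' x (axis i 1)))"
  using assms
proof induction
  case base
  define a where "a = 1 / (2 * s\<^sup>2)"
  have ga: "gaussian s c x = exp (- ((x - c) \<bullet> (x - c)) * a)" for x
    by (simp add: gaussian_def power2_norm_eq_inner a_def)
  let ?f' = "\<lambda>x h. complex_of_real (gaussian s c x * (- 2 * a * ((x - c) \<bullet> h)))"
  have "((\<lambda>x. complex_of_real (gaussian s c x)) has_derivative ?f' x) (at x)" for x
    unfolding ga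
    by (rule has_derivative_of_real)
      (auto intro!: derivative_eq_intros simp: fun_eq_iff inner_diff inner_commute algebra_simps)
  moreover have "poly_gaussian s c (\<lambda>x. ?f' x (axis i 1))" for i
  proof -
    have "poly_gaussian s c (\<lambda>x. complex_of_real (- 2 * a) * (complex_of_real (x $ i) * complex_of_real (gaussian s c x))
       + complex_of_real (2 * a * c $ i) * complex_of_real (gaussian s c x))"
      by (intro poly_gaussian.intros)
    also have "(\<lambda>x. complex_of_real (- 2 * a) * (complex_of_real (x $ i) * complex_of_real (gaussian s c x))
       + complex_of_real (2 * a * c $ i) * complex_of_real (gaussian s c x)) = (\<lambda>x. ?f' x (axis i 1))"
      by (simp add: fun_eq_iff inner_axis algebra_simps)
    finally show ?thesis .
  qed
  ultimately show ?case by (intro exI[of _ ?f']) blast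
next
  case (coord f j)
  then obtain f' where f': "\<And>x. (f has_derivative f' x) (at x)" "\<And>i. poly_gaussian s c (\<lambda>x. f' x (axis i 1))"
    by blast
  let ?f' = "\<lambda>x h. complex_of_real (x $ j) * f' x h + complex_of_real (h $ j) * f x"
  have "((\<lambda>x. complex_of_real (x $ j) * f x) has_derivative ?f' x) (at x)" for x
    by (intro has_derivative_mult has_derivative_of_real f' bounded_linear_imp_has_derivative bounded_linear_vec_nth)
  moreover have "poly_gaussian s c (\<lambda>x. ?f' x (axis i 1))" for i
    by (intro poly_gaussian.intros f' coord.hyps)
  ultimately show ?case by (intro exI[of _ ?f']) blast
next
  case (cmult f a)
  then obtain f' where f': "\<And>x. (f has_derivative f' x) (at x)" "\<And>i. poly_gaussian s c (\<lambda>x. f' x (axis i 1))"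
    by blast
  then have "((\<lambda>x. a * f x) has_derivative (\<lambda>h. a * f' x h)) (at x)" for x
    by (intro has_derivative_mult_right)
  moreover have "poly_gaussian s c (\<lambda>x. a * f' x (axis i 1))" for i
    by (intro poly_gaussian.intros f')
  ultimately show ?case by (intro exI[of _ "\<lambda>x h. a * f' x h"]) blast
next
  case (add f g)
  then obtain f' g' where f': "\<And>x. (f has_derivative f' x) (at x)" "\<And>i. poly_gaussian s c (\<lambda>x. f' x (axis i 1))"
    and g': "\<And>x. (g has_derivative g' x) (at x)" "\<And>i. poly_gaussian s c (\<lambda>x. g' x (axis i 1))"
    by blast
  then have "((\<lambda>x. f x + g x) has_derivative (\<lambda>h. f' x h + g' x h)) (at x)" for x
    by (intro has_derivative_add)
  moreover have "poly_gaussian s c (\<lambda>x. f' x (axis i 1) + g' x (axis i 1))" for i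
    by (intro poly_gaussian.intros f' g')
  ultimately show ?case by (intro exI[of _ "\<lambda>x h. f' x h + g' x h"]) blast
qed

lemma power_le_fact_exp: "x ^ k \<le> fact k * exp x" if "0 \<le> x" for x :: real
proof -
  have "x ^ k / fact k \<le> (\<Sum>n. x ^ n /\<^sub>R fact n)"
    using sum_le_suminf[of "\<lambda>n. x ^ n /\<^sub>R fact n" "{k}"] that summable_exp_generic[of x]
    by (simp add: divide_inverse mult.commute)
  then show ?thesis by (simp add: exp_def field_simps)
qed

text \<open>Every power is dominated by \<open>exp \<bar>x\<bar>\<close>, and completing the square in \<open>y - y\<^sup>2/(2s\<^sup>2) \<le> s\<^sup>2/2\<close> shows
  that the Gaussian dominates the exponential.\<close>

lemma poly_gaussian_bounded:
  assumes "poly_gaussian s c f" and s: "s \<noteq> 0"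
  shows "\<exists>B. \<forall>x. norm x ^ k * norm (f x) \<le> B"
  using assms(1)
proof (induction arbitrary: k)
  case base
  have "norm x ^ k * norm (complex_of_real (gaussian s c x)) \<le> fact k * (exp (norm c) * exp (s\<^sup>2 / 2))" for x
  proof -
    define y where "y = norm (x - c)"
    have "norm x \<le> norm c + y" using norm_triangle_ineq[of c "x - c"] by (simp add: y_def)
    then have "exp (norm x) \<le> exp (norm c) * exp y" by (simp flip: exp_add)
    then have "norm x ^ k \<le> fact k * (exp (norm c) * exp y)"
      using power_le_fact_exp[of "norm x" k] by (smt (verit) fact_gt_zero mult_left_mono norm_ge_zero)
    then have "norm x ^ k * gaussian s c x \<le> fact k * (exp (norm c) * exp y) * gaussian s c x"
      by (intro mult_right_mono) (auto intro: less_imp_le)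
    also have "\<dots> = fact k * (exp (norm c) * exp (y - y\<^sup>2 / (2 * s\<^sup>2)))"
      by (simp add: gaussian_def y_def exp_diff exp_minus field_simps)
    also have "y - y\<^sup>2 / (2 * s\<^sup>2) \<le> s\<^sup>2 / 2"
    proof -
      have "0 \<le> (y - s\<^sup>2)\<^sup>2 / (2 * s\<^sup>2)" by simp
      also have "(y - s\<^sup>2)\<^sup>2 / (2 * s\<^sup>2) = y\<^sup>2 / (2 * s\<^sup>2) - y + s\<^sup>2 / 2"
        using s by (simp add: power2_diff field_simps power2_eq_square)
      finally show ?thesis by simp
    qed
    finally show ?thesis by (simp add: less_imp_le)
  qed
  then show ?case by blast
next
  case (coord f j)
  from coord.IH[of "Suc k"] obtain B where B: "\<And>x. norm x ^ Suc k * norm (f x) \<le> B" by blast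
  have "norm x ^ k * norm (complex_of_real (x $ j) * f x) \<le> B" for x
  proof -
    have "norm x ^ k * norm (complex_of_real (x $ j) * f x) = \<bar>x $ j\<bar> * (norm x ^ k * norm (f x))"
      by (simp add: norm_mult)
    also have "\<dots> \<le> norm x * (norm x ^ k * norm (f x))"
      by (intro mult_right_mono component_le_norm_cart) auto
    finally show ?thesis using B[of x] by (simp add: mult.assoc)
  qed
  then show ?case by blast
next
  case (cmult f a)
  from cmult.IH[of k] obtain B where B: "\<And>x. norm x ^ k * norm (f x) \<le> B" by blast
  have "norm x ^ k * norm (a * f x) \<le> norm a * B" for x
    using mult_left_mono[OF B[of x], of "norm a"] by (simp add: norm_mult mult_ac)
  then show ?case by blast
next
  case (add f g)
  from add.IH(1)[of k] add.IH(2)[of k] obtain B B' where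
    B: "\<And>x. norm x ^ k * norm (f x) \<le> B" "\<And>x. norm x ^ k * norm (g x) \<le> B'" by blast
  have "norm x ^ k * norm (f x + g x) \<le> B + B'" for x
  proof -
    have "norm x ^ k * norm (f x + g x) \<le> norm x ^ k * (norm (f x) + norm (g x))"
      by (intro mult_left_mono norm_triangle_ineq) auto
    then show ?thesis using B[of x] by (simp add: distrib_left)
  qed
  then show ?case by blast
qed

lemma schwartz_gaussian:
  assumes "s \<noteq> 0"
  shows "schwartz (\<lambda>x. complex_of_real (gaussian s c x))"
proof -
  have pg: "poly_gaussian s c (foldr partial_deriv is (\<lambda>x. complex_of_real (gaussian s c x)))" for "is"
  proof (induction "is")
    case Nil
    then show ?case by (simp add: poly_gaussian.base)
  next
    case (Cons i "is")
    obtain f' where f': "\<And>x. (foldr partial_deriv is (\<lambda>x. complex_of_real (gaussian s c x)) has_derivative f' x) (at x)"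
        "\<And>i. poly_gaussian s c (\<lambda>x. f' x (axis i 1))"
      using poly_gaussian_derivative[OF Cons] by blast
    have "partial_deriv i (foldr partial_deriv is (\<lambda>x. complex_of_real (gaussian s c x))) = (\<lambda>x. f' x (axis i 1))"
      using frechet_derivative_at[OF f'(1), symmetric] by (simp add: partial_deriv_def fun_eq_iff)
    then show ?case using f'(2) by simp
  qed
  have "foldr partial_deriv is (\<lambda>x. complex_of_real (gaussian s c x)) differentiable_on UNIV" for "is"
    using poly_gaussian_derivative[OF pg[of "is"]]
    by (auto simp: differentiable_on_def differentiable_def intro: has_derivative_at_withinI)
  then show ?thesis
    unfolding schwartz_def using poly_gaussian_bounded[OF pg assms] by blast
qed

lemma lborel_product_integral:
  fixes f :: "'a::euclidean_space \<Rightarrow> real \<Rightarrow> complex"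
  assumes "\<And>b. b \<in> Basis \<Longrightarrow> integrable lborel (f b)"
  shows "(LINT x|lborel. (\<Prod>b\<in>Basis. f b (x \<bullet> b))) = (\<Prod>b\<in>Basis. LINT t|lborel. f b t)"
    and "integrable lborel (\<lambda>x. \<Prod>b\<in>Basis. f b (x \<bullet> b))"
proof -
  interpret product_sigma_finite "\<lambda>b::'a. lborel :: real measure" ..
  have m [measurable]: "f b \<in> borel_measurable borel" if "b \<in> Basis" for b
    using assms[OF that] by auto
  have mP: "(\<lambda>x. \<Prod>b\<in>Basis. f b (x \<bullet> b)) \<in> borel_measurable borel"
    by measurable
  have eq: "(\<Prod>b\<in>Basis. f b ((\<Sum>b\<in>Basis. g b *\<^sub>R b) \<bullet> b)) = (\<Prod>b\<in>Basis. f b (g b))" for g :: "'a \<Rightarrow> real"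
    by (intro prod.cong refl) simp
  have T: "(\<lambda>g. \<Sum>b\<in>Basis. g b *\<^sub>R b) \<in> measurable (Pi\<^sub>M (Basis :: 'a set) (\<lambda>b. lborel)) borel"
    by measurable
  show "(LINT x|lborel. (\<Prod>b\<in>Basis. f b (x \<bullet> b))) = (\<Prod>b\<in>Basis. LINT t|lborel. f b t)"
    by (subst lborel_eq, subst integral_distr[OF T mP], unfold eq, rule product_integral_prod) (use assms in auto)
  show "integrable lborel (\<lambda>x. \<Prod>b\<in>Basis. f b (x \<bullet> b))"
    by (subst lborel_eq, subst integrable_distr_eq[OF T mP], unfold eq, rule product_integrable_prod) (use assms in auto)
qed

lemma gaussian_fourier_1d:
  assumes s: "0 < s"
  shows "integrable lborel (\<lambda>u. complex_of_real (exp (- (u - c)\<^sup>2 / (2 * s\<^sup>2))) * exp (- (\<i> * complex_of_real (\<eta> * u))))"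
    and "(LINT u|lborel. complex_of_real (exp (- (u - c)\<^sup>2 / (2 * s\<^sup>2))) * exp (- (\<i> * complex_of_real (\<eta> * u)))) =
      complex_of_real (s * sqrt (2 * pi)) * (exp (- (\<i> * complex_of_real (\<eta> * c))) * complex_of_real (exp (- (s\<^sup>2 * \<eta>\<^sup>2) / 2)))"
proof -
  let ?f = "\<lambda>u. complex_of_real (exp (- (u - c)\<^sup>2 / (2 * s\<^sup>2))) * exp (- (\<i> * complex_of_real (\<eta> * u)))"
  let ?g = "\<lambda>x. std_normal_density x *\<^sub>R exp (\<i> * complex_of_real (- (s * \<eta>) * x))"
  have g: "integrable lborel ?g"
    by (rule Bochner_Integration.integrable_bound[OF integrable_normal_density[of 1 0]]) auto
  have "char std_normal_distribution (- (s * \<eta>)) = (LINT x|lborel. ?g x)"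
    unfolding char_def by (subst integral_density) auto
  then have gi: "(LINT x|lborel. ?g x) = complex_of_real (exp (- (s\<^sup>2 * \<eta>\<^sup>2) / 2))"
    by (simp add: char_std_normal_distribution power_mult_distrib)
  have eq: "?f (c + s * x) = complex_of_real (sqrt (2 * pi)) * exp (- (\<i> * complex_of_real (\<eta> * c))) * ?g x" for x
    using s by (simp add: std_normal_density_def scaleR_conv_of_real power_mult_distrib exp_add[symmetric] algebra_simps)
  show "integrable lborel ?f"
    by (subst lborel_integrable_real_affine_iff[where c=s and t=c, symmetric], use s in simp)
      (unfold eq, rule integrable_mult_right[OF g])
  have "(LINT u|lborel. ?f u) = \<bar>s\<bar> *\<^sub>R (LINT x|lborel. ?f (c + s * x))"
    using s by (intro lborel_integral_real_affine) simp
  also have "(LINT x|lborel. ?f (c + s * x)) = complex_of_real (sqrt (2 * pi)) * exp (- (\<i> * complex_of_real (\<eta> * c))) * complex_of_real (exp (- (s\<^sup>2 * \<eta>\<^sup>2) / 2))"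
    unfolding eq integral_mult_right_zero gi ..
  finally show "(LINT u|lborel. ?f u) =
      complex_of_real (s * sqrt (2 * pi)) * (exp (- (\<i> * complex_of_real (\<eta> * c))) * complex_of_real (exp (- (s\<^sup>2 * \<eta>\<^sup>2) / 2)))"
    using s by (simp add: scaleR_conv_of_real mult.assoc)
qed

text \<open>Integrand and exponential are products over the coordinates, and in each coordinate the integral is
  the characteristic function of a normal distribution.\<close>

lemma gaussian_fourier:
  fixes c \<xi> :: "real^'n"
  assumes s: "0 < s"
  shows "integrable lborel (\<lambda>x. exp (- (\<i> * complex_of_real (\<xi> \<bullet> x))) * complex_of_real (gaussian s c x))"
    and "fourier (\<lambda>x. complex_of_real (gaussian s c x)) \<xi> =
      complex_of_real ((s * sqrt (2 * pi)) ^ CARD('n)) *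
        (exp (- (\<i> * complex_of_real (\<xi> \<bullet> c))) * complex_of_real (exp (- (s\<^sup>2 * (norm \<xi>)\<^sup>2) / 2)))"
proof -
  let ?f = "\<lambda>b u. complex_of_real (exp (- (u - c \<bullet> b)\<^sup>2 / (2 * s\<^sup>2))) * exp (- (\<i> * complex_of_real ((\<xi> \<bullet> b) * u)))"
  have n2: "(norm x)\<^sup>2 = (\<Sum>b\<in>Basis. (x \<bullet> b)\<^sup>2)" for x :: "real^'n"
    unfolding power2_norm_eq_inner by (subst euclidean_inner) (simp add: power2_eq_square)
  have ei: "exp (- (\<i> * complex_of_real (\<xi> \<bullet> x))) = (\<Prod>b\<in>Basis. exp (- (\<i> * complex_of_real ((\<xi> \<bullet> b) * (x \<bullet> b)))))" for x
    unfolding exp_sum[OF finite_Basis, symmetric] by (subst euclidean_inner) (simp add: sum_distrib_left sum_negf)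
  have eg: "exp (- (norm y)\<^sup>2 * a) = (\<Prod>b\<in>Basis. exp (- (y \<bullet> b)\<^sup>2 * a))" for y :: "real^'n" and a :: real
    unfolding exp_sum[OF finite_Basis, symmetric] n2 by (simp add: sum_distrib_right sum_negf)
  have eq: "exp (- (\<i> * complex_of_real (\<xi> \<bullet> x))) * complex_of_real (gaussian s c x) = (\<Prod>b\<in>Basis. ?f b (x \<bullet> b))" for x
    using eg[of "x - c" "1 / (2 * s\<^sup>2)"] ei[of x]
    by (simp add: gaussian_def prod.distrib inner_diff_left mult.commute of_real_prod)
  have i1: "integrable lborel (?f b)" for b
    by (rule gaussian_fourier_1d(1)[OF s])
  show "integrable lborel (\<lambda>x. exp (- (\<i> * complex_of_real (\<xi> \<bullet> x))) * complex_of_real (gaussian s c x))"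
    unfolding eq by (rule lborel_product_integral(2)[OF i1])
  have "fourier (\<lambda>x. complex_of_real (gaussian s c x)) \<xi> = (\<Prod>b\<in>Basis. LINT u|lborel. ?f b u)"
    unfolding fourier_def eq by (rule lborel_product_integral(1)[OF i1])
  also have "\<dots> = (\<Prod>b\<in>(Basis :: (real^'n) set). complex_of_real (s * sqrt (2 * pi)) *
      (exp (- (\<i> * complex_of_real ((\<xi> \<bullet> b) * (c \<bullet> b)))) * complex_of_real (exp (- (s\<^sup>2 * (\<xi> \<bullet> b)\<^sup>2) / 2))))"
    by (intro prod.cong refl gaussian_fourier_1d(2)[OF s])
  also have "\<dots> = complex_of_real ((s * sqrt (2 * pi)) ^ CARD('n)) *
        (exp (- (\<i> * complex_of_real (\<xi> \<bullet> c))) * complex_of_real (exp (- (s\<^sup>2 * (norm \<xi>)\<^sup>2) / 2)))"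
    using eg[of \<xi> "s\<^sup>2 / 2"] ei[of c]
    by (simp add: prod.distrib of_real_prod mult.commute)
  finally show "fourier (\<lambda>x. complex_of_real (gaussian s c x)) \<xi> =
      complex_of_real ((s * sqrt (2 * pi)) ^ CARD('n)) *
        (exp (- (\<i> * complex_of_real (\<xi> \<bullet> c))) * complex_of_real (exp (- (s\<^sup>2 * (norm \<xi>)\<^sup>2) / 2)))" .
qed


lemma lborel_integral_affine:
  fixes f :: "'a::euclidean_space \<Rightarrow> 'b::{banach, second_countable_topology}"
  assumes [measurable]: "f \<in> borel_measurable borel" and c: "c \<noteq> 0"
  shows "(LINT x|lborel. f x) = \<bar>c\<bar> ^ DIM('a) *\<^sub>R (LINT x|lborel. f (t + c *\<^sub>R x))"
  by (subst lborel_affine[OF c, of t]) (simp add: integral_density integral_distr)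

lemma (in pair_sigma_finite) integrable_product_mult:
  fixes f :: "'a \<Rightarrow> real" and g :: "'b \<Rightarrow> real"
  assumes f: "integrable M1 f" and g: "integrable M2 g"
  shows "integrable (M1 \<Otimes>\<^sub>M M2) (\<lambda>(x, y). f x * g y)"
proof (rule Fubini_integrable)
  note [measurable] = borel_measurable_integrable[OF f] borel_measurable_integrable[OF g]
  show "(\<lambda>(x, y). f x * g y) \<in> borel_measurable (M1 \<Otimes>\<^sub>M M2)" by measurable
  show "integrable M1 (\<lambda>x. \<integral>y. norm (case (x, y) of (x, y) \<Rightarrow> f x * g y) \<partial>M2)"
    using f by (simp add: abs_mult)
  show "AE x in M1. integrable M2 (\<lambda>y. case (x, y) of (x, y) \<Rightarrow> f x * g y)"
    using g by simp
qed

text \<open>Since \<open>\<bar>x\<bar>\<^sup>2 \<le> 2 \<bar>x - c\<bar>\<^sup>2 + 2 \<bar>c\<bar>\<^sup>2\<close>, a Gaussian with bounded centre is dominated by a wider centred one.\<close>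

lemma gaussian_shift_le: "gaussian s c x \<le> exp ((norm c)\<^sup>2 / (2 * s\<^sup>2)) * gaussian (sqrt 2 * s) 0 x"
proof -
  have "norm x \<le> norm (x - c) + norm c" using norm_triangle_ineq[of "x - c" c] by simp
  then have "(norm x)\<^sup>2 \<le> (norm (x - c) + norm c)\<^sup>2" by (intro power_mono) auto
  also have "\<dots> \<le> 2 * (norm (x - c))\<^sup>2 + 2 * (norm c)\<^sup>2"
    using sum_squares_bound[of "norm (x - c)" "norm c"] by (simp add: power2_sum)
  finally have "(norm x)\<^sup>2 / 2 - (norm c)\<^sup>2 \<le> (norm (x - c))\<^sup>2" by simp
  then have "- (norm (x - c))\<^sup>2 / (2 * s\<^sup>2) \<le> ((norm c)\<^sup>2 - (norm x)\<^sup>2 / 2) / (2 * s\<^sup>2)"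
    by (intro divide_right_mono) auto
  also have "\<dots> = (norm c)\<^sup>2 / (2 * s\<^sup>2) + - (norm x)\<^sup>2 / (2 * (sqrt 2 * s)\<^sup>2)"
    by (simp add: power_mult_distrib diff_divide_distrib)
  finally show ?thesis
    unfolding gaussian_def exp_add[symmetric] by simp
qed

lemma gaussian_integrable: "0 < s \<Longrightarrow> integrable lborel (gaussian s (c :: real^'n))"
  using gaussian_fourier(1)[of s 0 c] integrable_Re by fastforce

lemma gaussian_integral: "0 < s \<Longrightarrow> (LINT x|lborel. gaussian s (c :: real^'n) x) = (s * sqrt (2 * pi)) ^ CARD('n)"
proof -
  assume s: "0 < s"
  have "complex_of_real (LINT x|lborel. gaussian s c x) = complex_of_real ((s * sqrt (2 * pi)) ^ CARD('n))"
    using gaussian_fourier(2)[OF s, of c 0] by (simp add: fourier_def)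
  then show ?thesis by (simp only: of_real_eq_iff)
qed

lemma gaussian_weight_tendsto: "(\<lambda>k. exp (- ((1 / real (Suc k))\<^sup>2 * a) / 2)) \<longlonglongrightarrow> 1"
proof -
  have s0: "(\<lambda>k. 1 / real (Suc k)) \<longlonglongrightarrow> 0"
    using LIMSEQ_inverse_real_of_nat by (simp add: inverse_eq_divide)
  have "(\<lambda>k. exp (- ((1 / real (Suc k))\<^sup>2 * a) / 2)) \<longlonglongrightarrow> exp (- (0\<^sup>2 * a) / 2)"
    by (rule tendsto_exp[OF tendsto_divide[OF tendsto_minus[OF tendsto_mult_right[OF tendsto_power[OF s0]]] tendsto_const]]) simp
  then show ?thesis by simp
qed

lemma norm_exp_minus_i [simp]: "norm (exp (- (\<i> * complex_of_real x))) = 1"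
  using norm_exp_i_times[of "- x"] by simp

lemma exp_minus_i_measurable [measurable (raw)]:
  "f \<in> borel_measurable M \<Longrightarrow> (\<lambda>x. exp (- (\<i> * complex_of_real (f x)))) \<in> borel_measurable M"
  by measurable

lemma fourier_measurable [measurable]:
  assumes [measurable]: "\<phi> \<in> borel_measurable borel"
  shows "fourier \<phi> \<in> borel_measurable borel"
  unfolding fourier_def by measurable

section \<open>The spatial covariance tested with continuous functions\<close>

context
  fixes \<mu> :: "(real^'n) measure" and f :: "real^'n \<Rightarrow> real"
  assumes tft: "tempered_fourier_transform \<mu> f"
    and sets_\<mu> [measurable_cong]: "sets \<mu> = sets borel"
    and sf: "sigma_finite_measure \<mu>"
begin

lemma kernel_measurable [measurable]: "f \<in> borel_measurable borel"
  using tft by (simp add: tempered_fourier_transform_def)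

lemma kernel_gaussian_integrable:
  assumes "0 < s" shows "integrable lborel (\<lambda>x. f x * gaussian s c x)"
proof -
  have "integrable lborel (\<lambda>x. complex_of_real (f x) * complex_of_real (gaussian s c x))"
    using tft schwartz_gaussian[of s c] assms unfolding tempered_fourier_transform_def by blast
  from integrable_Re[OF this] show ?thesis by simp
qed

lemma gaussian_spectral_integrable:
  assumes s: "0 < s" shows "integrable \<mu> (\<lambda>\<xi>. exp (- (s\<^sup>2 * (norm \<xi>)\<^sup>2) / 2))"
proof -
  let ?Z = "(s * sqrt (2 * pi)) ^ CARD('n)"
  have "integrable \<mu> (fourier (\<lambda>x. complex_of_real (gaussian s (0 :: real^'n) x)))"
    using tft schwartz_gaussian[of s 0] s unfolding tempered_fourier_transform_def by blast
  then have "integrable \<mu> (\<lambda>\<xi>. norm (fourier (\<lambda>x. complex_of_real (gaussian s (0 :: real^'n) x)) \<xi>))"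
    by (rule integrable_norm)
  then have "integrable \<mu> (\<lambda>\<xi>. ?Z * exp (- (s\<^sup>2 * (norm \<xi>)\<^sup>2) / 2))"
    unfolding gaussian_fourier(2)[OF s] using s by (simp add: norm_mult norm_power)
  then have "integrable \<mu> (\<lambda>\<xi>. (1 / ?Z) * (?Z * exp (- (s\<^sup>2 * (norm \<xi>)\<^sup>2) / 2)))"
    by (rule integrable_mult_right)
  then show ?thesis using s by simp
qed

lemma gaussian_pairing:
  assumes s: "0 < s"
  shows "complex_of_real (LINT x|lborel. f x * gaussian s c x) =
    complex_of_real ((s * sqrt (2 * pi)) ^ CARD('n)) *
      (LINT \<xi>|\<mu>. exp (- (\<i> * complex_of_real (\<xi> \<bullet> c))) * complex_of_real (exp (- (s\<^sup>2 * (norm \<xi>)\<^sup>2) / 2)))"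
proof -
  have "(LINT x|lborel. complex_of_real (f x) * complex_of_real (gaussian s c x)) =
      (LINT \<xi>|\<mu>. fourier (\<lambda>x. complex_of_real (gaussian s c x)) \<xi>)"
    using tft schwartz_gaussian[of s c] s unfolding tempered_fourier_transform_def by blast
  then show ?thesis
    unfolding gaussian_fourier(2)[OF s] by (simp flip: of_real_mult)
qed

text \<open>Testing \<open>f\<close> with Gaussians centred at \<open>c\<close> and integrating over \<open>c\<close> against \<open>g\<close> mollifies \<open>g\<close> on the
  left and puts a Gaussian weight on the right. The weight makes the spectral integral converge even
  though the Fourier transform of \<open>g\<close> is not known to be integrable for \<open>\<mu>\<close>.\<close>

lemma mollified_pairing:
  fixes g :: "real^'n \<Rightarrow> real"
  assumes [measurable]: "g \<in> borel_measurable borel" and M: "\<And>z. \<bar>g z\<bar> \<le> M * indicator (cball 0 R) z"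
    and s: "0 < s"
  shows "complex_of_real (LINT x|lborel. f x * (LINT w|lborel. gaussian 1 0 w * g (x + s *\<^sub>R w))) =
    complex_of_real (sqrt (2 * pi) ^ CARD('n)) *
      (LINT \<xi>|\<mu>. complex_of_real (exp (- (s\<^sup>2 * (norm \<xi>)\<^sup>2) / 2)) * fourier (\<lambda>x. complex_of_real (g x)) \<xi>)"
proof -
  interpret \<mu>: sigma_finite_measure \<mu> by (rule sf)
  interpret P: pair_sigma_finite lborel \<mu> ..
  let ?E = "\<lambda>\<xi>::real^'n. exp (- (s\<^sup>2 * (norm \<xi>)\<^sup>2) / 2)"
  let ?e = "\<lambda>(\<xi>::real^'n) c. exp (- (\<i> * complex_of_real (\<xi> \<bullet> c)))"
  let ?Z = "sqrt (2 * pi) ^ CARD('n)"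
  have ind: "integrable lborel (\<lambda>c::real^'n. M * indicator (cball 0 R) c :: real)"
    by (intro integrable_mult_right integrable_real_indicator) (use emeasure_bounded_finite[OF bounded_cball[of "0::real^'n" R]] in auto)
  have I1: "integrable (lborel \<Otimes>\<^sub>M lborel) (\<lambda>(c, x). g c * (f x * gaussian s c x))"
  proof (rule Bochner_Integration.integrable_bound)
    show "integrable (lborel \<Otimes>\<^sub>M lborel) (\<lambda>(c::real^'n, x). (exp (R\<^sup>2 / (2 * s\<^sup>2)) * (M * indicator (cball 0 R) c)) * (f x * gaussian (sqrt 2 * s) (0::real^'n) x))"
      using ind kernel_gaussian_integrable[of "sqrt 2 * s" 0] s
      by (intro lborel_pair.integrable_product_mult integrable_mult_right) auto
    show "(\<lambda>(c, x). g c * (f x * gaussian s c x)) \<in> borel_measurable (lborel \<Otimes>\<^sub>M lborel)" by measurable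
    have "norm (g c * (f x * gaussian s c x)) \<le> norm (exp (R\<^sup>2 / (2 * s\<^sup>2)) * (M * indicator (cball 0 R) c) * (f x * gaussian (sqrt 2 * s) 0 x))" for c x
    proof (cases "c \<in> cball 0 R")
      case True
      have "exp ((norm c)\<^sup>2 / (2 * s\<^sup>2)) \<le> exp (R\<^sup>2 / (2 * s\<^sup>2))"
        using True by (auto intro!: divide_right_mono power_mono)
      then have "gaussian s c x \<le> exp (R\<^sup>2 / (2 * s\<^sup>2)) * gaussian (sqrt 2 * s) 0 x"
        by (intro order_trans[OF gaussian_shift_le mult_right_mono]) auto
      moreover have "\<bar>g c\<bar> \<le> \<bar>M\<bar>" using M[of c] True by simp
      ultimately have "\<bar>g c\<bar> * (\<bar>f x\<bar> * gaussian s c x) \<le> \<bar>M\<bar> * (\<bar>f x\<bar> * (exp (R\<^sup>2 / (2 * s\<^sup>2)) * gaussian (sqrt 2 * s) 0 x))"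
        by (intro mult_mono mult_left_mono) auto
      then show ?thesis using True by (simp add: abs_mult mult_ac)
    next
      case False
      then have "g c = 0" using M[of c] by simp
      then show ?thesis by simp
    qed
    then show "AE z in lborel \<Otimes>\<^sub>M lborel. norm (case z of (c, x) \<Rightarrow> g c * (f x * gaussian s c x)) \<le>
       norm (case z of (c, x) \<Rightarrow> (exp (R\<^sup>2 / (2 * s\<^sup>2)) * (M * indicator (cball 0 R) c)) * (f x * gaussian (sqrt 2 * s) (0::real^'n) x))"
      by (intro AE_I2) (auto split: prod.split)
  qed
  have I2: "integrable (lborel \<Otimes>\<^sub>M \<mu>) (\<lambda>(c, \<xi>). complex_of_real (g c) * (?e \<xi> c * complex_of_real (?E \<xi>)))"
  proof (rule Bochner_Integration.integrable_bound)
    show "integrable (lborel \<Otimes>\<^sub>M \<mu>) (\<lambda>(c::real^'n, \<xi>). (M * indicator (cball 0 R) c) * ?E \<xi>)"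
      using ind gaussian_spectral_integrable[OF s] by (intro P.integrable_product_mult) auto
    show "(\<lambda>(c, \<xi>). complex_of_real (g c) * (?e \<xi> c * complex_of_real (?E \<xi>))) \<in> borel_measurable (lborel \<Otimes>\<^sub>M \<mu>)" by measurable
    have "norm (complex_of_real (g c) * (?e \<xi> c * complex_of_real (?E \<xi>))) \<le> norm (M * indicator (cball 0 R) c * ?E \<xi>)" for c \<xi>
      using M[of c] by (auto simp: norm_mult intro!: mult_right_mono split: split_indicator_asm)
    then show "AE z in lborel \<Otimes>\<^sub>M \<mu>. norm (case z of (c, \<xi>) \<Rightarrow> complex_of_real (g c) * (?e \<xi> c * complex_of_real (?E \<xi>)))
        \<le> norm (case z of (c, \<xi>) \<Rightarrow> (M * indicator (cball 0 R) c) * ?E \<xi>)"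
      by (intro AE_I2) (auto split: prod.split)
  qed
  have inner: "(LINT c|lborel. g c * (f x * gaussian s c x)) = s ^ CARD('n) * (f x * (LINT w|lborel. gaussian 1 0 w * g (x + s *\<^sub>R w)))" for x
  proof -
    have "(LINT c|lborel. g c * (f x * gaussian s c x)) = \<bar>s\<bar> ^ DIM(real^'n) *\<^sub>R (LINT w|lborel. g (x + s *\<^sub>R w) * (f x * gaussian s (x + s *\<^sub>R w) x))"
      using s by (intro lborel_integral_affine) auto
    also have "(\<lambda>w. g (x + s *\<^sub>R w) * (f x * gaussian s (x + s *\<^sub>R w) x)) = (\<lambda>w. f x * (gaussian 1 0 w * g (x + s *\<^sub>R w)))"
      using s by (simp add: fun_eq_iff gaussian_def power_mult_distrib)
    finally show ?thesis using s by simp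
  qed
  have "complex_of_real (s ^ CARD('n) * (LINT x|lborel. f x * (LINT w|lborel. gaussian 1 0 w * g (x + s *\<^sub>R w))))
     = complex_of_real (LINT x|lborel. LINT c|lborel. g c * (f x * gaussian s c x))"
    unfolding inner by simp
  also have "(LINT x|lborel. LINT c|lborel. g c * (f x * gaussian s c x)) = (LINT c|lborel. LINT x|lborel. g c * (f x * gaussian s c x))"
    by (rule lborel_pair.Fubini_integral[OF I1])
  also have "complex_of_real \<dots> = (LINT c|lborel. complex_of_real (g c) * complex_of_real (LINT x|lborel. f x * gaussian s c x))"
    unfolding integral_complex_of_real[symmetric] by simp
  also have "\<dots> = (LINT c|lborel. complex_of_real ((s * sqrt (2 * pi)) ^ CARD('n)) * (LINT \<xi>|\<mu>. complex_of_real (g c) * (?e \<xi> c * complex_of_real (?E \<xi>))))"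
    unfolding gaussian_pairing[OF s] by (simp add: mult_ac)
  also have "\<dots> = complex_of_real ((s * sqrt (2 * pi)) ^ CARD('n)) * (LINT c|lborel. LINT \<xi>|\<mu>. complex_of_real (g c) * (?e \<xi> c * complex_of_real (?E \<xi>)))"
    by (rule integral_mult_right_zero)
  also have "(LINT c|lborel. LINT \<xi>|\<mu>. complex_of_real (g c) * (?e \<xi> c * complex_of_real (?E \<xi>))) =
      (LINT \<xi>|\<mu>. LINT c|lborel. complex_of_real (g c) * (?e \<xi> c * complex_of_real (?E \<xi>)))"
    by (rule P.Fubini_integral[OF I2, symmetric])
  also have "\<dots> = (LINT \<xi>|\<mu>. complex_of_real (?E \<xi>) * fourier (\<lambda>x. complex_of_real (g x)) \<xi>)"
  proof (intro Bochner_Integration.integral_cong refl)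
    fix \<xi>
    have "(LINT c|lborel. complex_of_real (g c) * (?e \<xi> c * complex_of_real (?E \<xi>))) = (LINT c|lborel. complex_of_real (?E \<xi>) * (?e \<xi> c * complex_of_real (g c)))"
      by (intro Bochner_Integration.integral_cong refl) (simp add: mult_ac)
    then show "(LINT c|lborel. complex_of_real (g c) * (?e \<xi> c * complex_of_real (?E \<xi>))) = complex_of_real (?E \<xi>) * fourier (\<lambda>x. complex_of_real (g x)) \<xi>"
      unfolding fourier_def by (simp only: integral_mult_right_zero)
  qed
  finally have "complex_of_real (s ^ CARD('n)) * complex_of_real (LINT x|lborel. f x * (LINT w|lborel. gaussian 1 0 w * g (x + s *\<^sub>R w))) =
     complex_of_real (s ^ CARD('n)) * (complex_of_real ?Z * (LINT \<xi>|\<mu>. complex_of_real (?E \<xi>) * fourier (\<lambda>x. complex_of_real (g x)) \<xi>))"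
    by (simp add: power_mult_distrib mult.assoc)
  then show ?thesis using s by (subst (asm) mult_left_cancel) auto
qed

text \<open>As the width tends to \<open>0\<close>, the mollified function converges to \<open>g\<close> pointwise by continuity. Since \<open>g\<close>
  has compact support, the mollified functions are bounded by one fixed Gaussian, against which \<open>f\<close> is
  integrable.\<close>

lemma pairing_limit:
  fixes g :: "real^'n \<Rightarrow> real"
  assumes cont: "continuous_on UNIV g" and M: "\<And>z. \<bar>g z\<bar> \<le> M * indicator (cball 0 R) z"
  defines "E \<equiv> \<lambda>k \<xi>::real^'n. exp (- ((1 / real (Suc k))\<^sup>2 * (norm \<xi>)\<^sup>2) / 2)"
  shows "(\<lambda>k. LINT \<xi>|\<mu>. complex_of_real (E k \<xi>) * fourier (\<lambda>x. complex_of_real (g x)) \<xi>)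
     \<longlonglongrightarrow> complex_of_real (LINT x|lborel. f x * g x)"
proof -
  have [measurable]: "g \<in> borel_measurable borel"
    using cont by (rule borel_measurable_continuous_onI)
  let ?s = "\<lambda>k. 1 / real (Suc k)"
  let ?Z = "sqrt (2 * pi) ^ CARD('n)"
  let ?h = "\<lambda>k x. LINT w|lborel. gaussian 1 0 w * g (x + ?s k *\<^sub>R w)"
  have M0: "\<bar>g z\<bar> \<le> \<bar>M\<bar>" for z
    using M[of z] by (auto split: split_indicator_asm)
  have s0: "?s \<longlonglongrightarrow> 0"
    using LIMSEQ_inverse_real_of_nat by (simp add: inverse_eq_divide)
  have h_lim: "(\<lambda>k. ?h k x) \<longlonglongrightarrow> ?Z * g x" for x
  proof -
    have "(\<lambda>k. ?h k x) \<longlonglongrightarrow> (LINT w|lborel. gaussian 1 0 (w::real^'n) * g x)"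
    proof (rule integral_dominated_convergence)
      show "integrable lborel (\<lambda>w::real^'n. gaussian 1 0 w * \<bar>M\<bar>)"
        using gaussian_integrable[of 1 "0::real^'n"] by simp
      show "AE w in lborel. (\<lambda>k. gaussian 1 0 w * g (x + ?s k *\<^sub>R w)) \<longlonglongrightarrow> gaussian 1 0 w * g x"
      proof (intro AE_I2)
        fix w
        have "(\<lambda>k. x + ?s k *\<^sub>R w) \<longlonglongrightarrow> x + 0 *\<^sub>R w"
          by (intro tendsto_intros s0)
        moreover have "isCont g x" using cont by (simp add: continuous_on_eq_continuous_at)
        ultimately have "(\<lambda>k. g (x + ?s k *\<^sub>R w)) \<longlonglongrightarrow> g x"
          by (intro isCont_tendsto_compose[of _ g]) auto
        then show "(\<lambda>k. gaussian 1 0 w * g (x + ?s k *\<^sub>R w)) \<longlonglongrightarrow> gaussian 1 0 w * g x"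
          by (intro tendsto_intros)
      qed
    qed (auto simp: abs_mult intro!: AE_I2 mult_left_mono M0)
    then show ?thesis by (simp add: gaussian_integral)
  qed
  let ?D = "\<bar>M\<bar> * exp (R\<^sup>2 / 4) * (LINT w|lborel. gaussian (sqrt 2) (0::real^'n) w)"
  have h_bound: "\<bar>?h k x\<bar> \<le> ?D * gaussian 2 0 x" for k x
  proof -
    have pt: "\<bar>gaussian 1 0 w * g (x + ?s k *\<^sub>R w)\<bar> \<le> \<bar>M\<bar> * exp (R\<^sup>2 / 4) * gaussian 2 0 x * gaussian (sqrt 2) 0 w" for w
    proof (cases "x + ?s k *\<^sub>R w \<in> cball 0 R")
      case True
      have "norm x \<le> norm (x + ?s k *\<^sub>R w) + norm (?s k *\<^sub>R w)"
        using norm_triangle_ineq4[of "x + ?s k *\<^sub>R w" "?s k *\<^sub>R w"] by simp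
      also have "\<dots> \<le> R + norm w"
      proof -
        have "?s k * norm w \<le> 1 * norm w" by (intro mult_right_mono) auto
        then show ?thesis using True by simp
      qed
      finally have "(norm x)\<^sup>2 \<le> (R + norm w)\<^sup>2" by (intro power_mono) auto
      also have "\<dots> \<le> 2 * R\<^sup>2 + 2 * (norm w)\<^sup>2"
        using sum_squares_bound[of R "norm w"] by (simp add: power2_sum)
      finally have "gaussian 1 0 w \<le> exp (R\<^sup>2 / 4) * gaussian 2 0 x * gaussian (sqrt 2) 0 w"
        unfolding gaussian_def exp_add[symmetric] by simp
      from mult_mono[OF this M0[of "x + ?s k *\<^sub>R w"]]
      show ?thesis by (simp add: abs_mult mult_ac)
    next
      case False
      then have "g (x + ?s k *\<^sub>R w) = 0" using M[of "x + ?s k *\<^sub>R w"] by simp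
      then show ?thesis by simp
    qed
    have "norm (?h k x) \<le> (LINT w|lborel. norm (gaussian 1 0 w * g (x + ?s k *\<^sub>R w)))"
      by (rule integral_norm_bound)
    also have "\<dots> \<le> (LINT w|lborel. \<bar>M\<bar> * exp (R\<^sup>2 / 4) * gaussian 2 0 x * gaussian (sqrt 2) (0::real^'n) w)"
      using gaussian_integrable[of "sqrt 2" "0::real^'n"] pt
      by (intro integral_mono') auto
    finally show ?thesis by (simp add: mult_ac)
  qed
  have "(\<lambda>k. LINT x|lborel. f x * ?h k x) \<longlonglongrightarrow> (LINT x|lborel. f x * (?Z * g x))"
  proof (rule integral_dominated_convergence)
    show "integrable lborel (\<lambda>x. ?D * norm (f x * gaussian 2 0 x))"
      using kernel_gaussian_integrable[of 2 0] by (intro integrable_mult_right integrable_norm) auto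
    show "AE x in lborel. (\<lambda>k. f x * ?h k x) \<longlonglongrightarrow> f x * (?Z * g x)"
      by (intro AE_I2 tendsto_intros h_lim)
    show "AE x in lborel. norm (f x * ?h k x) \<le> ?D * norm (f x * gaussian 2 0 x)" for k
    proof (intro AE_I2)
      fix x
      show "norm (f x * ?h k x) \<le> ?D * norm (f x * gaussian 2 0 x)"
        using mult_left_mono[OF h_bound[where k=k and x=x], of "\<bar>f x\<bar>"] by (simp add: abs_mult mult_ac)
    qed
  qed auto
  then have "(\<lambda>k. complex_of_real (LINT x|lborel. f x * ?h k x)) \<longlonglongrightarrow> complex_of_real (LINT x|lborel. f x * (?Z * g x))"
    by (rule tendsto_of_real)
  also have "(\<lambda>k. complex_of_real (LINT x|lborel. f x * ?h k x)) = (\<lambda>k. complex_of_real ?Z * (LINT \<xi>|\<mu>. complex_of_real (E k \<xi>) * fourier (\<lambda>x. complex_of_real (g x)) \<xi>))"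
    unfolding E_def by (rule ext, rule mollified_pairing[OF _ M]) auto
  also have "(LINT x|lborel. f x * (?Z * g x)) = ?Z * (LINT x|lborel. f x * g x)"
    by (simp add: mult.left_commute[of _ ?Z])
  finally have "(\<lambda>k. complex_of_real (1 / ?Z) * (complex_of_real ?Z * (LINT \<xi>|\<mu>. complex_of_real (E k \<xi>) * fourier (\<lambda>x. complex_of_real (g x)) \<xi>)))
      \<longlonglongrightarrow> complex_of_real (1 / ?Z) * complex_of_real (?Z * (LINT x|lborel. f x * g x))"
    by (intro tendsto_intros)
  then show ?thesis by (simp add: field_simps)
qed

lemma fourier_norm_le:
  fixes g :: "real^'n \<Rightarrow> real"
  assumes "integrable lborel g"
  shows "norm (fourier (\<lambda>x. complex_of_real (g x)) \<xi>) \<le> (LINT x|lborel. \<bar>g x\<bar>)"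
proof -
  have "norm (fourier (\<lambda>x. complex_of_real (g x)) \<xi>) \<le> (LINT x|lborel. norm (exp (- (\<i> * complex_of_real (\<xi> \<bullet> x))) * complex_of_real (g x)))"
    unfolding fourier_def by (rule integral_norm_bound)
  then show ?thesis by (simp add: norm_mult)
qed

lemma pairing_eq_spectral:
  fixes g :: "real^'n \<Rightarrow> real"
  assumes cont: "continuous_on UNIV g" and M: "\<And>z. \<bar>g z\<bar> \<le> M * indicator (cball 0 R) z"
    and int: "integrable \<mu> (fourier (\<lambda>x. complex_of_real (g x)))"
  shows "complex_of_real (LINT x|lborel. f x * g x) = (LINT \<xi>|\<mu>. fourier (\<lambda>x. complex_of_real (g x)) \<xi>)"
proof (rule LIMSEQ_unique[OF pairing_limit[OF cont M]])
  have [measurable]: "g \<in> borel_measurable borel"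
    using cont by (rule borel_measurable_continuous_onI)
  let ?E = "\<lambda>k \<xi>::real^'n. exp (- ((1 / real (Suc k))\<^sup>2 * (norm \<xi>)\<^sup>2) / 2)"
  show "(\<lambda>k. LINT \<xi>|\<mu>. complex_of_real (?E k \<xi>) * fourier (\<lambda>x. complex_of_real (g x)) \<xi>) \<longlonglongrightarrow> (LINT \<xi>|\<mu>. fourier (\<lambda>x. complex_of_real (g x)) \<xi>)"
  proof (rule integral_dominated_convergence)
    show "integrable \<mu> (\<lambda>\<xi>. norm (fourier (\<lambda>x. complex_of_real (g x)) \<xi>))"
      using int by (rule integrable_norm)
    show "AE \<xi> in \<mu>. (\<lambda>k. complex_of_real (?E k \<xi>) * fourier (\<lambda>x. complex_of_real (g x)) \<xi>) \<longlonglongrightarrow> fourier (\<lambda>x. complex_of_real (g x)) \<xi>"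
    proof (intro AE_I2)
      fix \<xi> :: "real^'n"
      have "(\<lambda>k. complex_of_real (?E k \<xi>) * fourier (\<lambda>x. complex_of_real (g x)) \<xi>) \<longlonglongrightarrow> complex_of_real 1 * fourier (\<lambda>x. complex_of_real (g x)) \<xi>"
        by (intro tendsto_mult tendsto_of_real gaussian_weight_tendsto tendsto_const)
      then show "(\<lambda>k. complex_of_real (?E k \<xi>) * fourier (\<lambda>x. complex_of_real (g x)) \<xi>) \<longlonglongrightarrow> fourier (\<lambda>x. complex_of_real (g x)) \<xi>"
        by simp
    qed
    show "AE \<xi> in \<mu>. norm (complex_of_real (?E k \<xi>) * fourier (\<lambda>x. complex_of_real (g x)) \<xi>) \<le> norm (fourier (\<lambda>x. complex_of_real (g x)) \<xi>)" for k
      by (intro AE_I2) (auto simp: norm_mult intro!: mult_left_le_one_le)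
  qed measurable
qed

text \<open>The weights increase to \<open>1\<close> and the weighted integrals converge, so monotone convergence applies.\<close>

lemma spectral_integrable_of_nonneg:
  fixes g G :: "real^'n \<Rightarrow> real"
  assumes cont: "continuous_on UNIV g" and M: "\<And>z. \<bar>g z\<bar> \<le> M * indicator (cball 0 R) z"
    and G: "\<And>\<xi>. fourier (\<lambda>x. complex_of_real (g x)) \<xi> = complex_of_real (G \<xi>)" "\<And>\<xi>. 0 \<le> G \<xi>"
  shows "integrable \<mu> G"
proof -
  have [measurable]: "g \<in> borel_measurable borel"
    using cont by (rule borel_measurable_continuous_onI)
  have "(\<lambda>\<xi>. Re (fourier (\<lambda>x. complex_of_real (g x)) \<xi>)) \<in> borel_measurable borel" by measurable
  then have [measurable]: "G \<in> borel_measurable borel" by (simp add: G)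
  let ?E = "\<lambda>k \<xi>::real^'n. exp (- ((1 / real (Suc k))\<^sup>2 * (norm \<xi>)\<^sup>2) / 2)"
  have gi: "integrable lborel g"
  proof (rule Bochner_Integration.integrable_bound)
    show "integrable lborel (\<lambda>c::real^'n. M * indicator (cball 0 R) c :: real)"
      by (intro integrable_mult_right integrable_real_indicator) (use emeasure_bounded_finite[OF bounded_cball[of "0::real^'n" R]] in auto)
    show "AE x in lborel. norm (g x) \<le> norm (M * indicator (cball 0 R) x)"
      by (intro AE_I2) (simp only: real_norm_def, rule order_trans[OF M abs_ge_self])
  qed simp
  have "(\<lambda>k. Re (LINT \<xi>|\<mu>. complex_of_real (?E k \<xi>) * fourier (\<lambda>x. complex_of_real (g x)) \<xi>)) \<longlonglongrightarrow> Re (complex_of_real (LINT x|lborel. f x * g x))"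
    by (rule tendsto_Re[OF pairing_limit[OF cont M]])
  then have lim: "(\<lambda>k. LINT \<xi>|\<mu>. ?E k \<xi> * G \<xi>) \<longlonglongrightarrow> (LINT x|lborel. f x * g x)"
    unfolding G(1) of_real_mult[symmetric] integral_complex_of_real by simp
  show "integrable \<mu> G"
  proof (rule integrable_monotone_convergence[OF _ _ _ lim])
    show "integrable \<mu> (\<lambda>\<xi>. ?E k \<xi> * G \<xi>)" for k
    proof (rule Bochner_Integration.integrable_bound)
      show "integrable \<mu> (\<lambda>\<xi>. ?E k \<xi> * (LINT x|lborel. \<bar>g x\<bar>))"
        using gaussian_spectral_integrable[of "1 / real (Suc k)"] by (intro integrable_mult_left) auto
      have "\<bar>G \<xi>\<bar> \<le> (LINT x|lborel. \<bar>g x\<bar>)" for \<xi>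
        using fourier_norm_le[OF gi, of \<xi>] by (simp add: G)
      then show "AE \<xi> in \<mu>. norm (?E k \<xi> * G \<xi>) \<le> norm (?E k \<xi> * (LINT x|lborel. \<bar>g x\<bar>))"
        by (intro AE_I2) (auto simp: abs_mult intro!: mult_left_mono)
    qed measurable
    show "AE \<xi> in \<mu>. mono (\<lambda>k. ?E k \<xi> * G \<xi>)"
      using G(2) by (intro AE_I2 monoI mult_right_mono)
        (auto intro!: divide_right_mono mult_right_mono power_mono divide_left_mono)
    show "AE \<xi> in \<mu>. (\<lambda>k. ?E k \<xi> * G \<xi>) \<longlonglongrightarrow> G \<xi>"
    proof (intro AE_I2)
      fix \<xi> :: "real^'n"
      have "(\<lambda>k. ?E k \<xi> * G \<xi>) \<longlonglongrightarrow> 1 * G \<xi>"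
        by (intro tendsto_mult gaussian_weight_tendsto tendsto_const)
      then show "(\<lambda>k. ?E k \<xi> * G \<xi>) \<longlonglongrightarrow> G \<xi>" by simp
    qed
  qed measurable
qed

end

section \<open>The isometry for indicator functions\<close>

text \<open>The set \<open>B\<close> is squeezed between a compact \<open>K\<close> and an open \<open>U\<close> of nearly the same measure, and a
  small translation keeps \<open>K\<close> inside \<open>U\<close>; so a point can enter or leave \<open>B\<close> only through \<open>B - K\<close> or \<open>U - B\<close>.\<close>

lemma translate_indicator_continuous_L1:
  fixes B :: "(real^'n) set"
  assumes B: "B \<in> sets borel" "bounded B" and e: "0 < e"
  obtains d where "0 < d" "\<And>h. norm h < d \<Longrightarrow> (LINT y|lborel. \<bar>indicator B (y + h) - indicator B y :: real\<bar>) < e"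
proof -
  have Bl: "B \<in> sets lebesgue" using B by simp
  have e8: "0 < e / 8" using e by simp
  obtain U where U: "open U" "B \<subseteq> U" "U - B \<in> lmeasurable" "emeasure lebesgue (U - B) < ennreal (e / 8)"
    by (rule sets_lebesgue_outer_open[OF Bl e8]) (rule that)
  obtain K where K: "closed K" "K \<subseteq> B" "B - K \<in> lmeasurable" "emeasure lebesgue (B - K) < ennreal (e / 8)"
    by (rule sets_lebesgue_inner_closed[OF Bl e8]) (rule that)
  have "compact K" using K B bounded_subset compact_eq_bounded_closed by blast
  have KU: "K \<subseteq> U" using K U by blast
  obtain d where d: "0 < d" "\<And>x h. x \<in> K \<Longrightarrow> norm h < d \<Longrightarrow> x + h \<in> U"
  proof (cases "K = {}")
    case True
    then show ?thesis using that[of 1] by auto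
  next
    case False
    obtain d where "0 < d" "(\<Union>x\<in>K. ball x d) \<subseteq> U"
      using compact_subset_open_imp_ball_epsilon_subset[OF \<open>compact K\<close> U(1) KU] by blast
    moreover have "x + h \<in> ball x d" if "norm h < d" for x h
      using that by (simp add: dist_norm)
    ultimately show ?thesis by (intro that[of d]) blast+
  qed
  have [measurable]: "U \<in> sets borel" "K \<in> sets borel" "B \<in> sets borel"
    using U K B by auto
  have fB: "emeasure lborel B < \<infinity>" using B(2) by (rule emeasure_bounded_finite)
  have UB: "emeasure lborel (U - B) < ennreal (e / 8)" and BK: "emeasure lborel (B - K) < ennreal (e / 8)"
    using U(4) K(4) by (simp_all add: main_part_sets)
  have fUB: "emeasure lborel (U - B) < \<infinity>" and fBK: "emeasure lborel (B - K) < \<infinity>"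
    using UB BK by (auto intro: order_less_trans)
  have mUB: "measure lborel (U - B) < e / 8" and mBK: "measure lborel (B - K) < e / 8"
    using UB BK fUB fBK e by (auto simp: emeasure_eq_ennreal_measure less_top[symmetric] ennreal_less_iff)
  let ?f = "\<lambda>y. indicator (B - K) y + indicator (U - B) y :: real"
  have fi: "integrable lborel ?f"
    using fUB fBK by (intro Bochner_Integration.integrable_add integrable_real_indicator) auto
  have If: "(LINT y|lborel. ?f y) < e / 4"
    using mUB mBK fUB fBK by (subst Bochner_Integration.integral_add) (auto intro!: integrable_real_indicator)
  show thesis
  proof (rule that[OF d(1)])
    fix h :: "real^'n" assume h: "norm h < d"
    have fih: "integrable lborel (\<lambda>y. ?f (y + h))" and Ifh: "(LINT y|lborel. ?f (y + h)) = (LINT y|lborel. ?f y)"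
    proof -
      have *: "distr lborel borel (\<lambda>y. h + y) = lborel" by (rule lborel_distr_plus)
      have "integrable (distr lborel borel (\<lambda>y. h + y)) ?f" using fi * by simp
      then show "integrable lborel (\<lambda>y. ?f (y + h))"
        by (subst (asm) integrable_distr_eq) (auto simp: add.commute)
      have "(LINT y|distr lborel borel (\<lambda>y. h + y). ?f y) = (LINT y|lborel. ?f (h + y))"
        by (rule integral_distr) measurable
      then show "(LINT y|lborel. ?f (y + h)) = (LINT y|lborel. ?f y)"
        unfolding * by (simp add: add.commute)
    qed
    have pt: "\<bar>indicator B (y + h) - indicator B y :: real\<bar> \<le> ?f y + ?f (y + h)" for y
    proof -
      consider "y + h \<in> B" "y \<notin> B" | "y + h \<notin> B" "y \<in> B" | "y + h \<in> B \<longleftrightarrow> y \<in> B" by blast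
      then show ?thesis
      proof cases
        case 1
        have "y \<in> U" if "y + h \<in> K" using d(2)[OF that, of "- h"] h by simp
        then show ?thesis using 1 by (auto simp: indicator_def)
      next
        case 2
        have "y + h \<in> U" if "y \<in> K" using d(2)[OF that h] .
        then show ?thesis using 2 by (auto simp: indicator_def)
      next
        case 3
        then have "indicator B (y + h) = (indicator B y :: real)" by (auto simp: indicator_def)
        then show ?thesis by simp
      qed
    qed
    have "(LINT y|lborel. \<bar>indicator B (y + h) - indicator B y :: real\<bar>) \<le> (LINT y|lborel. ?f y + ?f (y + h))"
      by (rule integral_mono'[OF Bochner_Integration.integrable_add[OF fi fih] pt]) simp
    also have "\<dots> = (LINT y|lborel. ?f y) + (LINT y|lborel. ?f (y + h))"
      using fi fih by (rule Bochner_Integration.integral_add)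
    also have "\<dots> < e" using If Ifh e by linarith
    finally show "(LINT y|lborel. \<bar>indicator B (y + h) - indicator B y :: real\<bar>) < e" .
  qed
qed

text \<open>The convolution of \<open>1\<^sub>A\<close> with the reflection of \<open>1\<^sub>B\<close>, a continuous function of compact support.\<close>

definition overlap :: "(real^'n) set \<Rightarrow> (real^'n) set \<Rightarrow> real^'n \<Rightarrow> real" where
  "overlap A B z = (LINT x|lborel. indicator A x * indicator B (x - z))"

lemma indicator_integrable_bounded:
  fixes A :: "(real^'n) set"
  assumes "A \<in> sets borel" "bounded A"
  shows "integrable lborel (indicator A :: real^'n \<Rightarrow> real)"
  using assms emeasure_bounded_finite[OF assms(2)] by (intro integrable_real_indicator) auto

lemma overlap_integrable:
  fixes A B :: "(real^'n) set"
  assumes [measurable]: "A \<in> sets borel" "B \<in> sets borel" and "bounded A"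
  shows "integrable lborel (\<lambda>x. indicator A x * indicator B (x - z) :: real)"
  by (rule Bochner_Integration.integrable_bound[OF indicator_integrable_bounded[OF assms(1,3)]])
    (auto simp: indicator_def)

lemma overlap_continuous:
  fixes A B :: "(real^'n) set"
  assumes A: "A \<in> sets borel" "bounded A" and B: "B \<in> sets borel" "bounded B"
  shows "continuous_on UNIV (overlap A B)"
  unfolding continuous_on_iff
proof safe
  fix z :: "real^'n" and e :: real assume e: "0 < e"
  note [measurable] = A(1) B(1)
  obtain d where d: "0 < d" "\<And>h. norm h < d \<Longrightarrow> (LINT y|lborel. \<bar>indicator B (y + h) - indicator B y :: real\<bar>) < e"
    using translate_indicator_continuous_L1[OF B e] by blast
  have "dist (overlap A B z') (overlap A B z) < e" if z': "dist z' z < d" for z'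
  proof -
    let ?h = "z - z'"
    let ?D = "\<lambda>y. \<bar>indicator B (y + ?h) - indicator B y :: real\<bar>"
    have Di: "integrable lborel ?D"
    proof -
      have "integrable lborel (\<lambda>y. indicator B (?h + y) :: real)"
        using indicator_integrable_bounded[OF B] lborel_distr_plus[of ?h]
        by (subst (asm) lborel_distr_plus[of ?h, symmetric], subst (asm) integrable_distr_eq) auto
      then show ?thesis
        using indicator_integrable_bounded[OF B] by (intro integrable_abs Bochner_Integration.integrable_diff) (auto simp: add.commute)
    qed
    have D: "integrable lborel (\<lambda>x. ?D (x - z))" "(LINT x|lborel. ?D (x - z)) = (LINT y|lborel. ?D y)"
    proof -
      have *: "distr lborel borel (\<lambda>y. - z + y) = lborel" by (rule lborel_distr_plus)
      have "integrable (distr lborel borel (\<lambda>y. - z + y)) ?D" using Di * by simp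
      then show "integrable lborel (\<lambda>x. ?D (x - z))"
        by (subst (asm) integrable_distr_eq) (auto simp: algebra_simps)
      have "(LINT y|distr lborel borel (\<lambda>y. - z + y). ?D y) = (LINT x|lborel. ?D (- z + x))"
        by (rule integral_distr) measurable
      then show "(LINT x|lborel. ?D (x - z)) = (LINT y|lborel. ?D y)"
        unfolding * by simp
    qed
    have "overlap A B z' - overlap A B z = (LINT x|lborel. indicator A x * indicator B (x - z') - indicator A x * indicator B (x - z))"
      unfolding overlap_def by (rule Bochner_Integration.integral_diff[symmetric]; rule overlap_integrable[OF A(1) B(1) A(2)])
    also have "norm \<dots> \<le> (LINT x|lborel. norm (indicator A x * indicator B (x - z') - indicator A x * indicator B (x - z) :: real))"
      by (rule integral_norm_bound)
    also have "\<dots> \<le> (LINT x|lborel. ?D (x - z))"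
      using D(1) by (intro integral_mono') (auto simp: indicator_def)
    also have "\<dots> = (LINT y|lborel. ?D y)" by (rule D(2))
    also have "\<dots> < e"
      using d(2)[of ?h] z' by (simp add: dist_norm norm_minus_commute)
    finally show ?thesis by (simp add: dist_norm)
  qed
  then show "\<exists>d>0. \<forall>x'\<in>UNIV. dist x' z < d \<longrightarrow> dist (overlap A B x') (overlap A B z) < e"
    using d(1) by blast
qed

lemma overlap_bound:
  fixes A B :: "(real^'n) set"
  assumes A: "A \<in> sets borel" "bounded A" and B: "B \<in> sets borel" "bounded B"
  obtains M R where "\<forall>z. \<bar>overlap A B z\<bar> \<le> M * indicator (cball 0 R) z"
    "\<forall>x z. x \<in> A \<longrightarrow> x - z \<in> B \<longrightarrow> z \<in> cball 0 R"
proof -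
  obtain a b where ab: "\<And>x. x \<in> A \<Longrightarrow> norm x \<le> a" "\<And>x. x \<in> B \<Longrightarrow> norm x \<le> b"
    using A B by (auto simp: bounded_iff)
  have R: "z \<in> cball 0 (a + b)" if "x \<in> A" "x - z \<in> B" for x z
    using ab(1)[OF that(1)] ab(2)[OF that(2)] norm_triangle_ineq4[of x "x - z"] by simp
  have "\<bar>overlap A B z\<bar> \<le> measure lborel A * indicator (cball 0 (a + b)) z" for z
  proof (cases "z \<in> cball 0 (a + b)")
    case True
    have "norm (overlap A B z) \<le> (LINT x|lborel. norm (indicator A x * indicator B (x - z) :: real))"
      unfolding overlap_def by (rule integral_norm_bound)
    also have "\<dots> \<le> (LINT x|lborel. indicator A x)"
      by (rule integral_mono'[OF indicator_integrable_bounded[OF A]]) (auto simp: indicator_def)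
    finally show ?thesis using True A by simp
  next
    case False
    then have "indicator A x * indicator B (x - z) = (0 :: real)" for x
      using R[of x z] by (auto simp: indicator_def)
    then have "overlap A B z = (LINT x::real^'n|lborel. 0)"
      unfolding overlap_def by (intro Bochner_Integration.integral_cong refl)
    then show ?thesis using False by simp
  qed
  with R show thesis by (intro that[of "measure lborel A" "a + b"]) auto
qed

text \<open>The change of variables \<open>z = x - y\<close>. It is applied to the covariance \<open>f\<close> and to the exponentials
  of the Fourier transform.\<close>

lemma overlap_pairing:
  fixes A B :: "(real^'n) set" and k :: "real^'n \<Rightarrow> 'b::{banach, second_countable_topology}"
  assumes A: "A \<in> sets borel" "bounded A" and B: "B \<in> sets borel" "bounded B"
    and k [measurable]: "k \<in> borel_measurable borel" and loc: "\<And>R. set_integrable lborel (cball 0 R) k"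
  shows "(LINT x:A|lborel. LINT y:B|lborel. k (x - y)) = (LINT z|lborel. overlap A B z *\<^sub>R k z)"
proof -
  note [measurable] = A(1) B(1)
  obtain M R where "\<forall>z. \<bar>overlap A B z\<bar> \<le> M * indicator (cball 0 R) z"
    and R: "\<forall>x z. x \<in> A \<longrightarrow> x - z \<in> B \<longrightarrow> z \<in> cball 0 R"
    by (rule overlap_bound[OF A B]) (rule that)
  let ?F = "\<lambda>x z. (indicator A x * indicator B (x - z)) *\<^sub>R k z"
  have inner: "(LINT y:B|lborel. k (x - y)) = (LINT z|lborel. indicator B (x - z) *\<^sub>R k z)" for x
  proof -
    have "(LINT y:B|lborel. k (x - y)) = \<bar>- 1\<bar> ^ DIM(real^'n) *\<^sub>R (LINT z|lborel. indicator B (x + (- 1) *\<^sub>R z) *\<^sub>R k (x - (x + (- 1) *\<^sub>R z)))"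
      unfolding set_lebesgue_integral_def by (rule lborel_integral_affine) auto
    then show ?thesis by simp
  qed
  have I: "integrable (lborel \<Otimes>\<^sub>M lborel) (\<lambda>(x, z). ?F x z)"
  proof (rule Bochner_Integration.integrable_bound)
    show "integrable (lborel \<Otimes>\<^sub>M lborel) (\<lambda>(x::real^'n, z). indicator A x * norm (indicator (cball 0 R) z *\<^sub>R k z))"
      using loc[of R] by (intro lborel_pair.integrable_product_mult indicator_integrable_bounded A integrable_norm)
        (auto simp: set_integrable_def)
    show "(\<lambda>(x, z). ?F x z) \<in> borel_measurable (lborel \<Otimes>\<^sub>M lborel)" by measurable
    have "norm (?F x z) \<le> norm (indicator A x * norm (indicator (cball 0 R) z *\<^sub>R k z))" for x z
      using R by (auto simp: indicator_def)
    then show "AE p in lborel \<Otimes>\<^sub>M lborel. norm (case p of (x, z) \<Rightarrow> ?F x z) \<le>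
        norm (case p of (x, z) \<Rightarrow> indicator A x * norm (indicator (cball 0 R) z *\<^sub>R k z))"
      by (intro AE_I2) (auto split: prod.split)
  qed
  have "(LINT x:A|lborel. LINT y:B|lborel. k (x - y)) = (LINT x|lborel. LINT z|lborel. ?F x z)"
    unfolding inner by (simp add: set_lebesgue_integral_def flip: scaleR_scaleR)
  also have "\<dots> = (LINT z|lborel. LINT x|lborel. ?F x z)"
    by (rule lborel_pair.Fubini_integral[OF I, symmetric])
  also have "\<dots> = (LINT z|lborel. overlap A B z *\<^sub>R k z)"
    unfolding overlap_def
    by (intro Bochner_Integration.integral_cong refl integral_scaleR_left overlap_integrable[OF A(1) B(1) A(2)])
  finally show ?thesis .
qed

abbreviation fourier_ind :: "(real^'n) set \<Rightarrow> real^'n \<Rightarrow> complex" where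
  "fourier_ind A \<equiv> fourier (\<lambda>x. complex_of_real (indicator A x))"

lemma fourier_overlap:
  fixes A B :: "(real^'n) set"
  assumes A: "A \<in> sets borel" "bounded A" and B: "B \<in> sets borel" "bounded B"
  shows "fourier (\<lambda>z. complex_of_real (overlap A B z)) \<xi> = fourier_ind A \<xi> * cnj (fourier_ind B \<xi>)"
proof -
  let ?e = "\<lambda>z. exp (- (\<i> * complex_of_real (\<xi> \<bullet> z)))"
  have loc: "set_integrable lborel (cball 0 R) ?e" for R
    unfolding set_integrable_def
  proof (rule Bochner_Integration.integrable_bound)
    show "integrable lborel (indicator (cball 0 R) :: real^'n \<Rightarrow> real)"
      by (intro indicator_integrable_bounded) auto
  qed (auto simp: indicator_def)
  have "fourier (\<lambda>z. complex_of_real (overlap A B z)) \<xi> = (LINT z|lborel. overlap A B z *\<^sub>R ?e z)"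
    unfolding fourier_def by (simp add: scaleR_conv_of_real mult.commute)
  also have "\<dots> = (LINT x:A|lborel. LINT y:B|lborel. ?e (x - y))"
    by (rule overlap_pairing[OF A B _ loc, symmetric]) measurable
  also have "\<dots> = (LINT x|lborel. (?e x * complex_of_real (indicator A x)) * cnj (fourier_ind B \<xi>))"
    unfolding set_lebesgue_integral_def
  proof (intro Bochner_Integration.integral_cong refl)
    fix x
    have "(LINT y|lborel. indicator B y *\<^sub>R ?e (x - y)) = (LINT y|lborel. ?e x * cnj (?e y * complex_of_real (indicator B y)))"
      by (intro Bochner_Integration.integral_cong refl)
        (auto simp: indicator_def inner_diff_right exp_cnj exp_add[symmetric] algebra_simps)
    also have "\<dots> = ?e x * cnj (fourier_ind B \<xi>)"
      unfolding integral_mult_right_zero Bochner_Integration.integral_cnj fourier_def ..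
    finally show "indicator A x *\<^sub>R (LINT y|lborel. indicator B y *\<^sub>R ?e (x - y)) = (?e x * complex_of_real (indicator A x)) * cnj (fourier_ind B \<xi>)"
      by (simp add: scaleR_conv_of_real mult_ac)
  qed
  also have "\<dots> = fourier_ind A \<xi> * cnj (fourier_ind B \<xi>)"
    unfolding integral_mult_left_zero fourier_def ..
  finally show ?thesis .
qed

text \<open>For \<open>A = B\<close> the transform of the overlap is \<open>\<bar>F 1\<^sub>A\<bar>\<^sup>2 \<ge> 0\<close>, hence integrable for \<open>\<mu>\<close>; the mixed products
  are then integrable as well, and the pairing identity applies to them.\<close>

lemma indicator_isometry:
  fixes A B :: "(real^'n) set"
  assumes tft: "tempered_fourier_transform \<mu> f" and sets_\<mu> [measurable_cong]: "sets \<mu> = sets borel"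
    and sf: "sigma_finite_measure \<mu>"
    and A: "A \<in> sets borel" "bounded A" and B: "B \<in> sets borel" "bounded B"
  shows "integrable \<mu> (\<lambda>\<xi>. fourier_ind A \<xi> * cnj (fourier_ind B \<xi>))"
    and "complex_of_real (LINT x:A|lborel. LINT y:B|lborel. f (x - y)) =
      (LINT \<xi>|\<mu>. fourier_ind A \<xi> * cnj (fourier_ind B \<xi>))"
proof -
  have sq: "integrable \<mu> (\<lambda>\<xi>. (norm (fourier_ind C \<xi>))\<^sup>2)" if C: "C \<in> sets borel" "bounded C" for C :: "(real^'n) set"
  proof -
    obtain M R where MR0: "\<forall>z. \<bar>overlap C C z\<bar> \<le> M * indicator (cball 0 R) z"
        "\<forall>x z. x \<in> C \<longrightarrow> x - z \<in> C \<longrightarrow> z \<in> cball 0 R"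
      by (rule overlap_bound[OF C C]) (rule that)
    note MR = MR0(1)[rule_format]
    show ?thesis
      by (rule spectral_integrable_of_nonneg[OF tft sets_\<mu> sf overlap_continuous[OF C C] MR])
        (simp_all only: fourier_overlap[OF C C] complex_norm_square zero_le_power2)
  qed
  have [measurable]: "fourier_ind A \<in> borel_measurable borel" "fourier_ind B \<in> borel_measurable borel"
    using A B by auto
  show int: "integrable \<mu> (\<lambda>\<xi>. fourier_ind A \<xi> * cnj (fourier_ind B \<xi>))"
  proof (rule Bochner_Integration.integrable_bound)
    show "integrable \<mu> (\<lambda>\<xi>. (norm (fourier_ind A \<xi>))\<^sup>2 + (norm (fourier_ind B \<xi>))\<^sup>2)"
      using sq A B by (intro Bochner_Integration.integrable_add) auto
    have "cnj \<in> borel_measurable borel" by (intro borel_measurable_continuous_onI continuous_intros)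
    from measurable_compose[OF \<open>fourier_ind B \<in> borel_measurable borel\<close> this]
    have "(\<lambda>\<xi>. fourier_ind A \<xi> * cnj (fourier_ind B \<xi>)) \<in> borel_measurable borel"
      by (intro borel_measurable_times \<open>fourier_ind A \<in> borel_measurable borel\<close>)
    then show "(\<lambda>\<xi>. fourier_ind A \<xi> * cnj (fourier_ind B \<xi>)) \<in> borel_measurable \<mu>"
      by (subst measurable_cong_sets[OF sets_\<mu> refl])
    have "norm (fourier_ind A \<xi> * cnj (fourier_ind B \<xi>)) \<le> (norm (fourier_ind A \<xi>))\<^sup>2 + (norm (fourier_ind B \<xi>))\<^sup>2" for \<xi>
    proof -
      have "norm (fourier_ind A \<xi>) * norm (fourier_ind B \<xi>) \<le> 2 * norm (fourier_ind A \<xi>) * norm (fourier_ind B \<xi>)" by simp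
      also have "\<dots> \<le> (norm (fourier_ind A \<xi>))\<^sup>2 + (norm (fourier_ind B \<xi>))\<^sup>2" by (rule sum_squares_bound)
      finally show ?thesis by (simp add: norm_mult)
    qed
    then show "AE \<xi> in \<mu>. norm (fourier_ind A \<xi> * cnj (fourier_ind B \<xi>)) \<le> norm ((norm (fourier_ind A \<xi>))\<^sup>2 + (norm (fourier_ind B \<xi>))\<^sup>2)"
      by (intro AE_I2) simp
  qed
  obtain M R where MR0: "\<forall>z. \<bar>overlap A B z\<bar> \<le> M * indicator (cball 0 R) z"
      "\<forall>x z. x \<in> A \<longrightarrow> x - z \<in> B \<longrightarrow> z \<in> cball 0 R"
    by (rule overlap_bound[OF A B]) (rule that)
  note MR = MR0(1)[rule_format]
  have fm [measurable]: "f \<in> borel_measurable borel" using kernel_measurable[OF tft sets_\<mu> sf] .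
  have loc: "set_integrable lborel (cball 0 R) f" for R
    unfolding set_integrable_def
  proof (rule Bochner_Integration.integrable_bound)
    show "integrable lborel (\<lambda>x. exp (R\<^sup>2 / 2) * (f x * gaussian 1 0 x))"
      using kernel_gaussian_integrable[OF tft sets_\<mu> sf, of 1 0] by simp
    have "norm (indicator (cball 0 R) x *\<^sub>R f x) \<le> norm (exp (R\<^sup>2 / 2) * (f x * gaussian 1 0 x))" for x
    proof (cases "x \<in> cball 0 R")
      case True
      then have "(norm x)\<^sup>2 \<le> R\<^sup>2" by (intro power_mono) auto
      then have "1 \<le> exp (R\<^sup>2 / 2) * gaussian 1 0 x" by (simp add: gaussian_def flip: exp_add)
      from mult_left_mono[OF this, of "\<bar>f x\<bar>"] show ?thesis using True by (simp add: abs_mult mult_ac)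
    qed simp
    then show "AE x in lborel. norm (indicator (cball 0 R) x *\<^sub>R f x) \<le> norm (exp (R\<^sup>2 / 2) * (f x * gaussian 1 0 x))"
      by (intro AE_I2)
    have "(\<lambda>x. indicator (cball 0 R) x *\<^sub>R f x) \<in> borel_measurable borel"
      by (intro borel_measurable_scaleR borel_measurable_indicator fm) auto
    then show "(\<lambda>x. indicator (cball 0 R) x *\<^sub>R f x) \<in> borel_measurable lborel"
      by simp
  qed
  have "(LINT x:A|lborel. LINT y:B|lborel. f (x - y)) = (LINT z|lborel. f z * overlap A B z)"
    using overlap_pairing[OF A B fm loc] by (simp add: mult.commute)
  then show "complex_of_real (LINT x:A|lborel. LINT y:B|lborel. f (x - y)) =
      (LINT \<xi>|\<mu>. fourier_ind A \<xi> * cnj (fourier_ind B \<xi>))"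
    using pairing_eq_spectral[OF tft sets_\<mu> sf overlap_continuous[OF A B] MR] int
    unfolding fourier_overlap[OF A B, abs_def] by simp
qed

section \<open>Scaling in the frequency variable\<close>

lemma nn_integral_lborel_scale:
  fixes F :: "'a::euclidean_space \<Rightarrow> ennreal"
  assumes [measurable]: "F \<in> borel_measurable borel" and L: "0 < L"
  shows "(\<integral>\<^sup>+\<xi>. F (L *\<^sub>R \<xi>) \<partial>lborel) = ennreal (L powr (- real DIM('a))) * (\<integral>\<^sup>+\<eta>. F \<eta> \<partial>lborel)"
proof -
  have "(\<integral>\<^sup>+\<eta>. F \<eta> \<partial>lborel) = ennreal (\<bar>L\<bar> ^ DIM('a)) * (\<integral>\<^sup>+\<xi>. F (0 + L *\<^sub>R \<xi>) \<partial>lborel)"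
    using L by (subst lborel_affine[of L 0]) (auto simp: nn_integral_density nn_integral_distr nn_integral_cmult ennreal_power)
  then have "ennreal (L powr (- real DIM('a))) * (\<integral>\<^sup>+\<eta>. F \<eta> \<partial>lborel) =
      (ennreal (L powr (- real DIM('a))) * ennreal (\<bar>L\<bar> ^ DIM('a))) * (\<integral>\<^sup>+\<xi>. F (L *\<^sub>R \<xi>) \<partial>lborel)"
    by (simp add: mult.assoc)
  also have "ennreal (L powr (- real DIM('a))) * ennreal (\<bar>L\<bar> ^ DIM('a)) = 1"
    using L by (simp flip: ennreal_mult' add: powr_minus powr_realpow)
  finally show ?thesis by simp
qed

text \<open>Bounding the radial profile at \<open>\<bar>\<eta>\<bar>\<close> by an integral over \<open>[\<bar>\<eta>\<bar>, 2\<bar>\<eta>\<bar>]\<close> and integrating over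
  \<open>\<eta>\<close> first reduces the integral to the volume of balls, without polar coordinates.\<close>

lemma radial_weight_finite:
  fixes a :: real
  assumes a: "0 < a" "a < 2"
  shows "(\<integral>\<^sup>+\<eta>. ennreal (min 1 ((norm \<eta>)\<^sup>2) * norm (\<eta> :: 'a::euclidean_space) powr (- a - real DIM('a))) \<partial>lborel) < \<infinity>"
proof -
  define d where "d = real DIM('a)"
  define q where "q = a + d"
  define V where "V = unit_ball_vol d"
  have d: "0 < d" by (simp add: d_def)
  have q: "0 < q" using a d by (simp add: q_def)
  \<comment> \<open>compensates the largest ratio of \<open>\<rho> powr (-q - 1)\<close> to \<open>r powr (-q - 1)\<close> for \<open>\<rho> \<le> r \<le> 2\<rho>\<close>\<close>
  define C where "C = 2 powr (q + 1)"
  define w :: "real \<Rightarrow> real" where "w r = min 1 (r\<^sup>2) * r powr (- q - 1)" for r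
  have [measurable]: "w \<in> borel_measurable borel" unfolding w_def by measurable
  have w0: "0 \<le> w r" for r by (simp add: w_def)
  have C0: "0 < C" by (simp add: C_def)
  have profile: "ennreal (min 1 (\<rho>\<^sup>2) * \<rho> powr (- q)) \<le> (\<integral>\<^sup>+r. ennreal (C * w r) * indicator {\<rho>..2 * \<rho>} r \<partial>lborel)" if \<rho>: "0 < \<rho>" for \<rho>
  proof -
    have "min 1 (\<rho>\<^sup>2) * \<rho> powr (- q) = (C * (min 1 (\<rho>\<^sup>2) * (2 * \<rho>) powr (- q - 1))) * \<rho>"
    proof -
      have "\<rho> powr (- q - 1) = \<rho> powr (- q) * \<rho> powr (- 1)"
        by (simp only: powr_add[symmetric]) simp
      then have "(2 * \<rho>) powr (- q - 1) = 2 powr (- (q + 1)) * (\<rho> powr (- q) * \<rho> powr (- 1))"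
        using \<rho> by (simp only: powr_mult) simp
      moreover have "C * 2 powr (- (q + 1)) = 1" by (simp add: C_def flip: powr_add)
      moreover have "\<rho> powr (- 1) * \<rho> = 1" using \<rho> by (simp add: powr_minus)
      ultimately show ?thesis by (simp add: mult_ac)
    qed
    also have "ennreal \<dots> = (\<integral>\<^sup>+r. ennreal (C * (min 1 (\<rho>\<^sup>2) * (2 * \<rho>) powr (- q - 1))) * indicator {\<rho>..2 * \<rho>} r \<partial>lborel)"
      using \<rho> C0 by (simp add: nn_integral_cmult ennreal_mult')
    also have "\<dots> \<le> (\<integral>\<^sup>+r. ennreal (C * w r) * indicator {\<rho>..2 * \<rho>} r \<partial>lborel)"
    proof (intro nn_integral_mono)
      fix r
      have "min 1 (\<rho>\<^sup>2) * (2 * \<rho>) powr (- q - 1) \<le> w r" if "\<rho> \<le> r" "r \<le> 2 * \<rho>"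
        unfolding w_def using that \<rho> q
        by (intro mult_mono powr_mono2') (auto simp: min_le_iff_disj intro: power_mono)
      then show "ennreal (C * (min 1 (\<rho>\<^sup>2) * (2 * \<rho>) powr (- q - 1))) * indicator {\<rho>..2 * \<rho>} r \<le> ennreal (C * w r) * indicator {\<rho>..2 * \<rho>} r"
        using C0 by (auto simp: indicator_def intro!: ennreal_leI mult_left_mono)
    qed
    finally show ?thesis .
  qed
  have "(\<integral>\<^sup>+\<eta>. ennreal (min 1 ((norm \<eta>)\<^sup>2) * norm (\<eta> :: 'a) powr (- a - real DIM('a))) \<partial>lborel)
     \<le> (\<integral>\<^sup>+(\<eta>::'a). \<integral>\<^sup>+r. ennreal (C * w r) * indicator {r. 0 < r} r * indicator {(\<eta>, r). norm \<eta> \<le> r} (\<eta>, r) \<partial>lborel \<partial>lborel)"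
  proof (intro nn_integral_mono)
    fix \<eta> :: 'a
    show "ennreal (min 1 ((norm \<eta>)\<^sup>2) * norm \<eta> powr (- a - real DIM('a))) \<le>
       (\<integral>\<^sup>+r. ennreal (C * w r) * indicator {r. 0 < r} r * indicator {(\<eta>, r). norm \<eta> \<le> r} (\<eta>, r) \<partial>lborel)"
    proof (cases "\<eta> = 0")
      case False
      have "ennreal (min 1 ((norm \<eta>)\<^sup>2) * norm \<eta> powr (- a - real DIM('a))) = ennreal (min 1 ((norm \<eta>)\<^sup>2) * norm \<eta> powr (- q))"
        by (simp add: q_def d_def)
      also have "\<dots> \<le> (\<integral>\<^sup>+r. ennreal (C * w r) * indicator {norm \<eta>..2 * norm \<eta>} r \<partial>lborel)"
        using False by (intro profile) simp
      also have "\<dots> \<le> (\<integral>\<^sup>+r. ennreal (C * w r) * indicator {r. 0 < r} r * indicator {(\<eta>, r). norm \<eta> \<le> r} (\<eta>, r) \<partial>lborel)"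
        using False by (intro nn_integral_mono) (auto simp: indicator_def intro: less_le_trans[of 0 "norm \<eta>"])
      finally show ?thesis .
    qed simp
  qed
  also have "\<dots> = (\<integral>\<^sup>+r. \<integral>\<^sup>+(\<eta>::'a). ennreal (C * w r) * indicator {r. 0 < r} r * indicator {(\<eta>, r). norm \<eta> \<le> r} (\<eta>, r) \<partial>lborel \<partial>lborel)"
    by (rule lborel_pair.Fubini') measurable
  also have "\<dots> = (\<integral>\<^sup>+r. ennreal (C * V) * ennreal (indicator {0<..} r * (min 1 (r\<^sup>2) * r powr (- a - 1))) \<partial>lborel)"
  proof (intro nn_integral_cong)
    fix r :: real
    have "(\<integral>\<^sup>+(\<eta>::'a). ennreal (C * w r) * indicator {r. 0 < r} r * indicator {(\<eta>, r). norm \<eta> \<le> r} (\<eta>, r) \<partial>lborel)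
       = (\<integral>\<^sup>+(\<eta>::'a). (ennreal (C * w r) * indicator {r. 0 < r} r) * indicator (cball 0 r) \<eta> \<partial>lborel)"
      by (intro nn_integral_cong) (auto simp: indicator_def)
    also have "\<dots> = (ennreal (C * w r) * indicator {r. 0 < r} r) * emeasure lborel (cball (0::'a) r)"
      by (intro nn_integral_cmult_indicator) auto
    also have "\<dots> = ennreal (C * V) * ennreal (indicator {0<..} r * (min 1 (r\<^sup>2) * r powr (- a - 1)))"
    proof (cases "0 < r")
      case True
      have "r powr (- q - 1) * r ^ DIM('a) = r powr (- a - 1)"
        using True by (simp add: powr_realpow[symmetric] q_def d_def flip: powr_add)
      then have "w r * r ^ DIM('a) = min 1 (r\<^sup>2) * r powr (- a - 1)" by (simp add: w_def mult.assoc)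
      then have "C * w r * (V * r ^ DIM('a)) = C * V * (min 1 (r\<^sup>2) * r powr (- a - 1))" by (simp add: mult_ac)
      then show ?thesis
        using True C0 w0[of r] by (simp add: emeasure_cball V_def d_def flip: ennreal_mult')
    qed simp
    finally show "(\<integral>\<^sup>+(\<eta>::'a). ennreal (C * w r) * indicator {r. 0 < r} r * indicator {(\<eta>, r). norm \<eta> \<le> r} (\<eta>, r) \<partial>lborel)
       = ennreal (C * V) * ennreal (indicator {0<..} r * (min 1 (r\<^sup>2) * r powr (- a - 1)))" .
  qed
  also have "\<dots> = ennreal (C * V) * (\<integral>\<^sup>+r. ennreal (indicator {0<..} r * (min 1 (r\<^sup>2) * r powr (- a - 1))) \<partial>lborel)"
    by (intro nn_integral_cmult) measurable
  also have "\<dots> < \<infinity>"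
  proof -
    let ?g = "\<lambda>r::real. indicator {0<..} r * (min 1 (r\<^sup>2) * r powr (- a - 1))"
    have nn1: "(\<integral>\<^sup>+r. ennreal (indicator {0..1} r * r powr (1 - a)) \<partial>lborel) < \<infinity>"
    proof -
      have "integrable lborel (\<lambda>r. indicator {0..1} r * r powr (1 - a))"
        using powr_set_integral(1)[of "2 - a" 1] a by (simp add: set_integrable_def)
      from nn_integral_eq_integral[OF this] show ?thesis by simp
    qed
    have nn2: "(\<integral>\<^sup>+r. ennreal (indicator {1..} r * r powr (- a - 1)) \<partial>lborel) < \<infinity>"
    proof -
      have "integrable lborel (\<lambda>r. indicator {1..} r * r powr (- a - 1))"
        using lborel_set_integral_nonneg(1)[OF _ _ _ has_integral_powr_to_inf[of "- a - 1" 1]] a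
        by (simp add: set_integrable_def)
      from nn_integral_eq_integral[OF this] show ?thesis by simp
    qed
    have "(\<integral>\<^sup>+r. ennreal (?g r) \<partial>lborel) \<le> (\<integral>\<^sup>+r. ennreal (indicator {0..1} r * r powr (1 - a)) + ennreal (indicator {1..} r * r powr (- a - 1)) \<partial>lborel)"
    proof (intro nn_integral_mono)
      fix r :: real
      have "?g r \<le> indicator {0..1} r * r powr (1 - a) + indicator {1..} r * r powr (- a - 1)"
      proof (cases "0 < r")
        case True
        have "r\<^sup>2 * r powr (- a - 1) = r powr (1 - a)"
          using True powr_add[of r 2 "- a - 1"] by simp
        moreover have "min 1 (r\<^sup>2) * r powr (- a - 1) \<le> r\<^sup>2 * r powr (- a - 1)" by (intro mult_right_mono) auto
        moreover have "min 1 (r\<^sup>2) * r powr (- a - 1) \<le> 1 * r powr (- a - 1)" by (intro mult_right_mono) auto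
        ultimately show ?thesis using True by (auto simp: indicator_def intro: add_increasing add_increasing2)
      qed simp
      then show "ennreal (?g r) \<le> ennreal (indicator {0..1} r * r powr (1 - a)) + ennreal (indicator {1..} r * r powr (- a - 1))"
        by (simp add: ennreal_leI flip: ennreal_plus)
    qed
    also have "\<dots> = (\<integral>\<^sup>+r. ennreal (indicator {0..1} r * r powr (1 - a)) \<partial>lborel) + (\<integral>\<^sup>+r. ennreal (indicator {1..} r * r powr (- a - 1)) \<partial>lborel)"
      by (intro nn_integral_add) measurable
    also have "\<dots> < \<infinity>" using nn1 nn2 by simp
    finally show ?thesis by (simp add: ennreal_mult_less_top)
  qed
  finally show ?thesis .
qed

text \<open>The pair \<open>(\<delta>, z)\<close> stands for a normalised increment in time and space.\<close>

definition shell_defect :: "real \<Rightarrow> real \<times> (real^'n) \<Rightarrow> real" where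
  "shell_defect R p = (LINT \<eta>|lborel. indicator (cball 0 (2 * R) - ball 0 R) \<eta> * (1 - cos (\<eta> \<bullet> snd p) * cos (norm \<eta> * fst p)))"

lemma defect_bounds: "0 \<le> 1 - cos x * cos y" "1 - cos x * cos y \<le> 2" for x y :: real
proof -
  have "\<bar>cos x * cos y\<bar> \<le> 1 * 1" unfolding abs_mult by (intro mult_mono) auto
  then show "0 \<le> 1 - cos x * cos y" "1 - cos x * cos y \<le> 2" by auto
qed

lemma shell_integrable:
  "integrable lborel (\<lambda>\<eta>::real^'n. indicator (cball 0 (2 * R) - ball 0 R) \<eta> * c :: real)"
proof -
  have "bounded (cball 0 (2 * R) - ball 0 R :: (real^'n) set)"
    by (rule bounded_subset[OF bounded_cball]) auto
  from emeasure_bounded_finite[OF this] show ?thesis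
    by (intro integrable_mult_left integrable_real_indicator) auto
qed

lemma defect_measurable:
  "(\<lambda>\<eta>::real^'n. indicator (cball 0 (2 * R) - ball 0 R) \<eta> * (1 - cos (\<eta> \<bullet> z) * cos (norm \<eta> * \<delta>))) \<in> borel_measurable lborel"
proof -
  have "(\<lambda>\<eta>::real^'n. indicator (cball 0 (2 * R) - ball 0 R) \<eta> * (1 - cos (\<eta> \<bullet> z) * cos (norm \<eta> * \<delta>))) \<in> borel_measurable borel"
    by (intro borel_measurable_times borel_measurable_indicator borel_measurable_continuous_onI continuous_intros) auto
  then show ?thesis by simp
qed

lemma defect_integrable:
  "integrable lborel (\<lambda>\<eta>::real^'n. indicator (cball 0 (2 * R) - ball 0 R) \<eta> * (1 - cos (\<eta> \<bullet> z) * cos (norm \<eta> * \<delta>)))"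
proof (rule Bochner_Integration.integrable_bound[OF shell_integrable[of R 2]])
  show "AE \<eta>::real^'n in lborel. norm (indicator (cball 0 (2 * R) - ball 0 R) \<eta> * (1 - cos (\<eta> \<bullet> z) * cos (norm \<eta> * \<delta>)))
     \<le> norm (indicator (cball 0 (2 * R) - ball 0 R) \<eta> * 2 :: real)"
    using defect_bounds by (intro AE_I2) (auto simp: indicator_def)
qed (rule defect_measurable)

lemma continuous_shell_defect: "continuous_on UNIV (shell_defect R :: real \<times> (real^'n) \<Rightarrow> real)"
proof (rule continuous_on_sequentiallyI)
  fix u :: "nat \<Rightarrow> real \<times> (real^'n)" and p assume u: "u \<longlonglongrightarrow> p"
  show "(\<lambda>n. shell_defect R (u n)) \<longlonglongrightarrow> shell_defect R p"
    unfolding shell_defect_def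
  proof (rule integral_dominated_convergence[OF _ _ shell_integrable[of R 2]])
    show "AE \<eta>::real^'n in lborel. (\<lambda>n. indicator (cball 0 (2 * R) - ball 0 R) \<eta> * (1 - cos (\<eta> \<bullet> snd (u n)) * cos (norm \<eta> * fst (u n))))
       \<longlonglongrightarrow> indicator (cball 0 (2 * R) - ball 0 R) \<eta> * (1 - cos (\<eta> \<bullet> snd p) * cos (norm \<eta> * fst p))"
      using u by (intro AE_I2 tendsto_intros)
    show "AE \<eta>::real^'n in lborel. norm (indicator (cball 0 (2 * R) - ball 0 R) \<eta> * (1 - cos (\<eta> \<bullet> snd (u n)) * cos (norm \<eta> * fst (u n))))
       \<le> indicator (cball 0 (2 * R) - ball 0 R) \<eta> * 2" for n
      using defect_bounds by (intro AE_I2) (auto simp: indicator_def)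
  qed (rule defect_measurable)+
qed

text \<open>The integrand is continuous and nonnegative, so one positive value suffices. In the direction of \<open>z\<close>
  the defect at radius \<open>r\<close> is \<open>1 - cos (r \<bar>z\<bar>) cos (r \<delta>)\<close>; it vanishes only if both sines vanish, which
  cannot happen at all radii between \<open>R\<close> and \<open>2R\<close>.\<close>

lemma shell_defect_pos:
  fixes p :: "real \<times> (real^'n)"
  assumes R: "0 < R" and p: "p \<noteq> 0"
  shows "0 < shell_defect R p"
proof -
  obtain \<delta> z where p_eq: "p = (\<delta>, z)" by (cases p)
  define e :: "real^'n" where "e = (if z = 0 then axis undefined 1 else z /\<^sub>R norm z)"
  have ne: "norm e = 1" by (simp add: e_def)
  have ez: "e \<bullet> z = norm z"
    by (simp add: e_def power2_norm_eq_inner[symmetric] power2_eq_square)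
  \<comment> \<open>one of the two frequencies that is different from \<open>0\<close>\<close>
  define m where "m = (if \<delta> = 0 then norm z else \<delta>)"
  have m: "m \<noteq> 0" using p by (auto simp: m_def p_eq zero_prod_def)
  have "\<exists>r. R < r \<and> r < 2 * R \<and> sin (r * m) \<noteq> 0"
  proof (rule ccontr)
    assume "\<not> ?thesis"
    then have z0: "sin (r * m) = 0" if "R < r" "r < 2 * R" for r using that by blast
    let ?r = "3 / 2 * R"
    have "((\<lambda>r. sin (r * m)) has_real_derivative cos (?r * m) * m) (at ?r)"
      by (auto intro!: derivative_eq_intros)
    moreover have "((\<lambda>r. sin (r * m)) has_real_derivative 0) (at ?r)"
      by (rule has_field_derivative_transform_within_open[of "\<lambda>_. 0" _ _ "{R<..<2*R}"]) (use R z0 in auto)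
    ultimately have "cos (?r * m) * m = 0" by (rule DERIV_unique)
    then have "cos (?r * m) = 0" using m by simp
    moreover have "sin (?r * m) = 0" using R by (intro z0) auto
    ultimately show False using sin_cos_squared_add[of "?r * m"] by simp
  qed
  then obtain r where r: "R < r" "r < 2 * R" "sin (r * m) \<noteq> 0" by blast
  define F where "F = (\<lambda>\<eta>::real^'n. 1 - cos (\<eta> \<bullet> z) * cos (norm \<eta> * \<delta>))"
  have F0: "0 \<le> F \<eta>" for \<eta> using defect_bounds by (simp add: F_def)
  have cF: "continuous_on UNIV F" unfolding F_def by (intro continuous_intros)
  have "0 < F (r *\<^sub>R e)"
  proof -
    have "cos (r * norm z) * cos (r * \<delta>) \<noteq> 1"
    proof
      assume eq: "cos (r * norm z) * cos (r * \<delta>) = 1"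
      define A B where "A = \<bar>cos (r * norm z)\<bar>" and "B = \<bar>cos (r * \<delta>)\<bar>"
      have AB: "A * B = 1" "A \<le> 1" "B \<le> 1" "0 \<le> A" "0 \<le> B"
        unfolding A_def B_def abs_mult[symmetric] eq by auto
      have "1 \<le> A" using mult_left_le[of B A] AB by simp
      moreover have "1 \<le> B" using mult_left_le[of A B] AB by (simp add: mult.commute)
      ultimately have "A = 1" "B = 1" using AB(2,3) by auto
      then have "\<bar>cos (r * m)\<bar> = 1" by (simp add: m_def A_def B_def)
      then have "(cos (r * m))\<^sup>2 = 1" by (metis power2_abs power_one)
      then have "sin (r * m) = 0" using sin_cos_squared_add[of "r * m"] by simp
      then show False using r by simp
    qed
    then show ?thesis using F0[of "r *\<^sub>R e"] ne ez r R by (simp add: F_def less_le)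
  qed
  define \<epsilon> where "\<epsilon> = F (r *\<^sub>R e) / 2"
  have "open ({\<eta>. \<epsilon> < F \<eta>} \<inter> (ball 0 (2 * R) - cball 0 R))"
    by (intro open_Int open_Diff open_Collect_less continuous_on_const cF) auto
  moreover have "r *\<^sub>R e \<in> {\<eta>. \<epsilon> < F \<eta>} \<inter> (ball 0 (2 * R) - cball 0 R)"
    using \<open>0 < F (r *\<^sub>R e)\<close> r R ne by (simp add: \<epsilon>_def)
  ultimately obtain \<tau> where \<tau>: "0 < \<tau>" "ball (r *\<^sub>R e) \<tau> \<subseteq> {\<eta>. \<epsilon> < F \<eta>} \<inter> (ball 0 (2 * R) - cball 0 R)"
    by (meson open_contains_ball)
  have "0 < \<epsilon> * measure lborel (ball (r *\<^sub>R e) \<tau>)"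
    using \<open>0 < F (r *\<^sub>R e)\<close> \<tau>(1) by (auto simp: \<epsilon>_def intro!: mult_pos_pos content_ball_pos)
  also have "\<dots> = (LINT \<eta>|lborel. \<epsilon> * indicator (ball (r *\<^sub>R e) \<tau>) \<eta>)" by simp
  also have "\<dots> \<le> shell_defect R p"
    unfolding shell_defect_def p_eq fst_conv snd_conv
  proof (rule integral_mono[OF _ defect_integrable])
    show "integrable lborel (\<lambda>\<eta>. \<epsilon> * indicator (ball (r *\<^sub>R e) \<tau>) \<eta>)"
      using emeasure_bounded_finite[OF bounded_ball[of "r *\<^sub>R e" \<tau>]]
      by (intro integrable_mult_right integrable_real_indicator) auto
    show "\<epsilon> * indicator (ball (r *\<^sub>R e) \<tau>) \<eta> \<le> indicator (cball 0 (2 * R) - ball 0 R) \<eta> * (1 - cos (\<eta> \<bullet> z) * cos (norm \<eta> * \<delta>))" for \<eta>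
    proof (cases "\<eta> \<in> ball (r *\<^sub>R e) \<tau>")
      case True
      then have "\<epsilon> < F \<eta>" "\<eta> \<in> ball 0 (2 * R) - cball 0 R" using \<tau>(2) by auto
      then show ?thesis using True by (auto simp: F_def)
    next
      case False
      then show ?thesis using F0[of \<eta>] by (auto simp: F_def indicator_def)
    qed
  qed
  finally show ?thesis .
qed

lemma shell_defect_uniform:
  assumes R: "0 < R"
  obtains c where "0 < c" "\<And>(p :: real \<times> (real^'n)). max \<bar>fst p\<bar> (norm (snd p)) = 1 \<Longrightarrow> c \<le> shell_defect R p"
proof -
  define S where "S = {p :: real \<times> (real^'n). max \<bar>fst p\<bar> (norm (snd p)) = 1}"
  have "closed S"
    unfolding S_def by (intro closed_Collect_eq continuous_intros)
  moreover have "S \<subseteq> cball 0 1 \<times> cball 0 1" by (auto simp: S_def)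
  then have "bounded S" by (rule bounded_subset[rotated]) (intro bounded_Times bounded_cball)
  ultimately have "compact S" by (simp add: compact_eq_bounded_closed)
  moreover have "(1, 0) \<in> S" by (simp add: S_def)
  ultimately obtain p where p: "p \<in> S" "\<And>y. y \<in> S \<Longrightarrow> shell_defect R p \<le> shell_defect R y"
    using continuous_attains_inf[of S "shell_defect R"] continuous_on_subset[OF continuous_shell_defect] by blast
  have "p \<noteq> 0" using p(1) by (auto simp: S_def)
  then show thesis
    by (intro that[of "shell_defect R p"]) (use shell_defect_pos[OF R \<open>p \<noteq> 0\<close>] p(2) in \<open>auto simp: S_def\<close>)
qed

section \<open>Time profiles of the wave kernel\<close>

definition wave_diff :: "real \<Rightarrow> real^'n \<Rightarrow> real \<Rightarrow> real^'n \<Rightarrow> real \<Rightarrow> real^'n \<Rightarrow> complex" where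
  "wave_diff t x s y r \<xi> = wave_integrand_ft t x r \<xi> - wave_integrand_ft s y r \<xi>"

text \<open>For \<open>\<sigma> = 1\<close> the amplitude of \<open>exp(-i\<rho>r)\<close>, for \<open>\<sigma> = -1\<close> that of \<open>exp(i\<rho>r)\<close>, in
  \<open>exp(-i \<xi> \<bullet> x) sin ((t - r) \<rho>) / \<rho>\<close>.\<close>

definition wave_coeff :: "real \<Rightarrow> real^'n \<Rightarrow> real^'n \<Rightarrow> real \<Rightarrow> complex" where
  "wave_coeff t x \<xi> \<sigma> = complex_of_real \<sigma> * cis (\<sigma> * (norm \<xi> * t) - \<xi> \<bullet> x) / (2 * \<i> * complex_of_real (norm \<xi>))"

lemma wave_integrand_exponential:
  assumes "\<xi> \<noteq> 0"
  shows "wave_integrand_ft t x r \<xi> = indicator {0..t} r *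
    (wave_coeff t x \<xi> 1 * cis (- (norm \<xi> * r)) + wave_coeff t x \<xi> (- 1) * cis (norm \<xi> * r))"
proof -
  let ?\<rho> = "norm \<xi>"
  have "cis ((t - r) * ?\<rho>) - cis (- ((t - r) * ?\<rho>)) = 2 * \<i> * complex_of_real (sin ((t - r) * ?\<rho>))"
    by (simp add: complex_eq_iff)
  then have sin: "complex_of_real (sin ((t - r) * ?\<rho>)) = (cis ((t - r) * ?\<rho>) - cis (- ((t - r) * ?\<rho>))) / (2 * \<i>)"
    by (simp add: field_simps)
  have e: "exp (- (\<i> * complex_of_real (\<xi> \<bullet> x))) = cis (- (\<xi> \<bullet> x))"
    by (simp add: cis_conv_exp)
  have c1: "cis (- (\<xi> \<bullet> x)) * cis ((t - r) * ?\<rho>) = cis (1 * (?\<rho> * t) - \<xi> \<bullet> x) * cis (- (?\<rho> * r))"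
    and c2: "cis (- (\<xi> \<bullet> x)) * cis (- ((t - r) * ?\<rho>)) = cis (- 1 * (?\<rho> * t) - \<xi> \<bullet> x) * cis (?\<rho> * r)"
    by (simp_all add: cis_mult algebra_simps)
  have "exp (- (\<i> * complex_of_real (\<xi> \<bullet> x))) * wave_kernel_ft (t - r) (- \<xi>) =
      (cis (- (\<xi> \<bullet> x)) * cis ((t - r) * ?\<rho>) - cis (- (\<xi> \<bullet> x)) * cis (- ((t - r) * ?\<rho>))) / (2 * \<i> * complex_of_real ?\<rho>)"
  proof -
    have "wave_kernel_ft (t - r) (- \<xi>) = complex_of_real (sin ((t - r) * ?\<rho>)) / complex_of_real ?\<rho>"
      using assms by (simp add: wave_kernel_ft_def)
    then show ?thesis
      unfolding e sin by (simp only: times_divide_eq_right divide_divide_eq_left right_diff_distrib)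
  qed
  also have "\<dots> = wave_coeff t x \<xi> 1 * cis (- (?\<rho> * r)) + wave_coeff t x \<xi> (- 1) * cis (?\<rho> * r)"
    unfolding c1 c2 wave_coeff_def by (simp add: diff_divide_distrib)
  finally show ?thesis unfolding wave_integrand_ft_def by (simp add: mult.assoc)
qed

lemma norm_cis_diff: "(norm (cis a - cis b))\<^sup>2 = 2 - 2 * cos (a - b)"
proof -
  have "(norm (cis a - cis b))\<^sup>2 = ((cos a)\<^sup>2 + (sin a)\<^sup>2) + ((cos b)\<^sup>2 + (sin b)\<^sup>2) - 2 * (cos a * cos b + sin a * sin b)"
    by (simp add: cmod_power2 power2_diff algebra_simps)
  then show ?thesis by (simp add: cos_diff)
qed

text \<open>Each square is \<open>(2 - 2 cos)\<close> of a phase difference; the phases \<open>\<plusminus>\<rho>(t - s) - \<xi> \<bullet> (x - y)\<close> of the two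
  components add up to a product of cosines.\<close>

lemma wave_coeff_diff:
  assumes "\<xi> \<noteq> 0"
  shows "(norm (wave_coeff t x \<xi> 1 - wave_coeff s y \<xi> 1))\<^sup>2 + (norm (wave_coeff t x \<xi> (- 1) - wave_coeff s y \<xi> (- 1)))\<^sup>2
    = (1 - cos (\<xi> \<bullet> (x - y)) * cos (norm \<xi> * (t - s))) / (norm \<xi>)\<^sup>2"
proof -
  let ?\<rho> = "norm \<xi>" let ?\<theta> = "\<xi> \<bullet> (x - y)" let ?\<phi> = "norm \<xi> * (t - s)"
  have n: "(norm (wave_coeff t x \<xi> \<sigma> - wave_coeff s y \<xi> \<sigma>))\<^sup>2 = (2 - 2 * cos (\<sigma> * ?\<phi> - ?\<theta>)) / (4 * ?\<rho>\<^sup>2)"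
    if "\<bar>\<sigma>\<bar> = 1" for \<sigma>
  proof -
    have "wave_coeff t x \<xi> \<sigma> - wave_coeff s y \<xi> \<sigma> =
        complex_of_real \<sigma> * (cis (\<sigma> * (?\<rho> * t) - \<xi> \<bullet> x) - cis (\<sigma> * (?\<rho> * s) - \<xi> \<bullet> y)) / (2 * \<i> * complex_of_real ?\<rho>)"
      by (simp add: wave_coeff_def right_diff_distrib diff_divide_distrib)
    then have "(norm (wave_coeff t x \<xi> \<sigma> - wave_coeff s y \<xi> \<sigma>))\<^sup>2 =
        (norm (cis (\<sigma> * (?\<rho> * t) - \<xi> \<bullet> x) - cis (\<sigma> * (?\<rho> * s) - \<xi> \<bullet> y)))\<^sup>2 / (4 * ?\<rho>\<^sup>2)"
      using that by (simp add: norm_mult norm_divide power_divide power_mult_distrib)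
    also have "\<dots> = (2 - 2 * cos (\<sigma> * ?\<phi> - ?\<theta>)) / (4 * ?\<rho>\<^sup>2)"
      unfolding norm_cis_diff by (simp add: algebra_simps inner_diff_right)
    finally show ?thesis .
  qed
  have "(2 - 2 * cos (1 * b - a)) + (2 - 2 * cos (- 1 * b - a)) = 4 * (1 - cos a * cos b)" for a b :: real
    by (simp add: cos_diff algebra_simps)
  from this[of ?\<phi> ?\<theta>]
  have "(norm (wave_coeff t x \<xi> 1 - wave_coeff s y \<xi> 1))\<^sup>2 + (norm (wave_coeff t x \<xi> (- 1) - wave_coeff s y \<xi> (- 1)))\<^sup>2
     = 4 * (1 - cos ?\<theta> * cos ?\<phi>) / (4 * ?\<rho>\<^sup>2)"
    using n[of 1] n[of "- 1"] unfolding \<open>_ = 4 * (1 - cos ?\<theta> * cos ?\<phi>)\<close>[symmetric]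
    by (simp only: add_divide_distrib)
  moreover have "4 * a / (4 * b) = a / b" for a b :: real by simp
  ultimately show ?thesis by (simp only:)
qed

lemma defect_le:
  fixes \<theta> \<phi> z :: real
  assumes "\<bar>\<theta>\<bar> \<le> z" "\<bar>\<phi>\<bar> \<le> z"
  shows "1 - cos \<theta> * cos \<phi> \<le> 2 * min 1 (z\<^sup>2)"
proof -
  have half: "1 - cos u \<le> u\<^sup>2 / 2" for u :: real
  proof -
    have "1 - cos u = 2 * (sin (u / 2))\<^sup>2" using cos_double_sin[of "u / 2"] by simp
    also have "(sin (u / 2))\<^sup>2 \<le> (u / 2)\<^sup>2"
      by (subst abs_le_square_iff[symmetric]) (rule abs_sin_x_le_abs_x)
    finally show ?thesis by (simp add: power_divide)
  qed
  have c1: "\<bar>cos \<theta> * cos \<phi>\<bar> \<le> 1 * 1" unfolding abs_mult by (intro mult_mono) auto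
  have "1 - cos \<theta> * cos \<phi> = (1 - cos \<theta>) + cos \<theta> * (1 - cos \<phi>)" by (simp add: algebra_simps)
  also have "cos \<theta> * (1 - cos \<phi>) \<le> 1 * (1 - cos \<phi>)" by (intro mult_right_mono) auto
  also have "(1 - cos \<theta>) + 1 * (1 - cos \<phi>) \<le> \<theta>\<^sup>2 / 2 + \<phi>\<^sup>2 / 2" using half[of \<theta>] half[of \<phi>] by simp
  also have "\<dots> \<le> z\<^sup>2 / 2 + z\<^sup>2 / 2"
    using assms power_mono[of "\<bar>\<theta>\<bar>" z 2] power_mono[of "\<bar>\<phi>\<bar>" z 2] by simp
  finally have "1 - cos \<theta> * cos \<phi> \<le> z\<^sup>2" by simp
  then show ?thesis using c1 zero_le_power2[of z] by (auto simp: min_def)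
qed

lemma norm_wave_integrand_le:
  assumes "0 \<le> t"
  shows "norm (wave_integrand_ft t x r \<xi>) \<le> \<bar>t - r\<bar> * indicator {0..t} r"
proof -
  have "norm (wave_kernel_ft (t - r) (- \<xi>)) \<le> \<bar>t - r\<bar>"
  proof (cases "\<xi> = 0")
    case False
    have "\<bar>sin ((t - r) * norm \<xi>)\<bar> \<le> \<bar>t - r\<bar> * norm \<xi>"
      using abs_sin_x_le_abs_x[of "(t - r) * norm \<xi>"] by (simp add: abs_mult)
    then show ?thesis using False by (simp add: wave_kernel_ft_def norm_divide divide_le_eq)
  qed (simp add: wave_kernel_ft_def)
  then show ?thesis
    by (auto simp: wave_integrand_ft_def norm_mult indicator_def)
qed

lemma wave_integrand_measurable [measurable]:
  "(\<lambda>(r, \<xi>). wave_integrand_ft t x r \<xi>) \<in> borel_measurable (borel \<Otimes>\<^sub>M borel)"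
  unfolding wave_integrand_ft_def wave_kernel_ft_def by measurable

lemma pulse_wave_integrand:
  assumes "0 \<le> t"
  shows "pulse (\<lambda>r. wave_integrand_ft t x r \<xi>)"
  unfolding pulse_def
proof (intro conjI exI allI)
  show "(\<lambda>r. wave_integrand_ft t x r \<xi>) \<in> borel_measurable borel"
    by (rule measurable_compose[OF _ wave_integrand_measurable[of t x], of "\<lambda>r. (r, \<xi>)", simplified]) measurable
  show "norm (wave_integrand_ft t x r \<xi>) \<le> t * indicator {0..t} r" for r
    using norm_wave_integrand_le[OF assms, of x r \<xi>] by (auto simp: indicator_def split: if_splits)
qed

lemma pulse_wave_diff: "0 \<le> t \<Longrightarrow> 0 \<le> s \<Longrightarrow> pulse (\<lambda>r. wave_diff t x s y r \<xi>)"
  unfolding wave_diff_def by (intro pulse_diff pulse_wave_integrand)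

lemma powr_over_square:
  "0 < \<rho> \<Longrightarrow> \<rho> powr (1 - 2*H) / \<rho>\<^sup>2 = \<rho> powr (- 1 - 2*H)" for \<rho> :: real
  using powr_add[of \<rho> "- 1 - 2*H" 2] by (simp add: field_simps)

text \<open>Before \<open>t\<^sub>0\<close> both kernels are active, so their difference is a sum of two exponentials.\<close>

lemma wave_energy_lower:
  assumes H: "1/2 < H" "H < 1" and t0: "0 < t\<^sub>0"
  shows "\<exists>c>0. \<exists>K>0. \<forall>t s x y. \<forall>\<xi>::real^'n. t\<^sub>0 \<le> t \<longrightarrow> t\<^sub>0 \<le> s \<longrightarrow> K \<le> norm \<xi> \<longrightarrow>
    c * norm \<xi> powr (- 1 - 2*H) * (1 - cos (\<xi> \<bullet> (x - y)) * cos (norm \<xi> * (t - s))) \<le> energy H (\<lambda>r. wave_diff t x s y r \<xi>)"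
proof (rule energy_exponential_ge[OF H t0])
  fix c K :: real assume c: "0 < c" and K: "0 < K"
    and bd: "\<And>h A B \<rho>. pulse h \<Longrightarrow> K \<le> \<rho> \<Longrightarrow>
      (\<And>r. 0 < r \<Longrightarrow> r < t\<^sub>0 \<Longrightarrow> h r = A * cis (- (\<rho> * r)) + B * cis (\<rho> * r)) \<Longrightarrow>
      c * \<rho> powr (1 - 2*H) * ((norm A)\<^sup>2 + (norm B)\<^sup>2) \<le> energy H h"
  have "c * norm \<xi> powr (- 1 - 2*H) * (1 - cos (\<xi> \<bullet> (x - y)) * cos (norm \<xi> * (t - s))) \<le> energy H (\<lambda>r. wave_diff t x s y r \<xi>)"
    if ts: "t\<^sub>0 \<le> t" "t\<^sub>0 \<le> s" and \<xi>: "K \<le> norm \<xi>" for t s x y and \<xi> :: "real^'n"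
  proof -
    have \<xi>0: "\<xi> \<noteq> 0" using \<xi> K by auto
    let ?A = "wave_coeff t x \<xi> 1 - wave_coeff s y \<xi> 1" and ?B = "wave_coeff t x \<xi> (- 1) - wave_coeff s y \<xi> (- 1)"
    have "c * norm \<xi> powr (1 - 2*H) * ((norm ?A)\<^sup>2 + (norm ?B)\<^sup>2) \<le> energy H (\<lambda>r. wave_diff t x s y r \<xi>)"
    proof (rule bd[OF _ \<xi>])
      show "pulse (\<lambda>r. wave_diff t x s y r \<xi>)" using ts t0 by (intro pulse_wave_diff) auto
      show "wave_diff t x s y r \<xi> = ?A * cis (- (norm \<xi> * r)) + ?B * cis (norm \<xi> * r)" if "0 < r" "r < t\<^sub>0" for r
        using that ts by (simp add: wave_diff_def wave_integrand_exponential[OF \<xi>0] algebra_simps)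
    qed
    moreover have "norm \<xi> powr (1 - 2*H) / (norm \<xi>)\<^sup>2 = norm \<xi> powr (- 1 - 2*H)"
      using \<xi>0 by (intro powr_over_square) simp
    moreover have "c * a * (D / b) = c * (a / b) * D" for a b D :: real by simp
    ultimately show ?thesis
      unfolding wave_coeff_diff[OF \<xi>0] by (simp only:)
  qed
  then show ?thesis using c K by blast
qed

text \<open>For \<open>s \<le> t\<close> the profile splits into a sum of two exponentials on \<open>(0,s]\<close>, small because of the phase
  defect, and the later kernel alone on \<open>(s,t]\<close>. The second part is short: if
  \<open>\<rho> * (t - s) \<ge> 1\<close>, the oscillatory bound applies, and otherwise the kernel is at most \<open>t - s\<close> there.\<close>

lemma wave_energy_upper:
  assumes H: "1/2 < H" "H < 1" and T: "0 < T"
  shows "\<exists>C>0. \<forall>t s x y L. \<forall>\<xi>::real^'n. 0 \<le> t \<longrightarrow> t \<le> T \<longrightarrow> 0 \<le> s \<longrightarrow> s \<le> T \<longrightarrow>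
    \<bar>t - s\<bar> \<le> L \<longrightarrow> norm (x - y) \<le> L \<longrightarrow> \<xi> \<noteq> 0 \<longrightarrow>
    energy H (\<lambda>r. wave_diff t x s y r \<xi>) \<le> C * (min 1 ((L * norm \<xi>)\<^sup>2) * norm \<xi> powr (- 1 - 2*H))"
proof -
  define p where "p = 2*H - 1"
  define C0 where "C0 = 4 * (1 / p + 6)"
  have p: "0 < p" using H by (simp add: p_def)
  have C0: "0 < C0" using p by (simp add: C0_def add_pos_pos)
  define C1 where "C1 = max (C0 * T) (2 / p * T)"
  define C where "C = 2 * (4 * C0 * T) + 2 * C1"
  have C1: "0 < C1" using C0 T by (simp add: C1_def less_max_iff_disj)
  have C: "0 < C" using C0 C1 T by (simp add: C_def add_pos_pos)
  have ordered: "energy H (\<lambda>r. wave_diff t x s y r \<xi>) \<le> C * (min 1 ((L * norm \<xi>)\<^sup>2) * norm \<xi> powr (- 1 - 2*H))"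
    if st: "0 \<le> s" "s \<le> t" "t \<le> T" and L: "t - s \<le> L" "norm (x - y) \<le> L" and \<xi>: "\<xi> \<noteq> 0"
    for t s L x y and \<xi> :: "real^'n"
  proof -
    let ?\<rho> = "norm \<xi>"
    let ?m = "min 1 ((L * ?\<rho>)\<^sup>2)"
    have \<rho>: "0 < ?\<rho>" using \<xi> by simp
    have pw: "?\<rho> powr (1 - 2*H) / ?\<rho>\<^sup>2 = ?\<rho> powr (- 1 - 2*H)"
      using \<rho> by (rule powr_over_square)
    let ?A = "wave_coeff t x \<xi> 1 - wave_coeff s y \<xi> 1" and ?B = "wave_coeff t x \<xi> (- 1) - wave_coeff s y \<xi> (- 1)"
    define h1 where "h1 = (\<lambda>r. indicator {0<..s} r * (?A * cis (- (?\<rho> * r)) + ?B * cis (?\<rho> * r)))"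
    define h2 where "h2 = (\<lambda>r. indicator {s<..t} r * (wave_coeff t x \<xi> 1 * cis (- (?\<rho> * r)) + wave_coeff t x \<xi> (- 1) * cis (?\<rho> * r)))"
    have split: "wave_diff t x s y r \<xi> = h1 r + h2 r" if "0 < r" for r
      using that st by (auto simp: wave_diff_def h1_def h2_def wave_integrand_exponential[OF \<xi>] indicator_def algebra_simps)
    have pulse_exp: "pulse (\<lambda>r. indicator {a<..b} r * (A * cis (- (?\<rho> * r)) + B * cis (?\<rho> * r)))" if "0 \<le> a" for a b A B
      unfolding pulse_def
    proof (intro conjI exI allI)
      show "norm (indicator {a<..b} r * (A * cis (- (?\<rho> * r)) + B * cis (?\<rho> * r))) \<le> (norm A + norm B) * indicator {0..b} r" for r
        using that norm_triangle_ineq[of "A * cis (- (?\<rho> * r))" "B * cis (?\<rho> * r)"]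
        by (auto simp: norm_mult indicator_def)
    qed measurable
    have "energy H (\<lambda>r. wave_diff t x s y r \<xi>) = energy H (\<lambda>r. h1 r + h2 r)"
      by (rule energy_cong) (rule split)
    also have "\<dots> \<le> 2 * energy H h1 + 2 * energy H h2"
      using st unfolding h1_def h2_def by (intro energy_add_le H pulse_exp) auto
    finally have sum: "energy H (\<lambda>r. wave_diff t x s y r \<xi>) \<le> 2 * energy H h1 + 2 * energy H h2" .
    have e1: "energy H h1 \<le> 4 * C0 * T * (?m * ?\<rho> powr (- 1 - 2*H))"
    proof -
      have "(norm ?A + norm ?B)\<^sup>2 \<le> 2 * ((norm ?A)\<^sup>2 + (norm ?B)\<^sup>2)"
        using sum_squares_bound[of "norm ?A" "norm ?B"] by (simp add: power2_sum)
      also have "\<dots> = 2 * ((1 - cos (\<xi> \<bullet> (x - y)) * cos (?\<rho> * (t - s))) / ?\<rho>\<^sup>2)"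
        unfolding wave_coeff_diff[OF \<xi>] ..
      also have "\<dots> \<le> 2 * ((2 * ?m) / ?\<rho>\<^sup>2)"
      proof (intro mult_left_mono divide_right_mono defect_le)
        show "\<bar>\<xi> \<bullet> (x - y)\<bar> \<le> L * ?\<rho>"
          using Cauchy_Schwarz_ineq2[of \<xi> "x - y"] mult_left_mono[OF L(2), of ?\<rho>] by (simp add: mult.commute)
        show "\<bar>?\<rho> * (t - s)\<bar> \<le> L * ?\<rho>"
          using mult_left_mono[OF L(1), of ?\<rho>] st by (simp add: abs_mult mult.commute)
      qed auto
      finally have sq: "(norm ?A + norm ?B)\<^sup>2 \<le> 2 * ((2 * ?m) / ?\<rho>\<^sup>2)" .
      have "energy H h1 \<le> C0 * (s - 0) * ?\<rho> powr (1 - 2*H) * (norm ?A + norm ?B)\<^sup>2"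
        unfolding C0_def p_def by (rule energy_exponential_le[OF H _ _ \<rho>]) (use st in \<open>auto simp: h1_def\<close>)
      also have "\<dots> \<le> C0 * (s - 0) * ?\<rho> powr (1 - 2*H) * (2 * ((2 * ?m) / ?\<rho>\<^sup>2))"
        using C0 st by (intro mult_left_mono[OF sq]) auto
      also have "\<dots> = s * (4 * C0 * (?m * (?\<rho> powr (1 - 2*H) / ?\<rho>\<^sup>2)))" by simp
      also have "\<dots> \<le> T * (4 * C0 * (?m * (?\<rho> powr (1 - 2*H) / ?\<rho>\<^sup>2)))"
        using st C0 by (intro mult_right_mono mult_nonneg_nonneg) auto
      finally show ?thesis unfolding pw by (simp add: mult_ac)
    qed
    have e2: "energy H h2 \<le> C1 * (?m * ?\<rho> powr (- 1 - 2*H))"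
    proof (cases "1 \<le> (t - s) * ?\<rho>")
      case True
      then have "1 \<le> L * ?\<rho>" using mult_right_mono[OF L(1), of ?\<rho>] by simp
      then have "1 \<le> (L * ?\<rho>)\<^sup>2" by (rule one_le_power)
      then have m1: "?m = 1" by simp
      have nc: "norm (wave_coeff t x \<xi> \<sigma>) = 1 / (2 * ?\<rho>)" if "\<bar>\<sigma>\<bar> = 1" for \<sigma>
        using that by (simp add: wave_coeff_def norm_mult norm_divide)
      have "energy H h2 \<le> C0 * (t - s) * ?\<rho> powr (1 - 2*H) * (norm (wave_coeff t x \<xi> 1) + norm (wave_coeff t x \<xi> (- 1)))\<^sup>2"
        unfolding C0_def p_def by (rule energy_exponential_le[OF H _ _ \<rho>]) (use st in \<open>auto simp: h2_def\<close>)
      also have "(norm (wave_coeff t x \<xi> 1) + norm (wave_coeff t x \<xi> (- 1)))\<^sup>2 = 1 / ?\<rho>\<^sup>2"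
        by (simp add: nc power_divide)
      also have "C0 * (t - s) * ?\<rho> powr (1 - 2*H) * (1 / ?\<rho>\<^sup>2) = C0 * (t - s) * ?\<rho> powr (- 1 - 2*H)"
        unfolding pw[symmetric] by simp
      also have "\<dots> \<le> C1 * ?\<rho> powr (- 1 - 2*H)"
      proof (rule mult_right_mono)
        have "C0 * (t - s) \<le> C0 * T" using C0 st by (intro mult_left_mono) auto
        then show "C0 * (t - s) \<le> C1" by (simp add: C1_def)
      qed simp
      finally show ?thesis by (simp add: m1)
    next
      case False
      let ?d = "t - s"
      have h2n: "norm (h2 r) \<le> ?d * indicator {s<..t} r" for r
      proof (cases "s < r \<and> r \<le> t")
        case True
        have "h2 r = wave_integrand_ft t x r \<xi>"
          using True st by (simp add: h2_def wave_integrand_exponential[OF \<xi>])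
        then show ?thesis using norm_wave_integrand_le[of t x r \<xi>] True st by simp
      qed (auto simp: h2_def)
      have "energy H h2 \<le> 2 / (2*H - 1) * ?d\<^sup>2 * ?d powr (2*H)"
        using st h2n by (intro energy_le_of_bounded H) auto
      also have "\<dots> \<le> 2 / p * T * (?m * ?\<rho> powr (- 1 - 2*H))"
      proof (cases "?d = 0")
        case True
        then show ?thesis using p T by simp
      next
        case d0: False
        then have d: "0 < ?d" using st by simp
        have "?d powr (2*H - 1) \<le> ?\<rho> powr (1 - 2*H)"
        proof -
          have "?\<rho> \<le> 1 / ?d" using False d by (simp add: pos_le_divide_eq mult.commute)
          then have "(1 / ?d) powr (1 - 2*H) \<le> ?\<rho> powr (1 - 2*H)"
            using \<rho> H by (intro powr_mono2') auto
          moreover have "(1 / ?d) powr (1 - 2*H) = ?d powr (2*H - 1)"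
            using d by (simp add: powr_divide powr_minus_divide[symmetric])
          ultimately show ?thesis by simp
        qed
        moreover have "?d powr (2*H) = ?d * ?d powr (2*H - 1)"
          using d powr_mult_base[of ?d "2*H - 1"] by simp
        moreover have "?d * ?d powr (2*H - 1) \<le> T * ?d powr (2*H - 1)"
          using st by (intro mult_right_mono) auto
        ultimately have "?d powr (2*H) \<le> T * ?\<rho> powr (1 - 2*H)"
          using mult_left_mono[of "?d powr (2*H - 1)" "?\<rho> powr (1 - 2*H)" T] T by linarith
        then have "?d\<^sup>2 * ?d powr (2*H) \<le> ?d\<^sup>2 * (T * ?\<rho> powr (1 - 2*H))"
          by (intro mult_left_mono) auto
        also have "\<dots> = T * ((?d * ?\<rho>)\<^sup>2 * (?\<rho> powr (1 - 2*H) / ?\<rho>\<^sup>2))"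
          using \<rho> by (simp add: power_mult_distrib)
        also have "\<dots> \<le> T * (?m * (?\<rho> powr (1 - 2*H) / ?\<rho>\<^sup>2))"
        proof (intro mult_left_mono mult_right_mono)
          have "(?d * ?\<rho>)\<^sup>2 \<le> 1\<^sup>2" using False d \<rho> by (intro power_mono) auto
          moreover have "(?d * ?\<rho>)\<^sup>2 \<le> (L * ?\<rho>)\<^sup>2" using L(1) d \<rho> by (intro power_mono mult_right_mono) auto
          ultimately show "(?d * ?\<rho>)\<^sup>2 \<le> ?m" by simp
        qed (use T in auto)
        finally have "?d\<^sup>2 * ?d powr (2*H) \<le> T * (?m * ?\<rho> powr (- 1 - 2*H))" unfolding pw .
        then have "2 / p * (?d\<^sup>2 * ?d powr (2*H)) \<le> 2 / p * (T * (?m * ?\<rho> powr (- 1 - 2*H)))"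
          using p by (intro mult_left_mono) auto
        then show ?thesis by (simp add: p_def mult.assoc)
      qed
      also have "\<dots> \<le> C1 * (?m * ?\<rho> powr (- 1 - 2*H))"
        by (intro mult_right_mono) (auto simp: C1_def)
      finally show ?thesis .
    qed
    show ?thesis
      using sum e1 e2 by (simp add: C_def distrib_right)
  qed
  have "energy H (\<lambda>r. wave_diff t x s y r \<xi>) \<le> C * (min 1 ((L * norm \<xi>)\<^sup>2) * norm \<xi> powr (- 1 - 2*H))"
    if "0 \<le> t" "t \<le> T" "0 \<le> s" "s \<le> T" "\<bar>t - s\<bar> \<le> L" "norm (x - y) \<le> L" "\<xi> \<noteq> 0"
    for t s L x y and \<xi> :: "real^'n"
  proof (cases "s \<le> t")
    case True
    then show ?thesis using that by (intro ordered) auto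
  next
    case False
    have "energy H (\<lambda>r. wave_diff t x s y r \<xi>) = energy H (\<lambda>r. (- 1) * wave_diff s y t x r \<xi>)"
      by (simp add: wave_diff_def)
    also have "\<dots> = energy H (\<lambda>r. wave_diff s y t x r \<xi>)" by (subst energy_cmult) simp
    also have "\<dots> \<le> C * (min 1 ((L * norm \<xi>)\<^sup>2) * norm \<xi> powr (- 1 - 2*H))"
      using False that by (intro ordered) (auto simp: norm_minus_commute)
    finally show ?thesis .
  qed
  then show ?thesis using C by blast
qed

section \<open>Elementary integrands\<close>

lemma riesz_measure_sets [simp, measurable_cong]: "sets (riesz_measure \<beta>) = sets borel"
  by (simp add: riesz_measure_def)

lemma sigma_finite_riesz_measure: "sigma_finite_measure (riesz_measure \<beta>)"
  unfolding riesz_measure_def by (subst sigma_finite_measure.sigma_finite_iff_density_finite[OF sigma_finite_lborel]) auto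

lemma fourier_ind_integrable:
  fixes A :: "(real^'n) set"
  assumes "A \<in> sets borel" "bounded A"
  shows "integrable lborel (\<lambda>x. exp (- (\<i> * complex_of_real (\<xi> \<bullet> x))) * complex_of_real (indicator A x))"
proof (rule Bochner_Integration.integrable_bound[OF indicator_integrable_bounded[OF assms]])
  show "(\<lambda>x. exp (- (\<i> * complex_of_real (\<xi> \<bullet> x))) * complex_of_real (indicator A x)) \<in> borel_measurable lborel"
    using assms(1) by measurable
qed (auto simp: norm_mult)

lemma fourier_elementary:
  fixes S :: "(real \<times> (real^'n) set) set"
  assumes S: "finite S" "S \<subseteq> noise_index"
  shows "fourier (\<lambda>x. complex_of_real (elementary_fun S c r x)) \<xi> =
    (\<Sum>p\<in>S. complex_of_real (c p) * (indicator {0..fst p} r * fourier_ind (snd p) \<xi>))"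
proof -
  have "exp (- (\<i> * complex_of_real (\<xi> \<bullet> x))) * complex_of_real (elementary_fun S c r x) =
      (\<Sum>p\<in>S. complex_of_real (c p) * (indicator {0..fst p} r *
         (exp (- (\<i> * complex_of_real (\<xi> \<bullet> x))) * complex_of_real (indicator (snd p) x))))" for x
    unfolding elementary_fun_def of_real_sum sum_distrib_left
    by (intro sum.cong refl) (auto simp: case_prod_beta indicator_def)
  moreover have "integrable lborel (\<lambda>x. complex_of_real (c p) * (indicator {0..fst p} r *
         (exp (- (\<i> * complex_of_real (\<xi> \<bullet> x))) * complex_of_real (indicator (snd p) x))))" if "p \<in> S" for p
    using that S by (intro integrable_mult_right fourier_ind_integrable) (auto simp: noise_index_def)
  ultimately show ?thesis
    unfolding fourier_def by (simp only: Bochner_Integration.integral_sum integral_mult_right_zero)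
qed

text \<open>The spatial Fourier transform of \<open>elementary_fun\<close>, in closed form.\<close>

definition elementary_ft ::
    "(real \<times> (real^'n) set) set \<Rightarrow> (real \<times> (real^'n) set \<Rightarrow> real) \<Rightarrow> real \<Rightarrow> real^'n \<Rightarrow> complex" where
  "elementary_ft S c r \<xi> = (\<Sum>p\<in>S. complex_of_real (c p) * (indicator {0..fst p} r * fourier_ind (snd p) \<xi>))"

lemma pulse_sum: "finite S \<Longrightarrow> (\<And>p. p \<in> S \<Longrightarrow> pulse (f p)) \<Longrightarrow> pulse (\<lambda>r. \<Sum>p\<in>S. f p r)"
proof (induction S rule: finite_induct)
  case empty
  have "pulse (\<lambda>r. 0)" unfolding pulse_def by (auto intro!: exI[of _ 0])
  then show ?case by simp
next
  case (insert x S)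
  then show ?case by (simp add: pulse_add)
qed

lemma pulse_elementary_ft:
  assumes "finite S" shows "pulse (\<lambda>r. elementary_ft S c r \<xi>)"
  unfolding elementary_ft_def
proof (rule pulse_sum[OF assms])
  fix p :: "real \<times> (real^'a) set"
  have "pulse (\<lambda>r. indicator {0..fst p} r :: complex)"
  proof -
    have "\<forall>r. norm (indicator {0..fst p} r :: complex) \<le> 1 * indicator {0..fst p} r"
      by (simp add: indicator_def)
    moreover have "(\<lambda>r. indicator {0..fst p} r :: complex) \<in> borel_measurable borel" by measurable
    ultimately show ?thesis unfolding pulse_def by blast
  qed
  from pulse_cmult[OF this, of "complex_of_real (c p) * fourier_ind (snd p) \<xi>"]
  show "pulse (\<lambda>r. complex_of_real (c p) * (indicator {0..fst p} r * fourier_ind (snd p) \<xi>))"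
    by (simp add: mult_ac)
qed

lemma hp_density_elementary:
  fixes S :: "(real \<times> (real^'n) set) set" and \<xi> :: "real^'n"
  assumes H: "1/2 < H" "H < 1" and S: "finite S" "S \<subseteq> noise_index"
  shows "hp_density H (elementary_ft S c) (elementary_ft S c) \<xi> =
    (\<Sum>p\<in>S. \<Sum>q\<in>S. complex_of_real (c p * c q * (fbm_cov H (fst p) (fst q) / (H * (2*H - 1)))) *
        (fourier_ind (snd p) \<xi> * cnj (fourier_ind (snd q) \<xi>)))"
proof -
  define k where "k p q r v = indicator {0..fst p} r * indicator {0..fst q} v * \<bar>r - v\<bar> powr (2*H - 2)"
    for p q :: "real \<times> (real^'n) set" and r v :: real
  define a where "a p q = complex_of_real (c p * c q) * (fourier_ind (snd p) \<xi> * cnj (fourier_ind (snd q) \<xi>))" for p q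
  have k1: "integrable lborel (\<lambda>r. indicator {0<..} r *\<^sub>R (a p q * complex_of_real (k p q r v)))"
    and k2: "integrable lborel (\<lambda>v. indicator {0<..} v *\<^sub>R (a p q * complex_of_real (LINT r:{0<..}|lborel. k p q r v)))"
    and k3: "(LINT v:{0<..}|lborel. LINT r:{0<..}|lborel. k p q r v) = fbm_cov H (fst p) (fst q) / (H * (2*H - 1))"
    if "p \<in> S" "q \<in> S" for p q v
  proof -
    have "0 \<le> fst p" "0 \<le> fst q" using that S by (auto simp: noise_index_def)
    note f = fbm_cov_eq_integral[OF H(1) this, folded k_def]
    show "(LINT v:{0<..}|lborel. LINT r:{0<..}|lborel. k p q r v) = fbm_cov H (fst p) (fst q) / (H * (2*H - 1))"
      by (rule f(1))
    show "integrable lborel (\<lambda>r. indicator {0<..} r *\<^sub>R (a p q * complex_of_real (k p q r v)))"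
      using integrable_mult_right[OF integrable_of_real[OF f(2)[unfolded set_integrable_def]], of "a p q" v]
      by (simp add: scaleR_conv_of_real mult_ac)
    show "integrable lborel (\<lambda>v. indicator {0<..} v *\<^sub>R (a p q * complex_of_real (LINT r:{0<..}|lborel. k p q r v)))"
      using integrable_mult_right[OF integrable_of_real[OF f(3)[unfolded set_integrable_def]], of "a p q"]
      by (simp add: scaleR_conv_of_real mult_ac)
  qed
  have pt: "elementary_ft S c r \<xi> * cnj (elementary_ft S c v \<xi>) * complex_of_real (\<bar>r - v\<bar> powr (2*H - 2)) =
      (\<Sum>p\<in>S. \<Sum>q\<in>S. a p q * complex_of_real (k p q r v))" for r v
    unfolding elementary_ft_def cnj_sum sum_product
    by (unfold sum_distrib_right, intro sum.cong refl) (auto simp: a_def k_def indicator_def)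
  have inner: "(LINT r:{0<..}|lborel. elementary_ft S c r \<xi> * cnj (elementary_ft S c v \<xi>) * complex_of_real (\<bar>r - v\<bar> powr (2*H - 2))) =
      (\<Sum>p\<in>S. \<Sum>q\<in>S. a p q * complex_of_real (LINT r:{0<..}|lborel. k p q r v))" for v
  proof -
    have "(LINT r|lborel. indicator {0<..} r *\<^sub>R (a p q * complex_of_real (k p q r v))) = a p q * complex_of_real (LINT r:{0<..}|lborel. k p q r v)" for p q
    proof -
      have "(LINT r|lborel. indicator {0<..} r *\<^sub>R (a p q * complex_of_real (k p q r v))) = (LINT r|lborel. a p q * complex_of_real (indicator {0<..} r *\<^sub>R k p q r v))"
        by (intro Bochner_Integration.integral_cong refl) (simp add: scaleR_conv_of_real mult_ac)
      then show ?thesis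
        by (simp only: integral_mult_right_zero integral_complex_of_real set_lebesgue_integral_def)
    qed
    then show ?thesis
      unfolding pt set_lebesgue_integral_def[of _ _ "\<lambda>r. \<Sum>p\<in>S. \<Sum>q\<in>S. a p q * complex_of_real (k p q r v)"] scaleR_sum_right
      using k1 by (simp add: Bochner_Integration.integral_sum Bochner_Integration.integrable_sum)
  qed
  have "(LINT v|lborel. indicator {0<..} v *\<^sub>R (a p q * complex_of_real (LINT r:{0<..}|lborel. k p q r v))) =
      a p q * complex_of_real (LINT v:{0<..}|lborel. LINT r:{0<..}|lborel. k p q r v)" for p q
  proof -
    have "(LINT v|lborel. indicator {0<..} v *\<^sub>R (a p q * complex_of_real (LINT r:{0<..}|lborel. k p q r v))) =
       (LINT v|lborel. a p q * complex_of_real (indicator {0<..} v *\<^sub>R (LINT r:{0<..}|lborel. k p q r v)))"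
      by (intro Bochner_Integration.integral_cong refl) (simp add: scaleR_conv_of_real mult_ac)
    then show ?thesis
      by (simp only: integral_mult_right_zero integral_complex_of_real set_lebesgue_integral_def[of _ _ "\<lambda>v. LINT r:{0<..}|lborel. k p q r v"])
  qed
  then have "hp_density H (elementary_ft S c) (elementary_ft S c) \<xi> =
      (\<Sum>p\<in>S. \<Sum>q\<in>S. a p q * complex_of_real (LINT v:{0<..}|lborel. LINT r:{0<..}|lborel. k p q r v))"
    unfolding hp_density_def inner set_lebesgue_integral_def[of _ _ "\<lambda>v. \<Sum>p\<in>S. \<Sum>q\<in>S. a p q * complex_of_real (LINT r:{0<..}|lborel. k p q r v)"] scaleR_sum_right
    using k2 by (simp add: Bochner_Integration.integral_sum Bochner_Integration.integrable_sum)
  also have "\<dots> = (\<Sum>p\<in>S. \<Sum>q\<in>S. complex_of_real (c p * c q * (fbm_cov H (fst p) (fst q) / (H * (2*H - 1)))) *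
        (fourier_ind (snd p) \<xi> * cnj (fourier_ind (snd q) \<xi>)))"
    by (intro sum.cong refl) (simp add: k3 a_def mult_ac)
  finally show ?thesis .
qed

lemma centered_gaussian_square_integrable:
  assumes "centered_gaussian_rv P X"
  shows "integrable P (\<lambda>\<omega>. (X \<omega>)\<^sup>2)"
proof -
  have [measurable]: "X \<in> borel_measurable P" using assms by (simp add: centered_gaussian_rv_def)
  from assms consider "AE \<omega> in P. X \<omega> = 0" | \<sigma> where "0 < \<sigma>" "distributed P lborel X (normal_density 0 \<sigma>)"
    by (auto simp: centered_gaussian_rv_def)
  then show ?thesis
  proof cases
    case 1
    then have "AE \<omega> in P. (X \<omega>)\<^sup>2 = 0" by eventually_elim simp
    then show ?thesis by (subst integrable_cong_AE[where g="\<lambda>_. 0"]) auto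
  next
    case 2
    have "integrable lborel (\<lambda>x. normal_density 0 \<sigma> x * x\<^sup>2)"
      using integrable_normal_moment[of \<sigma> 0 2] 2(1) by simp
    then show ?thesis
      by (subst (asm) distributed_integrable[OF 2(2)]) auto
  qed
qed

lemma square_integrable_mult:
  fixes X Y :: "'a \<Rightarrow> real"
  assumes [measurable]: "X \<in> borel_measurable P" "Y \<in> borel_measurable P"
    and "integrable P (\<lambda>\<omega>. (X \<omega>)\<^sup>2)" "integrable P (\<lambda>\<omega>. (Y \<omega>)\<^sup>2)"
  shows "integrable P (\<lambda>\<omega>. X \<omega> * Y \<omega>)"
proof (rule Bochner_Integration.integrable_bound)
  show "integrable P (\<lambda>\<omega>. (X \<omega>)\<^sup>2 + (Y \<omega>)\<^sup>2)" using assms by simp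
  have "norm (x * y) \<le> norm (x\<^sup>2 + y\<^sup>2)" for x y :: real
  proof -
    have "0 \<le> \<bar>x\<bar> * \<bar>y\<bar>" by simp
    then have "\<bar>x\<bar> * \<bar>y\<bar> \<le> x\<^sup>2 + y\<^sup>2"
      using sum_squares_bound[of "\<bar>x\<bar>" "\<bar>y\<bar>"] unfolding power2_abs by linarith
    then show ?thesis by (simp add: abs_mult)
  qed
  then show "AE \<omega> in P. norm (X \<omega> * Y \<omega>) \<le> norm ((X \<omega>)\<^sup>2 + (Y \<omega>)\<^sup>2)" by (intro AE_I2)
qed measurable

lemma square_integrable_diff:
  fixes X Y :: "'a \<Rightarrow> real"
  assumes "X \<in> borel_measurable P" "Y \<in> borel_measurable P"
    and "integrable P (\<lambda>\<omega>. (X \<omega>)\<^sup>2)" "integrable P (\<lambda>\<omega>. (Y \<omega>)\<^sup>2)"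
  shows "integrable P (\<lambda>\<omega>. (X \<omega> - Y \<omega>)\<^sup>2)"
  using assms square_integrable_mult[OF assms] by (simp add: power2_diff mult.assoc)

text \<open>By bilinearity this is the product of the isometry in time (\<open>fbm_cov_eq_integral\<close>) and the isometry
  in space (\<open>indicator_isometry\<close>) for each pair of terms.\<close>

lemma elementary_isometry:
  fixes f :: "real^'n \<Rightarrow> real"
  assumes H: "1/2 < H" "H < 1"
    and tft: "tempered_fourier_transform (riesz_measure \<beta>) f"
    and W: "fractional_colored_noise P H f W"
    and S: "finite S" "S \<subseteq> noise_index"
  shows "elementary_integral W S c \<in> borel_measurable P"
    and "integrable P (\<lambda>\<omega>. (elementary_integral W S c \<omega>)\<^sup>2)"
    and "integrable (riesz_measure \<beta>) (hp_density H (elementary_ft S c) (elementary_ft S c))"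
    and "complex_of_real (LINT \<omega>|P. (elementary_integral W S c \<omega>)\<^sup>2) = hp_inner H \<beta> (elementary_ft S c) (elementary_ft S c)"
proof -
  let ?X = "\<lambda>p. W (fst p) (snd p)"
  let ?\<alpha> = "H * (2*H - 1)"
  have gauss: "centered_gaussian_rv P (?X p)" if "p \<in> S" for p
  proof -
    have "centered_gaussian_family P noise_index (\<lambda>(t, A). W t A)"
      using W unfolding fractional_colored_noise_def by blast
    then have "centered_gaussian_rv P (\<lambda>\<omega>. \<Sum>j\<in>{p}. 1 * (case j of (t, A) \<Rightarrow> W t A) \<omega>)"
      unfolding centered_gaussian_family_def using that S by (elim allE[of _ "{p}"] allE[of _ "\<lambda>_. 1"]) auto
    then show ?thesis by (simp add: case_prod_beta)
  qed
  have Xm [measurable]: "?X p \<in> borel_measurable P" if "p \<in> S" for p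
    using gauss[OF that] by (simp add: centered_gaussian_rv_def)
  have XX: "integrable P (\<lambda>\<omega>. ?X p \<omega> * ?X q \<omega>)" if "p \<in> S" "q \<in> S" for p q
    using that by (intro square_integrable_mult Xm centered_gaussian_square_integrable gauss)
  have I: "elementary_integral W S c = (\<lambda>\<omega>. \<Sum>p\<in>S. c p * ?X p \<omega>)"
    by (simp add: elementary_integral_def fun_eq_iff case_prod_beta)
  show "elementary_integral W S c \<in> borel_measurable P"
    unfolding I by (intro borel_measurable_sum borel_measurable_times Xm) auto
  have sq: "(elementary_integral W S c \<omega>)\<^sup>2 = (\<Sum>p\<in>S. \<Sum>q\<in>S. (c p * c q) * (?X p \<omega> * ?X q \<omega>))" for \<omega>
    unfolding I power2_eq_square sum_product by (intro sum.cong refl) simp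
  show "integrable P (\<lambda>\<omega>. (elementary_integral W S c \<omega>)\<^sup>2)"
    unfolding sq by (intro Bochner_Integration.integrable_sum integrable_mult_right XX)
  have borel: "snd p \<in> sets borel" "bounded (snd p)" if "p \<in> S" for p
    using that S by (auto simp: noise_index_def)
  note iso = indicator_isometry[OF tft riesz_measure_sets sigma_finite_riesz_measure]
  have dens: "hp_density H (elementary_ft S c) (elementary_ft S c) =
     (\<lambda>\<xi>. \<Sum>p\<in>S. \<Sum>q\<in>S. complex_of_real (c p * c q * (fbm_cov H (fst p) (fst q) / ?\<alpha>)) *
        (fourier_ind (snd p) \<xi> * cnj (fourier_ind (snd q) \<xi>)))"
    using hp_density_elementary[OF H S] by (intro ext)
  show "integrable (riesz_measure \<beta>) (hp_density H (elementary_ft S c) (elementary_ft S c))"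
    unfolding dens by (intro Bochner_Integration.integrable_sum integrable_mult_right iso(1) borel)
  have cov: "(LINT \<omega>|P. ?X p \<omega> * ?X q \<omega>) = fbm_cov H (fst p) (fst q) * (LINT x:snd p|lborel. LINT y:snd q|lborel. f (x - y))"
    if "p \<in> S" "q \<in> S" for p q
  proof -
    have "\<forall>(t, A)\<in>noise_index. \<forall>(s, B)\<in>noise_index.
        (LINT \<omega>|P. W t A \<omega> * W s B \<omega>) = fbm_cov H t s * (LINT x:A|lborel. LINT y:B|lborel. f (x - y))"
      using W unfolding fractional_colored_noise_def by blast
    moreover have "p \<in> noise_index" "q \<in> noise_index" using that S by auto
    ultimately show ?thesis by (auto simp: case_prod_beta)
  qed
  have "complex_of_real (LINT \<omega>|P. (elementary_integral W S c \<omega>)\<^sup>2) =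
     complex_of_real (\<Sum>p\<in>S. \<Sum>q\<in>S. (c p * c q) * (LINT \<omega>|P. ?X p \<omega> * ?X q \<omega>))"
    unfolding sq using XX
    by (simp add: Bochner_Integration.integral_sum Bochner_Integration.integrable_sum integrable_mult_right)
  also have "\<dots> = (\<Sum>p\<in>S. \<Sum>q\<in>S. complex_of_real (c p * c q * fbm_cov H (fst p) (fst q)) *
     (LINT \<xi>|riesz_measure \<beta>. fourier_ind (snd p) \<xi> * cnj (fourier_ind (snd q) \<xi>)))"
    unfolding of_real_sum
    by (intro sum.cong refl) (simp add: cov iso(2)[OF borel borel, symmetric] mult.assoc)
  also have "\<dots> = complex_of_real ?\<alpha> * (\<Sum>p\<in>S. \<Sum>q\<in>S. complex_of_real (c p * c q * (fbm_cov H (fst p) (fst q) / ?\<alpha>)) *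
     (LINT \<xi>|riesz_measure \<beta>. fourier_ind (snd p) \<xi> * cnj (fourier_ind (snd q) \<xi>)))"
    unfolding sum_distrib_left
  proof (intro sum.cong refl)
    fix p q
    have "c p * c q * fbm_cov H (fst p) (fst q) = ?\<alpha> * (c p * c q * (fbm_cov H (fst p) (fst q) / ?\<alpha>))"
      using H by simp
    then show "complex_of_real (c p * c q * fbm_cov H (fst p) (fst q)) * (LINT \<xi>|riesz_measure \<beta>. fourier_ind (snd p) \<xi> * cnj (fourier_ind (snd q) \<xi>)) =
      complex_of_real ?\<alpha> * (complex_of_real (c p * c q * (fbm_cov H (fst p) (fst q) / ?\<alpha>)) * (LINT \<xi>|riesz_measure \<beta>. fourier_ind (snd p) \<xi> * cnj (fourier_ind (snd q) \<xi>)))"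
      by (simp only: of_real_mult mult.assoc)
  qed
  also have "\<dots> = hp_inner H \<beta> (elementary_ft S c) (elementary_ft S c)"
    unfolding hp_inner_def dens using iso(1) borel
    by (simp add: Bochner_Integration.integral_sum Bochner_Integration.integrable_sum integrable_mult_right del: of_real_mult of_real_divide)
  finally show "complex_of_real (LINT \<omega>|P. (elementary_integral W S c \<omega>)\<^sup>2) = hp_inner H \<beta> (elementary_ft S c) (elementary_ft S c)" .
qed


section \<open>From elementary integrands to the solution\<close>

text \<open>Differences of elementary integrands are again elementary, on the union of the index sets.\<close>

lemma union_combination:
  fixes X :: "'i \<Rightarrow> 'b::real_vector" and c c' :: "'i \<Rightarrow> real"
  assumes "finite S" "finite S'"
  defines "d \<equiv> \<lambda>p. (if p \<in> S then c p else 0) - (if p \<in> S' then c' p else 0)"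
  shows "(\<Sum>p\<in>S \<union> S'. d p *\<^sub>R X p) = (\<Sum>p\<in>S. c p *\<^sub>R X p) - (\<Sum>p\<in>S'. c' p *\<^sub>R X p)"
proof -
  have "(\<Sum>p\<in>S \<union> S'. (if p \<in> S then c p else 0) *\<^sub>R X p) = (\<Sum>p\<in>S. c p *\<^sub>R X p)"
    using assms by (intro sum.mono_neutral_cong_right) auto
  moreover have "(\<Sum>p\<in>S \<union> S'. (if p \<in> S' then c' p else 0) *\<^sub>R X p) = (\<Sum>p\<in>S'. c' p *\<^sub>R X p)"
    using assms by (intro sum.mono_neutral_cong_right) auto
  ultimately show ?thesis
    unfolding d_def scaleR_diff_left sum_subtractf by simp
qed

lemma elementary_ft_scaleR: "elementary_ft S c r \<xi> = (\<Sum>p\<in>S. c p *\<^sub>R (indicator {0..fst p} r * fourier_ind (snd p) \<xi>))"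
  by (simp add: elementary_ft_def scaleR_conv_of_real)

lemma hp_density_eq_energy:
  assumes "1/2 < H" "H < 1" "pulse (\<lambda>r. \<Phi> r \<xi>)"
  shows "hp_density H \<Phi> \<Phi> \<xi> = complex_of_real (energy H (\<lambda>r. \<Phi> r \<xi>))"
  using frac_form_eq_energy[OF assms] by (simp add: frac_form_def hp_density_def)

lemma energy_minus: "energy H (\<lambda>r. - h r) = energy H h"
  using energy_cmult[of H "- 1" h] by simp

lemma energy_measurable:
  assumes [measurable]: "(\<lambda>(r, \<xi>). \<Phi> r \<xi>) \<in> borel_measurable (borel \<Otimes>\<^sub>M borel)"
  shows "(\<lambda>\<xi>::real^'n. energy H (\<lambda>r. \<Phi> r \<xi>)) \<in> borel_measurable borel"
  unfolding energy_def frac_form_def set_lebesgue_integral_def by measurable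

lemma wave_diff_measurable:
  "(\<lambda>(r, \<xi>). wave_diff t x s y r \<xi>) \<in> borel_measurable (borel \<Otimes>\<^sub>M borel)"
  unfolding wave_diff_def by measurable

text \<open>Convergence in \<open>hp_tendsto\<close> is convergence to \<open>0\<close> of the integrated energy, since the form is a
  nonnegative real number at every frequency.\<close>

lemma wiener_approximation:
  assumes H: "1/2 < H" "H < 1"
    and X: "is_wiener_integral P H \<beta> W \<Phi> X"
    and pulse: "\<And>\<xi>. pulse (\<lambda>r. \<Phi> r \<xi>)"
  shows "X \<in> borel_measurable P" and "integrable P (\<lambda>\<omega>. (X \<omega>)\<^sup>2)"
    and "\<exists>S c. (\<forall>n::nat. finite (S n) \<and> S n \<subseteq> noise_index) \<and>
      (\<forall>n. integrable (riesz_measure \<beta>) (\<lambda>\<xi>. energy H (\<lambda>r. elementary_ft (S n) (c n) r \<xi> - \<Phi> r \<xi>))) \<and>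
      (\<lambda>n. LINT \<xi>|riesz_measure \<beta>. energy H (\<lambda>r. elementary_ft (S n) (c n) r \<xi> - \<Phi> r \<xi>)) \<longlonglongrightarrow> 0 \<and>
      (\<lambda>n. LINT \<omega>|P. (elementary_integral W (S n) (c n) \<omega> - X \<omega>)\<^sup>2) \<longlonglongrightarrow> 0"
proof -
  show "X \<in> borel_measurable P" and "integrable P (\<lambda>\<omega>. (X \<omega>)\<^sup>2)"
    using X by (auto simp: is_wiener_integral_def)
  obtain S c where S: "\<forall>n::nat. finite (S n) \<and> S n \<subseteq> noise_index"
    and hp: "hp_tendsto H \<beta> (\<lambda>n r. fourier (\<lambda>x. complex_of_real (elementary_fun (S n) (c n) r x))) \<Phi>"
    and lim: "(\<lambda>n. LINT \<omega>|P. (elementary_integral W (S n) (c n) \<omega> - X \<omega>)\<^sup>2) \<longlonglongrightarrow> 0"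
    using X unfolding is_wiener_integral_def by blast
  define D where "D n r \<xi> = elementary_ft (S n) (c n) r \<xi> - \<Phi> r \<xi>" for n r \<xi>
  define e where "e n \<xi> = energy H (\<lambda>r. D n r \<xi>)" for n \<xi>
  have ft: "(\<lambda>n r. fourier (\<lambda>x. complex_of_real (elementary_fun (S n) (c n) r x))) = (\<lambda>n r \<xi>. elementary_ft (S n) (c n) r \<xi>)"
    using S by (simp add: fun_eq_iff fourier_elementary elementary_ft_def)
  have dens: "hp_density H (D n) (D n) = (\<lambda>\<xi>. complex_of_real (e n \<xi>))" for n
  proof
    fix \<xi>
    have "pulse (\<lambda>r. D n r \<xi>)" unfolding D_def using S by (intro pulse_diff pulse_elementary_ft pulse) auto
    from hp_density_eq_energy[OF H, of "D n" \<xi>, OF this] show "hp_density H (D n) (D n) \<xi> = complex_of_real (e n \<xi>)"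
      by (simp add: e_def)
  qed
  have hp': "\<forall>n. integrable (riesz_measure \<beta>) (hp_density H (D n) (D n))" "(\<lambda>n. hp_inner H \<beta> (D n) (D n)) \<longlonglongrightarrow> 0"
    using hp unfolding hp_tendsto_def ft Let_def D_def by auto
  have ie: "integrable (riesz_measure \<beta>) (e n)" for n
    using integrable_Re[OF hp'(1)[rule_format, of n, unfolded dens]] by simp
  have "hp_inner H \<beta> (D n) (D n) = complex_of_real (H * (2*H - 1) * (LINT \<xi>|riesz_measure \<beta>. e n \<xi>))" for n
    unfolding hp_inner_def dens by (simp only: integral_complex_of_real of_real_mult)
  then have "(\<lambda>n. Re (complex_of_real (H * (2*H - 1) * (LINT \<xi>|riesz_measure \<beta>. e n \<xi>)))) \<longlonglongrightarrow> Re 0"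
    using hp'(2) by (intro tendsto_Re) simp
  then have "(\<lambda>n. H * (2*H - 1) * (LINT \<xi>|riesz_measure \<beta>. e n \<xi>)) \<longlonglongrightarrow> 0" by simp
  then have "(\<lambda>n. 1 / (H * (2*H - 1)) * (H * (2*H - 1) * (LINT \<xi>|riesz_measure \<beta>. e n \<xi>))) \<longlonglongrightarrow> 1 / (H * (2*H - 1)) * 0"
    by (intro tendsto_mult tendsto_const)
  then have "(\<lambda>n. LINT \<xi>|riesz_measure \<beta>. e n \<xi>) \<longlonglongrightarrow> 0" using H by simp
  then show "\<exists>S c. (\<forall>n::nat. finite (S n) \<and> S n \<subseteq> noise_index) \<and>
      (\<forall>n. integrable (riesz_measure \<beta>) (\<lambda>\<xi>. energy H (\<lambda>r. elementary_ft (S n) (c n) r \<xi> - \<Phi> r \<xi>))) \<and>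
      (\<lambda>n. LINT \<xi>|riesz_measure \<beta>. energy H (\<lambda>r. elementary_ft (S n) (c n) r \<xi> - \<Phi> r \<xi>)) \<longlonglongrightarrow> 0 \<and>
      (\<lambda>n. LINT \<omega>|P. (elementary_integral W (S n) (c n) \<omega> - X \<omega>)\<^sup>2) \<longlonglongrightarrow> 0"
    using S ie lim unfolding e_def D_def by blast
qed

text \<open>For the approximating elementary integrals both sides agree. Passing to the limit with
  \<open>energy_add_le\<close> and its analogue for second moments costs a factor \<open>2\<close> on each side.\<close>

lemma variance_comparison:
  fixes f :: "real^'n \<Rightarrow> real" and x y :: "real^'n" and t s :: real
    and u :: "real \<Rightarrow> real^'n \<Rightarrow> 'w \<Rightarrow> real"
  assumes H: "1/2 < H" "H < 1"
    and tft: "tempered_fourier_transform (riesz_measure \<beta>) f"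
    and W: "fractional_colored_noise P H f W"
    and u: "mild_solution P H \<beta> W u"
    and ts: "0 \<le> t" "0 \<le> s"
  defines "E \<equiv> (LINT \<omega>|P. (u t x \<omega> - u s y \<omega>)\<^sup>2)"
    and "N \<equiv> \<lambda>\<xi>. energy H (\<lambda>r. wave_diff t x s y r \<xi>)"
  shows "integrable (riesz_measure \<beta>) N"
    and "E \<le> 4 * (H * (2*H - 1)) * (LINT \<xi>|riesz_measure \<beta>. N \<xi>)"
    and "H * (2*H - 1) * (LINT \<xi>|riesz_measure \<beta>. N \<xi>) \<le> 4 * E"
proof -
  let ?\<mu> = "riesz_measure \<beta> :: (real^'n) measure"
  define \<alpha> where "\<alpha> = H * (2*H - 1)"
  have \<alpha>: "0 < \<alpha>" using H by (simp add: \<alpha>_def)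
  have pw: "pulse (\<lambda>r. wave_integrand_ft \<tau> z r \<xi>)" if "0 \<le> \<tau>" for \<tau> z and \<xi> :: "real^'n"
    using that by (rule pulse_wave_integrand)
  have wt: "is_wiener_integral P H \<beta> W (wave_integrand_ft t x) (u t x)"
    and ws: "is_wiener_integral P H \<beta> W (wave_integrand_ft s y) (u s y)"
    using u ts by (auto simp: mild_solution_def)
  note wt = wiener_approximation[OF H wt pw[OF ts(1)]] and ws = wiener_approximation[OF H ws pw[OF ts(2)]]
  obtain S c where S: "\<And>n::nat. finite (S n)" "\<And>n. S n \<subseteq> noise_index"
    and e_int: "\<And>n. integrable ?\<mu> (\<lambda>\<xi>. energy H (\<lambda>r. elementary_ft (S n) (c n) r \<xi> - wave_integrand_ft t x r \<xi>))"
    and e_lim: "(\<lambda>n. LINT \<xi>|?\<mu>. energy H (\<lambda>r. elementary_ft (S n) (c n) r \<xi> - wave_integrand_ft t x r \<xi>)) \<longlonglongrightarrow> 0"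
    and u_lim: "(\<lambda>n. LINT \<omega>|P. (elementary_integral W (S n) (c n) \<omega> - u t x \<omega>)\<^sup>2) \<longlonglongrightarrow> 0"
    using wt(3) by blast
  obtain S' c' where S': "\<And>n::nat. finite (S' n)" "\<And>n. S' n \<subseteq> noise_index"
    and e_int': "\<And>n. integrable ?\<mu> (\<lambda>\<xi>. energy H (\<lambda>r. elementary_ft (S' n) (c' n) r \<xi> - wave_integrand_ft s y r \<xi>))"
    and e_lim': "(\<lambda>n. LINT \<xi>|?\<mu>. energy H (\<lambda>r. elementary_ft (S' n) (c' n) r \<xi> - wave_integrand_ft s y r \<xi>)) \<longlonglongrightarrow> 0"
    and u_lim': "(\<lambda>n. LINT \<omega>|P. (elementary_integral W (S' n) (c' n) \<omega> - u s y \<omega>)\<^sup>2) \<longlonglongrightarrow> 0"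
    using ws(3) by blast
  define e where "e n \<xi> = energy H (\<lambda>r. elementary_ft (S n) (c n) r \<xi> - wave_integrand_ft t x r \<xi>)" for n \<xi>
  define e' where "e' n \<xi> = energy H (\<lambda>r. elementary_ft (S' n) (c' n) r \<xi> - wave_integrand_ft s y r \<xi>)" for n \<xi>
  define d where "d n p = (if p \<in> S n then c n p else 0) - (if p \<in> S' n then c' n p else 0)" for n p
  define I where "I n = elementary_integral W (S n) (c n)" for n
  define I' where "I' n = elementary_integral W (S' n) (c' n)" for n
  define dn where "dn n \<xi> = energy H (\<lambda>r. elementary_ft (S n) (c n) r \<xi> - elementary_ft (S' n) (c' n) r \<xi>)" for n \<xi>
  have un: "finite (S n \<union> S' n)" "S n \<union> S' n \<subseteq> noise_index" for n using S S' by auto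
  have dI: "elementary_integral W (S n \<union> S' n) (d n) \<omega> = I n \<omega> - I' n \<omega>" for n \<omega>
    using union_combination[OF S(1)[of n] S'(1)[of n], of "c n" "c' n" "\<lambda>p. W (fst p) (snd p) \<omega>"]
    unfolding d_def[symmetric] by (simp add: elementary_integral_def I_def I'_def case_prod_beta)
  have dft: "elementary_ft (S n \<union> S' n) (d n) = (\<lambda>r \<xi>. elementary_ft (S n) (c n) r \<xi> - elementary_ft (S' n) (c' n) r \<xi>)" for n
    unfolding elementary_ft_scaleR d_def
    by (intro ext union_combination S(1) S'(1))
  have pe: "pulse (\<lambda>r. elementary_ft (S n) (c n) r \<xi>)" "pulse (\<lambda>r. elementary_ft (S' n) (c' n) r \<xi>)" for n \<xi>
    using S S' by (auto intro: pulse_elementary_ft)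
  note iso = elementary_isometry[OF H tft W un, of _ "d _"]
  have dens: "hp_density H (elementary_ft (S n \<union> S' n) (d n)) (elementary_ft (S n \<union> S' n) (d n)) = (\<lambda>\<xi>. complex_of_real (dn n \<xi>))" for n
    unfolding dft dn_def by (intro ext hp_density_eq_energy H pulse_diff pe)
  have dn_int: "integrable ?\<mu> (dn n)" for n
    using integrable_Re[OF iso(3)[of n n, unfolded dens]] by simp
  have EI: "(LINT \<omega>|P. (I n \<omega> - I' n \<omega>)\<^sup>2) = \<alpha> * (LINT \<xi>|?\<mu>. dn n \<xi>)" for n
  proof -
    have "complex_of_real (LINT \<omega>|P. (I n \<omega> - I' n \<omega>)\<^sup>2) = complex_of_real (\<alpha> * (LINT \<xi>|?\<mu>. dn n \<xi>))"
      using iso(4)[of n n] unfolding dI hp_inner_def dens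
      by (simp only: integral_complex_of_real of_real_mult \<alpha>_def)
    then show ?thesis by (simp only: of_real_eq_iff)
  qed
  \<comment> \<open>Each of the two energies is at most twice the other, up to the approximation errors.\<close>
  have N_le: "N \<xi> \<le> 2 * dn n \<xi> + (4 * e n \<xi> + 4 * e' n \<xi>)" and dn_le: "dn n \<xi> \<le> 2 * N \<xi> + (4 * e n \<xi> + 4 * e' n \<xi>)" for n \<xi>
  proof -
    let ?a = "\<lambda>r. elementary_ft (S n) (c n) r \<xi> - wave_integrand_ft t x r \<xi>"
    let ?b = "\<lambda>r. elementary_ft (S' n) (c' n) r \<xi> - wave_integrand_ft s y r \<xi>"
    let ?D = "\<lambda>r. elementary_ft (S n) (c n) r \<xi> - elementary_ft (S' n) (c' n) r \<xi>"
    let ?w = "\<lambda>r. wave_diff t x s y r \<xi>"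
    have pa: "pulse ?a" and pb: "pulse ?b" and pD: "pulse ?D" and pww: "pulse ?w"
      using ts by (auto intro!: pulse_diff pe pw pulse_wave_diff)
    have pma: "pulse (\<lambda>r. - ?a r)" and pmb: "pulse (\<lambda>r. - ?b r)"
      using pulse_cmult[OF pa, of "- 1"] pulse_cmult[OF pb, of "- 1"] by simp_all
    have "energy H (\<lambda>r. - ?a r + ?b r) \<le> 2 * energy H (\<lambda>r. - ?a r) + 2 * energy H ?b"
      by (rule energy_add_le[OF H pma pb])
    then have ab: "energy H (\<lambda>r. - ?a r + ?b r) \<le> 2 * e n \<xi> + 2 * e' n \<xi>"
      by (simp only: energy_minus e_def e'_def)
    have "energy H (\<lambda>r. ?a r + - ?b r) \<le> 2 * energy H ?a + 2 * energy H (\<lambda>r. - ?b r)"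
      by (rule energy_add_le[OF H pa pmb])
    then have ba: "energy H (\<lambda>r. ?a r + - ?b r) \<le> 2 * e n \<xi> + 2 * e' n \<xi>"
      by (simp only: energy_minus e_def e'_def)
    have "energy H (\<lambda>r. ?D r + (- ?a r + ?b r)) \<le> 2 * energy H ?D + 2 * energy H (\<lambda>r. - ?a r + ?b r)"
      by (intro energy_add_le H pD pulse_add pma pb)
    moreover have "(\<lambda>r. ?D r + (- ?a r + ?b r)) = ?w" by (simp add: wave_diff_def fun_eq_iff)
    ultimately show "N \<xi> \<le> 2 * dn n \<xi> + (4 * e n \<xi> + 4 * e' n \<xi>)"
      using ab by (simp add: N_def dn_def)
    have "energy H (\<lambda>r. ?w r + (?a r + - ?b r)) \<le> 2 * energy H ?w + 2 * energy H (\<lambda>r. ?a r + - ?b r)"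
      by (intro energy_add_le H pww pulse_add pa pmb)
    moreover have "(\<lambda>r. ?w r + (?a r + - ?b r)) = ?D" by (simp add: wave_diff_def fun_eq_iff)
    ultimately show "dn n \<xi> \<le> 2 * N \<xi> + (4 * e n \<xi> + 4 * e' n \<xi>)"
      using ba by (simp add: N_def dn_def)
  qed
  have N0: "0 \<le> N \<xi>" for \<xi>
    unfolding N_def using ts by (intro energy_nonneg H pulse_wave_diff)
  have ei: "integrable ?\<mu> (e n)" "integrable ?\<mu> (e' n)" for n
    using e_int e_int' unfolding e_def e'_def by auto
  have err_int: "integrable ?\<mu> (\<lambda>\<xi>. 4 * e n \<xi> + 4 * e' n \<xi>)" for n
    using ei by simp
  have comb: "integrable ?\<mu> (\<lambda>\<xi>. 2 * g \<xi> + (4 * e n \<xi> + 4 * e' n \<xi>))" if "integrable ?\<mu> g" for g n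
    by (rule Bochner_Integration.integrable_add[OF integrable_mult_right[OF that] err_int])
  show N_int: "integrable ?\<mu> N"
  proof (rule Bochner_Integration.integrable_bound)
    show "integrable ?\<mu> (\<lambda>\<xi>. 2 * dn 0 \<xi> + (4 * e 0 \<xi> + 4 * e' 0 \<xi>))"
      by (rule comb[OF dn_int])
    have "N \<in> borel_measurable borel"
      unfolding N_def by (rule energy_measurable[OF wave_diff_measurable])
    then show "N \<in> borel_measurable ?\<mu>" by (subst measurable_cong_sets[OF riesz_measure_sets refl])
    have "norm (N \<xi>) \<le> norm (2 * dn 0 \<xi> + (4 * e 0 \<xi> + 4 * e' 0 \<xi>))" for \<xi>
      using N_le[of \<xi> 0] N0[of \<xi>] by simp
    then show "AE \<xi> in ?\<mu>. norm (N \<xi>) \<le> norm (2 * dn 0 \<xi> + (4 * e 0 \<xi> + 4 * e' 0 \<xi>))" by (intro AE_I2)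
  qed
  define \<epsilon> where "\<epsilon> n = (LINT \<xi>|?\<mu>. 4 * e n \<xi> + 4 * e' n \<xi>)" for n
  have \<epsilon>: "\<epsilon> \<longlonglongrightarrow> 0"
  proof -
    have "\<epsilon> = (\<lambda>n. 4 * (LINT \<xi>|?\<mu>. e n \<xi>) + 4 * (LINT \<xi>|?\<mu>. e' n \<xi>))"
      using ei by (simp add: \<epsilon>_def fun_eq_iff)
    moreover have "(\<lambda>n. 4 * (LINT \<xi>|?\<mu>. e n \<xi>) + 4 * (LINT \<xi>|?\<mu>. e' n \<xi>)) \<longlonglongrightarrow> 4 * 0 + 4 * 0"
      using e_lim e_lim' unfolding e_def e'_def by (intro tendsto_add tendsto_mult tendsto_const)
    ultimately show ?thesis by simp
  qed
  define v where "v n = 4 * (LINT \<omega>|P. (I n \<omega> - u t x \<omega>)\<^sup>2) + 4 * (LINT \<omega>|P. (I' n \<omega> - u s y \<omega>)\<^sup>2)" for n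
  have v: "v \<longlonglongrightarrow> 0"
  proof -
    have "v \<longlonglongrightarrow> 4 * 0 + 4 * 0"
      unfolding v_def I_def I'_def by (intro tendsto_add tendsto_mult tendsto_const u_lim u_lim')
    then show ?thesis by simp
  qed
  have QN1: "(LINT \<xi>|?\<mu>. N \<xi>) \<le> 2 * (LINT \<xi>|?\<mu>. dn n \<xi>) + \<epsilon> n" for n
  proof -
    have "(LINT \<xi>|?\<mu>. N \<xi>) \<le> (LINT \<xi>|?\<mu>. 2 * dn n \<xi> + (4 * e n \<xi> + 4 * e' n \<xi>))"
      by (rule integral_mono[OF N_int comb[OF dn_int] N_le])
    also have "\<dots> = 2 * (LINT \<xi>|?\<mu>. dn n \<xi>) + \<epsilon> n"
      unfolding \<epsilon>_def using dn_int err_int by (subst Bochner_Integration.integral_add) auto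
    finally show ?thesis .
  qed
  have QN2: "(LINT \<xi>|?\<mu>. dn n \<xi>) \<le> 2 * (LINT \<xi>|?\<mu>. N \<xi>) + \<epsilon> n" for n
  proof -
    have "(LINT \<xi>|?\<mu>. dn n \<xi>) \<le> (LINT \<xi>|?\<mu>. 2 * N \<xi> + (4 * e n \<xi> + 4 * e' n \<xi>))"
      by (rule integral_mono[OF dn_int comb[OF N_int] dn_le])
    also have "\<dots> = 2 * (LINT \<xi>|?\<mu>. N \<xi>) + \<epsilon> n"
      unfolding \<epsilon>_def using N_int err_int by (subst Bochner_Integration.integral_add) auto
    finally show ?thesis .
  qed
  have um: "u t x \<in> borel_measurable P" "integrable P (\<lambda>\<omega>. (u t x \<omega>)\<^sup>2)" "u s y \<in> borel_measurable P" "integrable P (\<lambda>\<omega>. (u s y \<omega>)\<^sup>2)"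
    using wt(1,2) ws(1,2) by auto
  have Im: "I n \<in> borel_measurable P" "integrable P (\<lambda>\<omega>. (I n \<omega>)\<^sup>2)" "I' n \<in> borel_measurable P" "integrable P (\<lambda>\<omega>. (I' n \<omega>)\<^sup>2)" for n
    unfolding I_def I'_def using elementary_isometry(1,2)[OF H tft W] S S' by auto
  have i1: "integrable P (\<lambda>\<omega>. (u t x \<omega> - u s y \<omega>)\<^sup>2)" and i2: "integrable P (\<lambda>\<omega>. (I n \<omega> - I' n \<omega>)\<^sup>2)"
    and i3: "integrable P (\<lambda>\<omega>. (I n \<omega> - u t x \<omega>)\<^sup>2)" and i4: "integrable P (\<lambda>\<omega>. (I' n \<omega> - u s y \<omega>)\<^sup>2)" for n
    using um Im[of n] by (auto intro: square_integrable_diff)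
  have sq: "(a - b)\<^sup>2 \<le> 2 * (a' - b')\<^sup>2 + (4 * (a' - a)\<^sup>2 + 4 * (b' - b)\<^sup>2)" for a b a' b' :: real
  proof -
    have "(a - b)\<^sup>2 \<le> 2 * (a' - b')\<^sup>2 + 2 * ((b' - b) - (a' - a))\<^sup>2"
      using norm_add_power2_le[of "a' - b'" "(b' - b) - (a' - a)"] by simp
    moreover have "((b' - b) - (a' - a))\<^sup>2 \<le> 2 * (b' - b)\<^sup>2 + 2 * (a' - a)\<^sup>2"
    proof -
      have "(p - q)\<^sup>2 \<le> 2 * p\<^sup>2 + 2 * q\<^sup>2" for p q :: real
        using norm_add_power2_le[of p "- q"] by simp
      then show ?thesis by blast
    qed
    ultimately show ?thesis by simp
  qed
  have E1: "E \<le> 2 * (\<alpha> * (LINT \<xi>|?\<mu>. dn n \<xi>)) + v n" for n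
  proof -
    have "E \<le> (LINT \<omega>|P. 2 * (I n \<omega> - I' n \<omega>)\<^sup>2 + (4 * (I n \<omega> - u t x \<omega>)\<^sup>2 + 4 * (I' n \<omega> - u s y \<omega>)\<^sup>2))"
      unfolding E_def using i1 i2 i3 i4 sq by (intro integral_mono Bochner_Integration.integrable_add integrable_mult_right)
    also have "\<dots> = 2 * (LINT \<omega>|P. (I n \<omega> - I' n \<omega>)\<^sup>2) + v n"
      using i2 i3 i4 by (simp add: v_def)
    finally show ?thesis unfolding EI .
  qed
  have E2: "\<alpha> * (LINT \<xi>|?\<mu>. dn n \<xi>) \<le> 2 * E + v n" for n
  proof -
    have "(LINT \<omega>|P. (I n \<omega> - I' n \<omega>)\<^sup>2) \<le> (LINT \<omega>|P. 2 * (u t x \<omega> - u s y \<omega>)\<^sup>2 + (4 * (I n \<omega> - u t x \<omega>)\<^sup>2 + 4 * (I' n \<omega> - u s y \<omega>)\<^sup>2))"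
      using i1 i2 i3 i4 sq[of "I _ _" "I' _ _" "u t x _" "u s y _"]
      by (intro integral_mono Bochner_Integration.integrable_add integrable_mult_right) (auto simp: power2_commute)
    also have "\<dots> = 2 * E + v n"
      using i1 i3 i4 by (simp add: v_def E_def)
    finally show ?thesis unfolding EI .
  qed
  let ?Q = "LINT \<xi>|?\<mu>. N \<xi>"
  have "E \<le> 4 * \<alpha> * ?Q + (2 * \<alpha> * \<epsilon> n + v n)" for n
    using E1[of n] mult_left_mono[OF QN2[of n], of "2 * \<alpha>"] \<alpha> by (simp add: algebra_simps)
  moreover have "(\<lambda>n. 4 * \<alpha> * ?Q + (2 * \<alpha> * \<epsilon> n + v n)) \<longlonglongrightarrow> 4 * \<alpha> * ?Q + (2 * \<alpha> * 0 + 0)"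
    by (intro tendsto_add tendsto_mult tendsto_const \<epsilon> v)
  ultimately have "E \<le> 4 * \<alpha> * ?Q + (2 * \<alpha> * 0 + 0)"
    by (intro LIMSEQ_le_const) auto
  then show "E \<le> 4 * (H * (2*H - 1)) * ?Q" by (simp add: \<alpha>_def)
  have "\<alpha> * ?Q \<le> 4 * E + (2 * v n + \<alpha> * \<epsilon> n)" for n
    using E2[of n] mult_left_mono[OF QN1[of n], of "\<alpha>"] \<alpha> by (simp add: algebra_simps)
  moreover have "(\<lambda>n. 4 * E + (2 * v n + \<alpha> * \<epsilon> n)) \<longlonglongrightarrow> 4 * E + (2 * 0 + \<alpha> * 0)"
    by (intro tendsto_add tendsto_mult tendsto_const \<epsilon> v)
  ultimately have "\<alpha> * ?Q \<le> 4 * E + (2 * 0 + \<alpha> * 0)"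
    by (intro LIMSEQ_le_const) auto
  then show "H * (2*H - 1) * ?Q \<le> 4 * E" by (simp add: \<alpha>_def)
qed


lemma nn_integral_riesz:
  fixes F :: "real^'n \<Rightarrow> ennreal"
  assumes "F \<in> borel_measurable borel"
  shows "(\<integral>\<^sup>+\<xi>. F \<xi> \<partial>riesz_measure \<beta>) = (\<integral>\<^sup>+\<xi>. ennreal (norm \<xi> powr (\<beta> - real CARD('n))) * F \<xi> \<partial>lborel)"
  using assms unfolding riesz_measure_def by (subst nn_integral_density) auto

section \<open>Scaling of the spectral integral\<close>

text \<open>In the variable \<open>\<eta> = L\<xi>\<close> the bound on \<open>N\<close>, multiplied by the density of \<open>\<mu>\<close>, is the radial weight times
  \<open>L powr (a + d)\<close>, and the change of variables contributes \<open>L powr (-d)\<close>.\<close>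

lemma spectral_upper:
  assumes \<beta>: "2*H - 1 < \<beta>" "\<beta> < 2*H + 1" and "0 < C"
  shows "\<exists>\<kappa>\<ge>0. \<forall>(N :: real^'n \<Rightarrow> real) L. 0 < L \<longrightarrow> N \<in> borel_measurable borel \<longrightarrow>
    (\<forall>\<xi>. \<xi> \<noteq> 0 \<longrightarrow> N \<xi> \<le> C * (min 1 ((L * norm \<xi>)\<^sup>2) * norm \<xi> powr (- 1 - 2*H))) \<longrightarrow>
    (\<integral>\<^sup>+\<xi>. ennreal (N \<xi>) \<partial>riesz_measure \<beta>) \<le> ennreal (\<kappa> * L powr (2*H + 1 - \<beta>))"
proof -
  define a where "a = 2*H + 1 - \<beta>"
  define d where "d = real CARD('n)"
  define F where "F \<eta> = ennreal (min 1 ((norm \<eta>)\<^sup>2) * norm \<eta> powr (- a - d))" for \<eta> :: "real^'n"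
  have [measurable]: "F \<in> borel_measurable borel" unfolding F_def by measurable
  have "0 < a" "a < 2" using \<beta> by (auto simp: a_def)
  then have "(\<integral>\<^sup>+\<eta>. F \<eta> \<partial>lborel) < \<infinity>"
    using radial_weight_finite[of a, where 'a="real^'n"] by (simp add: F_def d_def)
  then obtain \<kappa> where \<kappa>: "0 \<le> \<kappa>" "(\<integral>\<^sup>+\<eta>. F \<eta> \<partial>lborel) = ennreal \<kappa>"
    by (cases "\<integral>\<^sup>+\<eta>. F \<eta> \<partial>lborel") auto
  have "(\<integral>\<^sup>+\<xi>. ennreal (N \<xi>) \<partial>riesz_measure \<beta>) \<le> ennreal (C * \<kappa> * L powr a)"
    if L: "0 < L" and [measurable]: "N \<in> borel_measurable borel"
      and N: "\<And>\<xi>. \<xi> \<noteq> 0 \<Longrightarrow> N \<xi> \<le> C * (min 1 ((L * norm \<xi>)\<^sup>2) * norm \<xi> powr (- 1 - 2*H))" for N :: "real^'n \<Rightarrow> real" and L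
  proof -
    have pt: "ennreal (norm \<xi> powr (\<beta> - real CARD('n))) * ennreal (N \<xi>) \<le> ennreal (C * L powr (a + d)) * F (L *\<^sub>R \<xi>)" for \<xi>
    proof (cases "\<xi> = 0")
      case False
      have "L powr (a + d) * (L * norm \<xi>) powr (- a - d) = norm \<xi> powr (- a - d)"
      proof -
        have "L powr (a + d) * L powr (- a - d) = 1"
          using L by (simp flip: powr_add)
        then show ?thesis
          using L by (simp add: powr_mult mult.assoc[symmetric])
      qed
      moreover have "norm \<xi> powr (\<beta> - d) * norm \<xi> powr (- 1 - 2*H) = norm \<xi> powr (- a - d)"
        by (simp only: powr_add[symmetric]) (simp add: a_def algebra_simps)
      ultimately have eq: "norm \<xi> powr (\<beta> - d) * (C * (min 1 ((L * norm \<xi>)\<^sup>2) * norm \<xi> powr (- 1 - 2*H)))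
          = C * L powr (a + d) * (min 1 ((L * norm \<xi>)\<^sup>2) * (L * norm \<xi>) powr (- a - d))"
        by (simp add: mult_ac)
      have "norm \<xi> powr (\<beta> - d) * N \<xi> \<le> norm \<xi> powr (\<beta> - d) * (C * (min 1 ((L * norm \<xi>)\<^sup>2) * norm \<xi> powr (- 1 - 2*H)))"
        by (intro mult_left_mono N False) simp
      then have "ennreal (norm \<xi> powr (\<beta> - d) * N \<xi>) \<le> ennreal (C * L powr (a + d) * (min 1 ((L * norm \<xi>)\<^sup>2) * (L * norm \<xi>) powr (- a - d)))"
        unfolding eq by (rule ennreal_leI)
      then show ?thesis
        using L \<open>0 < C\<close> by (simp add: F_def d_def ennreal_mult')
    qed simp
    have "(\<integral>\<^sup>+\<xi>. ennreal (N \<xi>) \<partial>riesz_measure \<beta>) = (\<integral>\<^sup>+\<xi>. ennreal (norm \<xi> powr (\<beta> - real CARD('n))) * ennreal (N \<xi>) \<partial>lborel)"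
      by (intro nn_integral_riesz) measurable
    also have "\<dots> \<le> (\<integral>\<^sup>+\<xi>. ennreal (C * L powr (a + d)) * F (L *\<^sub>R \<xi>) \<partial>lborel)"
      by (intro nn_integral_mono pt)
    also have "\<dots> = ennreal (C * L powr (a + d)) * (\<integral>\<^sup>+\<xi>. F (L *\<^sub>R \<xi>) \<partial>lborel)"
      by (intro nn_integral_cmult) measurable
    also have "(\<integral>\<^sup>+\<xi>. F (L *\<^sub>R \<xi>) \<partial>lborel) = ennreal (L powr (- d)) * ennreal \<kappa>"
      using nn_integral_lborel_scale[of F L] L by (simp add: \<kappa> d_def)
    also have "ennreal (C * L powr (a + d)) * (ennreal (L powr (- d)) * ennreal \<kappa>) = ennreal (C * \<kappa> * (L powr (a + d) * L powr (- d)))"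
      using \<kappa>(1) \<open>0 < C\<close> by (simp add: ennreal_mult'[symmetric] mult_ac)
    also have "L powr (a + d) * L powr (- d) = L powr a"
      by (simp flip: powr_add)
    finally show ?thesis .
  qed
  then show ?thesis
    using \<kappa>(1) \<open>0 < C\<close> unfolding a_def by (intro exI[of _ "C * \<kappa>"]) auto
qed

text \<open>The same substitution, restricted to a shell on which the lower bound for high frequencies is valid.\<close>

lemma spectral_lower:
  assumes c: "0 < c" and K: "0 < K" and Lm: "0 < Lmax"
    and a0: "0 < 2*H + 1 - \<beta>"
  shows "\<exists>\<kappa>>0. \<forall>(N :: real^'n \<Rightarrow> real) \<delta> z L. 0 < L \<longrightarrow> L \<le> Lmax \<longrightarrow> N \<in> borel_measurable borel \<longrightarrow>
    max \<bar>\<delta>\<bar> (norm z) = L \<longrightarrow>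
    (\<forall>\<xi>. K \<le> norm \<xi> \<longrightarrow> c * norm \<xi> powr (- 1 - 2*H) * (1 - cos (\<xi> \<bullet> z) * cos (norm \<xi> * \<delta>)) \<le> N \<xi>) \<longrightarrow>
    ennreal (\<kappa> * L powr (2*H + 1 - \<beta>)) \<le> (\<integral>\<^sup>+\<xi>. ennreal (N \<xi>) \<partial>riesz_measure \<beta>)"
proof -
  define a where "a = 2*H + 1 - \<beta>"
  define d where "d = real CARD('n)"
  \<comment> \<open>\<open>\<bar>\<eta>\<bar> \<ge> R\<close> forces \<open>\<bar>\<xi>\<bar> = \<bar>\<eta>\<bar> / L \<ge> K\<close> for every \<open>L \<le> Lmax\<close>\<close>
  define R where "R = K * Lmax"
  have R: "0 < R" using K Lm by (simp add: R_def)
  obtain c' where c': "0 < c'" "\<And>(p :: real \<times> (real^'n)). max \<bar>fst p\<bar> (norm (snd p)) = 1 \<Longrightarrow> c' \<le> shell_defect R p"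
    using shell_defect_uniform[OF R] by blast
  define b where "b = c * (2 * R) powr (- a - d)"
  have b: "0 < b" using c R by (simp add: b_def)
  have ad: "- a - d \<le> 0" using a0 by (simp add: a_def d_def)
  have "ennreal (b * c' * L powr a) \<le> (\<integral>\<^sup>+\<xi>. ennreal (N \<xi>) \<partial>riesz_measure \<beta>)"
    if L: "0 < L" "L \<le> Lmax" and [measurable]: "N \<in> borel_measurable borel" and Lz: "max \<bar>\<delta>\<bar> (norm z) = L"
      and N: "\<And>\<xi>. K \<le> norm \<xi> \<Longrightarrow> c * norm \<xi> powr (- 1 - 2*H) * (1 - cos (\<xi> \<bullet> z) * cos (norm \<xi> * \<delta>)) \<le> N \<xi>"
    for N :: "real^'n \<Rightarrow> real" and \<delta> z L
  proof -
    define p where "p = (\<delta> / L, z /\<^sub>R L)"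
    have p1: "max \<bar>fst p\<bar> (norm (snd p)) = 1"
    proof -
      have "max \<bar>fst p\<bar> (norm (snd p)) = max \<bar>\<delta>\<bar> (norm z) / L"
        using L by (simp add: p_def max_divide_distrib_right divide_inverse_commute[symmetric])
      then show ?thesis using L Lz by simp
    qed
    define G0 where "G0 \<eta> = indicator (cball 0 (2 * R) - ball 0 R) \<eta> * (1 - cos (\<eta> \<bullet> snd p) * cos (norm \<eta> * fst p))" for \<eta> :: "real^'n"
    define G where "G \<eta> = ennreal (G0 \<eta>)" for \<eta>
    have G0n: "0 \<le> G0 \<eta>" for \<eta> unfolding G0_def using defect_bounds by (auto simp: indicator_def)
    have G0i: "integrable lborel G0" unfolding G0_def by (rule defect_integrable)
    have G0m [measurable]: "G0 \<in> borel_measurable borel" using borel_measurable_integrable[OF G0i] by simp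
    have [measurable]: "G \<in> borel_measurable borel" unfolding G_def by measurable
    have IG: "(\<integral>\<^sup>+\<eta>. G \<eta> \<partial>lborel) = ennreal (shell_defect R p)"
      unfolding G_def shell_defect_def G0_def[symmetric] by (rule nn_integral_eq_integral[OF G0i]) (use G0n in auto)
    have pt: "ennreal (b * L powr (a + d)) * G (L *\<^sub>R \<xi>) \<le> ennreal (norm \<xi> powr (\<beta> - real CARD('n))) * ennreal (N \<xi>)" for \<xi>
    proof (cases "L *\<^sub>R \<xi> \<in> cball 0 (2 * R) - ball 0 R")
      case True
      then have n: "L * norm \<xi> \<le> 2 * R" "R \<le> L * norm \<xi>" using L by auto
      have K': "K \<le> norm \<xi>"
      proof -
        have "K * L \<le> R" using L K by (simp add: R_def mult_left_mono)
        then have "K * L \<le> norm \<xi> * L" using n by (simp add: mult.commute)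
        then show ?thesis using L by simp
      qed
      then have \<xi>: "0 < norm \<xi>" using K by linarith
      let ?D = "1 - cos (\<xi> \<bullet> z) * cos (norm \<xi> * \<delta>)"
      have e: "(L *\<^sub>R \<xi>) \<bullet> snd p = \<xi> \<bullet> z" "norm (L *\<^sub>R \<xi>) * fst p = norm \<xi> * \<delta>"
        using L by (simp_all add: p_def field_simps)
      have G0: "G0 (L *\<^sub>R \<xi>) = ?D"
        unfolding G0_def e indicator_simps(1)[OF True] by simp
      have D0: "0 \<le> ?D" using defect_bounds by simp
      have "b * L powr (a + d) \<le> c * norm \<xi> powr (- a - d)"
      proof -
        have "(2 * R) powr (- a - d) \<le> (L * norm \<xi>) powr (- a - d)"
          using n R ad by (intro powr_mono2') auto
        then have "c * (2 * R) powr (- a - d) * L powr (a + d) \<le> c * (L * norm \<xi>) powr (- a - d) * L powr (a + d)"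
          using c by (intro mult_right_mono mult_left_mono) auto
        also have "\<dots> = c * norm \<xi> powr (- a - d) * (L powr (- a - d) * L powr (a + d))"
          using L by (simp add: powr_mult mult_ac)
        also have "L powr (- a - d) * L powr (a + d) = 1"
          using L by (simp flip: powr_add)
        finally show ?thesis by (simp add: b_def)
      qed
      then have "b * L powr (a + d) * ?D \<le> c * norm \<xi> powr (- a - d) * ?D"
        using D0 by (rule mult_right_mono)
      also have "norm \<xi> powr (- a - d) = norm \<xi> powr (\<beta> - d) * norm \<xi> powr (- 1 - 2*H)"
        by (simp only: powr_add[symmetric]) (simp add: a_def algebra_simps)
      also have "c * (norm \<xi> powr (\<beta> - d) * norm \<xi> powr (- 1 - 2*H)) * ?D = norm \<xi> powr (\<beta> - d) * (c * norm \<xi> powr (- 1 - 2*H) * ?D)"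
        by (simp add: mult_ac)
      also have "\<dots> \<le> norm \<xi> powr (\<beta> - d) * N \<xi>"
        by (intro mult_left_mono N K') simp
      finally have "ennreal (b * L powr (a + d) * G0 (L *\<^sub>R \<xi>)) \<le> ennreal (norm \<xi> powr (\<beta> - d) * N \<xi>)"
        unfolding G0 by (rule ennreal_leI)
      then show ?thesis using b by (simp add: G_def d_def ennreal_mult')
    next
      case False
      then have "G0 (L *\<^sub>R \<xi>) = 0" unfolding G0_def by simp
      then show ?thesis by (simp add: G_def)
    qed
    have "ennreal (b * c' * L powr a) = ennreal (b * L powr (a + d)) * (ennreal (L powr (- d)) * ennreal c')"
    proof -
      have "L powr (a + d) * L powr (- d) = L powr a" by (simp flip: powr_add)
      then have "b * c' * L powr a = b * L powr (a + d) * (L powr (- d) * c')" by (simp add: mult_ac)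
      then show ?thesis using b c'(1) by (simp add: ennreal_mult' mult_ac)
    qed
    also have "\<dots> \<le> ennreal (b * L powr (a + d)) * (ennreal (L powr (- d)) * (\<integral>\<^sup>+\<eta>. G \<eta> \<partial>lborel))"
      unfolding IG using c'(2)[OF p1] by (intro mult_left_mono ennreal_leI) auto
    also have "ennreal (L powr (- d)) * (\<integral>\<^sup>+\<eta>. G \<eta> \<partial>lborel) = (\<integral>\<^sup>+\<xi>. G (L *\<^sub>R \<xi>) \<partial>lborel)"
      using nn_integral_lborel_scale[of G L] L by (simp add: d_def)
    also have "ennreal (b * L powr (a + d)) * \<dots> = (\<integral>\<^sup>+\<xi>. ennreal (b * L powr (a + d)) * G (L *\<^sub>R \<xi>) \<partial>lborel)"
      by (intro nn_integral_cmult[symmetric]) measurable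
    also have "\<dots> \<le> (\<integral>\<^sup>+\<xi>. ennreal (norm \<xi> powr (\<beta> - real CARD('n))) * ennreal (N \<xi>) \<partial>lborel)"
      by (intro nn_integral_mono pt)
    also have "\<dots> = (\<integral>\<^sup>+\<xi>. ennreal (N \<xi>) \<partial>riesz_measure \<beta>)"
      by (intro nn_integral_riesz[symmetric]) measurable
    finally show ?thesis .
  qed
  then show ?thesis
    using b c'(1) unfolding a_def by (intro exI[of _ "b * c'"]) auto
qed

section \<open>The two-sided bound\<close>

theorem theorem2:
  fixes P :: "'w measure"
    and W :: "real \<Rightarrow> (real^'n) set \<Rightarrow> 'w \<Rightarrow> real"
    and f :: "real^'n \<Rightarrow> real"
    and u :: "real \<Rightarrow> real^'n \<Rightarrow> 'w \<Rightarrow> real"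
    and H \<beta> t\<^sub>0 T M :: real
  assumes "prob_space P"
    and "1/2 < H" and "H < 1"
    and "0 < t\<^sub>0" and "t\<^sub>0 < T"
    and "0 < M"
    and "2*H - 1 < \<beta>" and "\<beta> < min (real CARD('n)) (2*H + 1)"
    and "tempered_fourier_transform (riesz_measure \<beta>) f"
    and "fractional_colored_noise P H f W"
    and "mild_solution P H \<beta> W u"
  shows "\<exists>C\<^sub>1 C\<^sub>2. 0 < C\<^sub>1 \<and> 0 < C\<^sub>2 \<and>
    (\<forall>t\<in>{t\<^sub>0..T}. \<forall>s\<in>{t\<^sub>0..T}.
     \<forall>x\<in>{x. \<forall>i. x $ i \<in> {-M..M}}. \<forall>y\<in>{y. \<forall>i. y $ i \<in> {-M..M}}.
       C\<^sub>1 * Delta H \<beta> (t, x) (s, y) \<le> prob_space.expectation P (\<lambda>\<omega>. \<bar>u t x \<omega> - u s y \<omega>\<bar>\<^sup>2) \<and>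
       prob_space.expectation P (\<lambda>\<omega>. \<bar>u t x \<omega> - u s y \<omega>\<bar>\<^sup>2) \<le> C\<^sub>2 * Delta H \<beta> (t, x) (s, y))"
proof -
  note H = assms(2,3)
  have T: "0 < T" using assms(4,5) by simp
  define a where "a = 2*H + 1 - \<beta>"
  have a: "0 < a" using assms(8) by (simp add: a_def)
  have \<beta>: "2*H - 1 < \<beta>" "\<beta> < 2*H + 1" using assms(7,8) by auto
  define \<alpha> where "\<alpha> = H * (2*H - 1)"
  have \<alpha>: "0 < \<alpha>" using H by (simp add: \<alpha>_def)
  \<comment> \<open>bounds both the time increment and the space increment\<close>
  define Lmax where "Lmax = max T (2 * M * real CARD('n))"
  have Lmax: "0 < Lmax" using T by (simp add: Lmax_def less_max_iff_disj)
  obtain C where C: "0 < C" and up: "\<And>t s x y L (\<xi>::real^'n). 0 \<le> t \<Longrightarrow> t \<le> T \<Longrightarrow> 0 \<le> s \<Longrightarrow> s \<le> T \<Longrightarrow>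
      \<bar>t - s\<bar> \<le> L \<Longrightarrow> norm (x - y) \<le> L \<Longrightarrow> \<xi> \<noteq> 0 \<Longrightarrow>
      energy H (\<lambda>r. wave_diff t x s y r \<xi>) \<le> C * (min 1 ((L * norm \<xi>)\<^sup>2) * norm \<xi> powr (- 1 - 2*H))"
    using wave_energy_upper[OF H T] by blast
  obtain c K where c: "0 < c" and K: "0 < K" and low: "\<And>t s x y (\<xi>::real^'n). t\<^sub>0 \<le> t \<Longrightarrow> t\<^sub>0 \<le> s \<Longrightarrow> K \<le> norm \<xi> \<Longrightarrow>
      c * norm \<xi> powr (- 1 - 2*H) * (1 - cos (\<xi> \<bullet> (x - y)) * cos (norm \<xi> * (t - s))) \<le> energy H (\<lambda>r. wave_diff t x s y r \<xi>)"
    using wave_energy_lower[OF H assms(4)] by blast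
  obtain \<kappa>\<^sub>1 where k1: "0 \<le> \<kappa>\<^sub>1" and spec_up: "\<And>(N :: real^'n \<Rightarrow> real) L. 0 < L \<Longrightarrow> N \<in> borel_measurable borel \<Longrightarrow>
      \<forall>\<xi>. \<xi> \<noteq> 0 \<longrightarrow> N \<xi> \<le> C * (min 1 ((L * norm \<xi>)\<^sup>2) * norm \<xi> powr (- 1 - 2*H)) \<Longrightarrow>
      (\<integral>\<^sup>+\<xi>. ennreal (N \<xi>) \<partial>riesz_measure \<beta>) \<le> ennreal (\<kappa>\<^sub>1 * L powr a)"
    using spectral_upper[OF \<beta> C, where 'n='n] unfolding a_def by blast
  obtain \<kappa>\<^sub>2 where k2: "0 < \<kappa>\<^sub>2" and spec_low: "\<And>(N :: real^'n \<Rightarrow> real) \<delta> z L. 0 < L \<Longrightarrow> L \<le> Lmax \<Longrightarrow> N \<in> borel_measurable borel \<Longrightarrow>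
      max \<bar>\<delta>\<bar> (norm z) = L \<Longrightarrow>
      \<forall>\<xi>. K \<le> norm \<xi> \<longrightarrow> c * norm \<xi> powr (- 1 - 2*H) * (1 - cos (\<xi> \<bullet> z) * cos (norm \<xi> * \<delta>)) \<le> N \<xi> \<Longrightarrow>
      ennreal (\<kappa>\<^sub>2 * L powr a) \<le> (\<integral>\<^sup>+\<xi>. ennreal (N \<xi>) \<partial>riesz_measure \<beta>)"
    using spectral_lower[OF c K Lmax a[unfolded a_def], where 'n='n] unfolding a_def by blast
  define C1 where "C1 = \<alpha> * \<kappa>\<^sub>2 / 8"
  \<comment> \<open>adding \<open>1\<close> makes the constant positive\<close>
  define C2 where "C2 = 4 * \<alpha> * \<kappa>\<^sub>1 + 1"
  have main: "C1 * Delta H \<beta> (t, x) (s, y) \<le> (LINT \<omega>|P. \<bar>u t x \<omega> - u s y \<omega>\<bar>\<^sup>2) \<and>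
      (LINT \<omega>|P. \<bar>u t x \<omega> - u s y \<omega>\<bar>\<^sup>2) \<le> C2 * Delta H \<beta> (t, x) (s, y)"
    if t: "t \<in> {t\<^sub>0..T}" and s: "s \<in> {t\<^sub>0..T}"
      and x: "\<forall>i. x $ i \<in> {-M..M}" and y: "\<forall>i. y $ i \<in> {-M..M}" for t s x y
  proof -
    define L where "L = max \<bar>t - s\<bar> (norm (x - y))"
    have Delta: "Delta H \<beta> (t, x) (s, y) = \<bar>t - s\<bar> powr a + norm (x - y) powr a"
      by (simp add: Delta_def a_def)
    show ?thesis
    proof (cases "L = 0")
      case True
      then have "\<bar>t - s\<bar> \<le> 0" "norm (x - y) \<le> 0" unfolding L_def by (metis max.cobounded1, metis max.cobounded2)
      then have eq: "t = s" "x = y" by auto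
      then have "Delta H \<beta> (t, x) (s, y) = 0" by (simp add: Delta_def)
      then show ?thesis using eq by simp
    next
      case False
      then have L: "0 < L" by (auto simp: L_def less_max_iff_disj max_def)
      have LL: "L \<le> Lmax"
      proof -
        have "norm (x - y) \<le> (\<Sum>i\<in>UNIV. \<bar>(x - y) $ i\<bar>)" by (rule norm_le_l1_cart)
        also have "\<dots> \<le> of_nat (card (UNIV :: 'n set)) * (2 * M)"
        proof (rule sum_bounded_above)
          fix i :: 'n
          have "x $ i \<in> {-M..M}" "y $ i \<in> {-M..M}" using x y by blast+
          then show "\<bar>(x - y) $ i\<bar> \<le> 2 * M" by auto
        qed
        finally have "norm (x - y) \<le> 2 * M * real CARD('n)" by (simp add: mult_ac)
        moreover have "\<bar>t - s\<bar> \<le> T" using t s assms(4) by auto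
        ultimately show ?thesis by (auto simp: L_def Lmax_def)
      qed
      have t0: "0 \<le> t" "0 \<le> s" using t s assms(4) by auto
      have low_Delta: "L powr a \<le> Delta H \<beta> (t, x) (s, y)"
        unfolding Delta L_def by (auto simp: max_def)
      have up_Delta: "Delta H \<beta> (t, x) (s, y) \<le> 2 * L powr a"
      proof -
        have "\<bar>t - s\<bar> powr a \<le> L powr a" "norm (x - y) powr a \<le> L powr a"
          using a by (auto simp: L_def intro!: powr_mono2)
        then show ?thesis unfolding Delta by simp
      qed
      let ?N = "\<lambda>\<xi>. energy H (\<lambda>r. wave_diff t x s y r \<xi>)"
      let ?E = "LINT \<omega>|P. (u t x \<omega> - u s y \<omega>)\<^sup>2"
      let ?Q = "LINT \<xi>|riesz_measure \<beta>. ?N \<xi>"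
      note cmp = variance_comparison[OF H assms(9,10,11) t0, of x y]
      have Nm: "?N \<in> borel_measurable borel"
        by (rule energy_measurable[OF wave_diff_measurable])
      have N0: "0 \<le> ?N \<xi>" for \<xi>
        using t0 by (intro energy_nonneg H pulse_wave_diff)
      have nn: "(\<integral>\<^sup>+\<xi>. ennreal (?N \<xi>) \<partial>riesz_measure \<beta>) = ennreal ?Q"
        by (rule nn_integral_eq_integral[OF cmp(1)]) (use N0 in auto)
      have Q0: "0 \<le> ?Q" by (rule Bochner_Integration.integral_nonneg) (rule N0)
      have "ennreal ?Q \<le> ennreal (\<kappa>\<^sub>1 * L powr a)"
        unfolding nn[symmetric]
      proof (rule spec_up[OF L Nm], intro allI impI)
        fix \<xi> :: "real^'n" assume "\<xi> \<noteq> 0"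
        then show "?N \<xi> \<le> C * (min 1 ((L * norm \<xi>)\<^sup>2) * norm \<xi> powr (- 1 - 2*H))"
          using t s t0 by (intro up) (auto simp: L_def)
      qed
      then have Qu: "?Q \<le> \<kappa>\<^sub>1 * L powr a" using k1 by (subst (asm) ennreal_le_iff) auto
      have "ennreal (\<kappa>\<^sub>2 * L powr a) \<le> ennreal ?Q"
        unfolding nn[symmetric]
      proof (rule spec_low[OF L LL Nm, of "t - s" "x - y"])
        show "max \<bar>t - s\<bar> (norm (x - y)) = L" by (simp add: L_def)
        show "\<forall>\<xi>. K \<le> norm \<xi> \<longrightarrow> c * norm \<xi> powr (- 1 - 2*H) * (1 - cos (\<xi> \<bullet> (x - y)) * cos (norm \<xi> * (t - s))) \<le> ?N \<xi>"
          using t s by (intro allI impI low) auto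
      qed
      then have Ql: "\<kappa>\<^sub>2 * L powr a \<le> ?Q" using Q0 by (subst (asm) ennreal_le_iff) auto
      have "C1 * Delta H \<beta> (t, x) (s, y) \<le> C1 * (2 * L powr a)"
        using up_Delta \<alpha> k2 by (intro mult_left_mono) (auto simp: C1_def)
      also have "\<dots> = \<alpha> * (\<kappa>\<^sub>2 * L powr a) / 4" by (simp add: C1_def)
      also have "\<dots> \<le> \<alpha> * ?Q / 4" using Ql \<alpha> by (intro divide_right_mono mult_left_mono) auto
      also have "\<dots> \<le> ?E" using cmp(3) by (simp add: \<alpha>_def)
      finally have lower: "C1 * Delta H \<beta> (t, x) (s, y) \<le> ?E" .
      have "?E \<le> 4 * \<alpha> * ?Q" using cmp(2) by (simp add: \<alpha>_def)
      also have "\<dots> \<le> 4 * \<alpha> * (\<kappa>\<^sub>1 * L powr a)" using Qu \<alpha> by (intro mult_left_mono) auto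
      also have "\<dots> \<le> C2 * L powr a" by (simp add: C2_def algebra_simps)
      also have "\<dots> \<le> C2 * Delta H \<beta> (t, x) (s, y)"
        using low_Delta \<alpha> k1 by (intro mult_left_mono) (auto simp: C2_def)
      finally show ?thesis using lower by simp
    qed
  qed
  show ?thesis
  proof (rule exI[of _ C1], rule exI[of _ C2], intro conjI ballI)
    show "0 < C1" using \<alpha> k2 by (simp add: C1_def)
    show "0 < C2" using \<alpha> k1 by (simp add: C2_def add_nonneg_pos)
  qed (use main in auto)
qed

end
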